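(* Let $\sigma>0$ and let $K(t)=\left(1-\frac{t^2}{\sigma^2}\right)\exp\left(-\frac{t^2}{2\sigma^2}\right)$ be the Ricker wavelet. Let $\mu=\sum_{t_j\in T}a_j\delta_{t_j}$ with $T\subset\mathbb{R}$ finite and $a_j\in\mathbb{R}$. Let $S=\{s_1,\ldots,s_n\}$ be a grid of sample locations with $s_{i+1}=s_i+\tau$ and step size $\tau\in[0.0775\,\sigma,\,0.165\,\sigma]$. Let $w\in\mathbb{R}^n$, let $\mathcal{N}:=\{s_i\in S: w_i\neq 0\}$ be the set of noise locations, and let the data be $$y_i=(K*\mu)(s_i)+w_i,\qquad i=1,\ldots,n.$$ With $\mathcal{I}$ and $\mathcal{C}$ the sets of clean samples surrounding the spikes and the corruptions respectively (defined in the context), assume that $$|\mathcal{I}|=2|T|,\qquad |\mathcal{C}|=2|\mathcal{N}|,\qquad \mathcal{C}\cap\mathcal{I}=\emptyset .$$ If $\Delta(T)\geq 5.056\,\sigma$ and $\Delta(\mathcal{N})\geq 5.056\,\sigma$, then solving $$\underset{\tilde\mu,\tilde w}{\text{minimize}}\ \|\tilde\mu\|_{\mathrm{TV}}+\lambda\|\tilde w\|_1\quad\text{subject to}\quad (K*\tilde\mu)(s_i)+\tilde w_i=y_i,\ i=1,\ldots,n,$$ with parameter $\lambda:=2$ recovers $\mu$ and $w$ exactly, i.e. $(\mu,w)$ is the unique solution.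
   Context: $\delta_t$ denotes the Dirac measure at $t$, and $(K*\mu)(s)=\int K(s-t)\,d\mu(t)$. In the minimization problem, $\tilde w$ ranges over $\mathbb{R}^n$ and $\tilde\mu$ ranges over the finite signed Borel measures supported on a fixed compact interval of $\mathbb{R}$ that contains $T$; $\|\cdot\|_{\mathrm{TV}}$ is the total-variation norm of a measure (for $\sum_i b_i\delta_{t_i}$ with distinct $t_i$ it equals $\sum_i|b_i|$). For a finite set $A\subset\mathbb{R}$, its minimum separation is $\Delta(A)=\min_{a\neq a'\in A}|a-a'|$ (understood as $+\infty$ if $A$ has at most one element). The surrounding sets are $$\mathcal{I}:=\{s_i\in S\setminus\mathcal{N}: \exists t_j\in T,\ s_i\le t_j<s_{i+1}\}\cup\{s_{i+1}\in S\setminus\mathcal{N}: \exists t_j\in T,\ s_i\le t_j<s_{i+1}\},$$ $$\mathcal{C}:=\{s_{i-1}\in S\setminus\mathcal{N}: s_i\in\mathcal{N}\}\cup\{s_{i+1}\in S\setminus\mathcal{N}: s_i\in\mathcal{N}\},$$ where only indices in $\{1,\ldots,n\}$ are considered. *)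

theory Defs
  imports "HOL-Analysis.Analysis"
begin

text \<open>
  A finite signed measure on a sigma-algebra M is a real-valued set function; its values
  outside sets M are irrelevant, so two signed measures on M are equal iff they agree on sets M.
\<close>

definition signed_measure :: "'a measure \<Rightarrow> ('a set \<Rightarrow> real) \<Rightarrow> bool" where
  "signed_measure M \<nu> \<longleftrightarrow> \<nu> {} = 0 \<and>
     (\<forall>A :: nat \<Rightarrow> 'a set. range A \<subseteq> sets M \<longrightarrow> disjoint_family A \<longrightarrow>
        (\<lambda>i. \<nu> (A i)) sums \<nu> (\<Union>i. A i))"

definition signed_measure_eq :: "'a measure \<Rightarrow> ('a set \<Rightarrow> real) \<Rightarrow> ('a set \<Rightarrow> real) \<Rightarrow> bool" where
  "signed_measure_eq M \<nu> \<nu>' \<longleftrightarrow> (\<forall>A\<in>sets M. \<nu> A = \<nu>' A)"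

definition supported_on :: "'a measure \<Rightarrow> 'a set \<Rightarrow> ('a set \<Rightarrow> real) \<Rightarrow> bool" where
  "supported_on M J \<nu> \<longleftrightarrow> (\<forall>A\<in>sets M. A \<inter> J = {} \<longrightarrow> \<nu> A = 0)"

definition tv_norm :: "'a measure \<Rightarrow> ('a set \<Rightarrow> real) \<Rightarrow> ereal" where
  "tv_norm M \<nu> =
     (SUP P \<in> {P. finite P \<and> P \<subseteq> sets M \<and> disjoint P \<and> \<Union>P = space M}. ereal (\<Sum>A\<in>P. \<bar>\<nu> A\<bar>))"

text \<open>
  Upper variation: the positive part of the Jordan decomposition. The negative part is the
  upper variation of the negated set function. Negative values are truncated to 0 by ennreal,
  which is harmless because B = {} always competes in the supremum.
\<close>

definition upper_variation :: "'a measure \<Rightarrow> ('a set \<Rightarrow> real) \<Rightarrow> 'a measure" where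
  "upper_variation M \<nu> = measure_of (space M) (sets M)
     (\<lambda>A. SUP B \<in> {B \<in> sets M. B \<subseteq> A}. ennreal (\<nu> B))"

definition signed_integral :: "'a measure \<Rightarrow> ('a set \<Rightarrow> real) \<Rightarrow> ('a \<Rightarrow> real) \<Rightarrow> real" where
  "signed_integral M \<nu> f =
     (\<integral>t. f t \<partial>upper_variation M \<nu>) - (\<integral>t. f t \<partial>upper_variation M (\<lambda>A. - \<nu> A))"

definition convolve :: "(real \<Rightarrow> real) \<Rightarrow> (real set \<Rightarrow> real) \<Rightarrow> real \<Rightarrow> real" where
  "convolve K \<nu> x = signed_integral borel \<nu> (\<lambda>t. K (x - t))"

definition dirac :: "'a \<Rightarrow> 'a set \<Rightarrow> real" where
  "dirac t A = indicator A t"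

definition spikes :: "'a set \<Rightarrow> ('a \<Rightarrow> real) \<Rightarrow> 'a set \<Rightarrow> real" where
  "spikes T a = (\<lambda>A. \<Sum>t\<in>T. a t * dirac t A)"

definition ricker :: "real \<Rightarrow> real \<Rightarrow> real" where
  "ricker \<sigma> t = (1 - t\<^sup>2 / \<sigma>\<^sup>2) * exp (- (t\<^sup>2 / (2 * \<sigma>\<^sup>2)))"

text \<open>The infimum over the empty set in ereal is infinity.\<close>

definition min_separation :: "real set \<Rightarrow> ereal" where
  "min_separation A = (INF (x, y) \<in> {(x, y). x \<in> A \<and> y \<in> A \<and> x \<noteq> y}. ereal \<bar>x - y\<bar>)"

text \<open>
  Vectors in n-dimensional space are functions on nat of which only the values at 1, ..., n matter.
  The range {1..<n} below says exactly that i and i + 1 are both in {1..n}.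
\<close>

definition noise_locations :: "nat \<Rightarrow> (nat \<Rightarrow> real) \<Rightarrow> (nat \<Rightarrow> real) \<Rightarrow> real set" where
  "noise_locations n s w = {s i | i. i \<in> {1..n} \<and> w i \<noteq> 0}"

definition spike_neighbours :: "nat \<Rightarrow> (nat \<Rightarrow> real) \<Rightarrow> real set \<Rightarrow> real set \<Rightarrow> real set" where
  "spike_neighbours n s N T =
     {s i | i. i \<in> {1..<n} \<and> s i \<notin> N \<and> (\<exists>t\<in>T. s i \<le> t \<and> t < s (i + 1))} \<union>
     {s (i + 1) | i. i \<in> {1..<n} \<and> s (i + 1) \<notin> N \<and> (\<exists>t\<in>T. s i \<le> t \<and> t < s (i + 1))}"

definition noise_neighbours :: "nat \<Rightarrow> (nat \<Rightarrow> real) \<Rightarrow> real set \<Rightarrow> real set" where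
  "noise_neighbours n s N =
     {s i | i. i \<in> {1..<n} \<and> s i \<notin> N \<and> s (i + 1) \<in> N} \<union>
     {s (i + 1) | i. i \<in> {1..<n} \<and> s (i + 1) \<notin> N \<and> s i \<in> N}"

definition feasible ::
  "(real \<Rightarrow> real) \<Rightarrow> real set \<Rightarrow> nat \<Rightarrow> (nat \<Rightarrow> real) \<Rightarrow> (nat \<Rightarrow> real) \<Rightarrow>
    (real set \<Rightarrow> real) \<Rightarrow> (nat \<Rightarrow> real) \<Rightarrow> bool" where
  "feasible K J n s y \<nu> v \<longleftrightarrow>
     signed_measure borel \<nu> \<and> supported_on borel J \<nu> \<and>
     (\<forall>i\<in>{1..n}. convolve K \<nu> (s i) + v i = y i)"

definition objective :: "real \<Rightarrow> nat \<Rightarrow> (real set \<Rightarrow> real) \<Rightarrow> (nat \<Rightarrow> real) \<Rightarrow> ereal" where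
  "objective lam n \<nu> v = tv_norm borel \<nu> + ereal (lam * (\<Sum>i=1..n. \<bar>v i\<bar>))"

definition is_solution ::
  "real \<Rightarrow> (real \<Rightarrow> real) \<Rightarrow> real set \<Rightarrow> nat \<Rightarrow> (nat \<Rightarrow> real) \<Rightarrow> (nat \<Rightarrow> real) \<Rightarrow>
    (real set \<Rightarrow> real) \<Rightarrow> (nat \<Rightarrow> real) \<Rightarrow> bool" where
  "is_solution lam K J n s y \<nu> v \<longleftrightarrow>
     feasible K J n s y \<nu> v \<and>
     (\<forall>\<nu>' v'. feasible K J n s y \<nu>' v' \<longrightarrow> objective lam n \<nu> v \<le> objective lam n \<nu>' v')"

definition is_unique_solution ::
  "real \<Rightarrow> (real \<Rightarrow> real) \<Rightarrow> real set \<Rightarrow> nat \<Rightarrow> (nat \<Rightarrow> real) \<Rightarrow> (nat \<Rightarrow> real) \<Rightarrow>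
    (real set \<Rightarrow> real) \<Rightarrow> (nat \<Rightarrow> real) \<Rightarrow> bool" where
  "is_unique_solution lam K J n s y \<nu> v \<longleftrightarrow>
     is_solution lam K J n s y \<nu> v \<and>
     (\<forall>\<nu>' v'. is_solution lam K J n s y \<nu>' v' \<longrightarrow>
        signed_measure_eq borel \<nu>' \<nu> \<and> (\<forall>i\<in>{1..n}. v' i = v i))"

end

theory Submission
  imports Defs
begin

text \<open>
  A dual certificate is a combination \<open>Q\<close> of translates of the wavelet centred at the samples that
  interpolates the signs of the spikes, satisfies \<open>\<bar>Q\<bar> < 1\<close> elsewhere, and whose coefficients are twice
  the signs of the noise at corrupted samples and smaller than 2 in absolute value at clean ones.
  If \<open>(\<nu>, v)\<close> is as good as \<open>(\<mu>, w)\<close>, integrating \<open>Q\<close> against \<open>\<nu>\<close> forces \<open>\<nu>\<close> onto \<open>T\<close> and \<open>v\<close> onto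
  the corrupted samples; a second certificate, for the signs of the differences \<open>\<nu> - \<mu>\<close> and \<open>v - w\<close>,
  then shows that the differences vanish.

  Normalise \<open>\<sigma> = 1\<close>. At a corrupted sample take the coefficients \<open>-1, 2, -1\<close> (up to sign) on it and its
  two clean neighbours: this second difference contributes only \<open>O(\<tau>\<^sup>2)\<close>. The two coefficients at
  the neighbours of each spike are then determined by \<open>Q = \<plusminus>1\<close> and \<open>Q' = 0\<close> at the spikes; in suitable
  coordinates this linear system is a small perturbation of the identity. Near a spike \<open>\<bar>Q\<bar> < 1\<close> by
  concavity, away from the spikes by the decay of the wavelet.
\<close>

section \<open>Bounds for the derivatives of the Gaussian\<close>

text \<open>Spikes and corruptions may be only a few grid steps apart, so no decay separates the two
  parts of the certificate. The pattern \<open>- 1, 2, - 1\<close> answers this: summed over all of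
  \<open>N\<close> it stays below 0.094 at every point, at the price of coefficients of modulus 1 at
  the clean neighbours. The raw linear system at a spike is nearly singular, since translates by
  adjacent samples almost coincide. Hence the unknowns are the weight \<alpha> of their linear
  interpolation at the spike and the weight \<gamma> of their normalised difference. Returning to
  the samples divides \<gamma> by 3 \<tau>: the coefficients are at most
  \<open>\<bar>\<alpha>\<bar> + \<bar>\<gamma>\<bar> / (3 * \<tau>)\<close>, below 1.128 + 0.467.
  This is why the grid must not be too fine: \<gamma> contains an interaction between spikes that
  does not shrink with \<tau>. The upper limit for \<tau> controls the terms of order \<tau>^2. Away
  from the spikes the budget is 0.88 for the two nearest spikes, 0.002 for the others and 0.094 for
  the corruptions.\<close>

lemma exp_taylor_le:
  fixes x :: real
  assumes "0 \<le> x \<or> odd k"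
  shows "(\<Sum>i\<le>k. x ^ i / fact i) \<le> exp x"
proof -
  obtain t where t: "exp x = (\<Sum>i<Suc k. x ^ i / fact i) + exp t / fact (Suc k) * x ^ Suc k"
    using Maclaurin_exp_le [of x "Suc k"] by auto
  \<comment> \<open>The Lagrange remainder has the sign of \<open>x ^ Suc k\<close>; for odd
    \<open>k\<close> the exponent is even, which admits negative \<open>x\<close>.\<close>
  have "0 \<le> x ^ Suc k"
    using assms zero_le_even_power [of "Suc k" x] by auto
  then have "0 \<le> exp t / fact (Suc k) * x ^ Suc k"
    by (intro mult_nonneg_nonneg divide_nonneg_pos) simp_all
  then show ?thesis
    using t by (simp only: lessThan_Suc_atMost)
qed

text \<open>Since \<open>exp b = exp (b / 8) ^ 8\<close>, a quartic Taylor polynomial is accurate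
  enough for the arguments up to 10 that occur below, and bounds for exp become rational
  arithmetic.\<close>

lemma exp_lower_power:
  fixes b :: real
  assumes "0 \<le> b"
  shows "(1 + b / 8 + (b / 8)^2 / 2 + (b / 8)^3 / 6 + (b / 8)^4 / 24)^8 \<le> exp b"
proof -
  have "1 + b / 8 + (b / 8)^2 / 2 + (b / 8)^3 / 6 + (b / 8)^4 / 24 \<le> exp (b / 8)"
    using assms exp_taylor_le [of "b / 8" 4] by (simp add: atMost_nat_numeral fact_numeral)
  then have "(1 + b / 8 + (b / 8)^2 / 2 + (b / 8)^3 / 6 + (b / 8)^4 / 24)^8 \<le> exp (b / 8) ^ 8"
    using assms by (intro power_mono) simp_all
  also have "\<dots> = exp b"
    using exp_of_nat_mult [of 8 "b / 8"] by simp
  finally show ?thesis .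
qed
text \<open>From \<open>exp z = exp b * exp (z - b)\<close>, with the second factor replaced by a
  Taylor polynomial: a transcendental inequality becomes a polynomial identity. The alternative
  \<open>odd k\<close> serves arguments to the left of \<open>b\<close>.\<close>

lemma exp_taylor_bound:
  fixes b z E C :: real
  assumes "0 \<le> b" "E \<le> (1 + b / 8 + (b / 8)^2 / 2 + (b / 8)^3 / 6 + (b / 8)^4 / 24)^8"
    "C * (E * (\<Sum>i\<le>k. (z - b) ^ i / fact i)) - p = r"
    "0 \<le> r" "b \<le> z \<or> odd k" "0 \<le> C" "0 \<le> E"
  shows "p \<le> C * exp z"
proof -
  have "E * (\<Sum>i\<le>k. (z - b) ^ i / fact i) \<le> E * exp (z - b)"
    using exp_taylor_le [of "z - b" k] assms(5,7) by (intro mult_left_mono) auto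
  also have "\<dots> \<le> exp b * exp (z - b)"
    using order_trans [OF assms(2) exp_lower_power [OF assms(1)]] by (intro mult_right_mono) auto
  also have "\<dots> = exp z"
    by (simp flip: exp_add)
  finally have "C * (E * (\<Sum>i\<le>k. (z - b) ^ i / fact i)) \<le> C * exp z"
    by (rule mult_left_mono [OF _ assms(6)])
  then show ?thesis
    using assms(3,4) by linarith
qed

text \<open>The probabilists' Hermite polynomials, by their three-term recurrence.\<close>

fun hermite :: "nat \<Rightarrow> real \<Rightarrow> real" where
  "hermite 0 x = 1"
| "hermite (Suc 0) x = x"
| "hermite (Suc (Suc n)) x = x * hermite (Suc n) x - real (Suc n) * hermite n x"

text \<open>By Rodrigues' formula this is the \<open>n\<close>-th derivative of
  \<open>exp (- x^2 / 2)\<close>; the wavelet is minus the second one.\<close>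

definition gauss_deriv :: "nat \<Rightarrow> real \<Rightarrow> real" where
  "gauss_deriv n x = (-1) ^ n * hermite n x * exp (- (x\<^sup>2 / 2))"

lemma hermite_simps:
  "hermite 2 x = x\<^sup>2 - 1" "hermite 3 x = x * (x\<^sup>2 - 3)" "hermite 4 x = x^4 - 6 * x\<^sup>2 + 3"
  "hermite 5 x = x * (x^4 - 10 * x\<^sup>2 + 15)" "hermite 6 x = x^6 - 15 * x^4 + 45 * x\<^sup>2 - 15"
  by (simp_all add: eval_nat_numeral algebra_simps)

lemma hermite_minus: "hermite n (- x) = (-1) ^ n * hermite n x"
  by (induction n x rule: hermite.induct) (simp_all add: algebra_simps)

lemma gauss_deriv_minus: "gauss_deriv n (- x) = (-1) ^ n * gauss_deriv n x"
  by (simp add: gauss_deriv_def hermite_minus)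

lemma abs_gauss_deriv_abs: "\<bar>gauss_deriv n \<bar>x\<bar>\<bar> = \<bar>gauss_deriv n x\<bar>"
  by (cases "0 \<le> x") (simp_all add: gauss_deriv_minus abs_mult)

text \<open>Differentiating the three-term recurrence calls for the same identity at the two
  preceding indices, hence the strong induction.\<close>

lemma has_real_derivative_hermite:
  "(hermite (Suc n) has_real_derivative real (Suc n) * hermite n x) (at x)"
proof (induction n rule: less_induct)
  case (less n)
  consider "n = 0" | m where "n = Suc m"
    by (cases n) auto
  then show ?case
  proof cases
    case 1
    then show ?thesis
      by simp
  next
    case 2
    have m: "(hermite m has_real_derivative real m * hermite (m - 1) x) (at x)"
    proof (cases m)
      case 0
      then show ?thesis
        by (simp add: hermite.simps(1) [abs_def])
    next
      case (Suc k)
      then show ?thesis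
        using less [of k] 2 by simp
    qed
    have "(hermite (Suc m) has_real_derivative real (Suc m) * hermite m x) (at x)"
      using less [of m] 2 by simp
    then have "((\<lambda>x. x * hermite (Suc m) x - real (Suc m) * hermite m x) has_real_derivative
        hermite (Suc m) x + x * (real (Suc m) * hermite m x) - real (Suc m) * (real m * hermite (m - 1) x)) (at x)"
      using m by (auto intro!: derivative_eq_intros)
    moreover have "hermite (Suc m) x + x * (real (Suc m) * hermite m x) - real (Suc m) * (real m * hermite (m - 1) x)
        = real (Suc n) * hermite n x"
      using 2 by (cases m) (simp_all add: algebra_simps)
    ultimately show ?thesis
      using 2 by (simp add: hermite.simps(3) [abs_def])
  qed
qed

lemma has_real_derivative_gauss_deriv:
  "(gauss_deriv n has_real_derivative gauss_deriv (Suc n) x) (at x)"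
proof -
  have herm: "(hermite n has_real_derivative real n * hermite (n - 1) x) (at x)"
    using has_real_derivative_hermite [of "n - 1" x]
    by (cases n) (simp_all add: hermite.simps(1) [abs_def])
  have rec: "hermite (Suc n) x = x * hermite n x - real n * hermite (n - 1) x"
    by (cases n) simp_all
  show ?thesis
    unfolding gauss_deriv_def [abs_def] rec
    by (rule derivative_eq_intros herm refl | simp)+ (simp add: algebra_simps)
qed

lemma abs_gauss_deriv_leI:
  assumes "hermite n x \<le> C * exp (x\<^sup>2 / 2)" "- hermite n x \<le> C * exp (x\<^sup>2 / 2)"
  shows "\<bar>gauss_deriv n x\<bar> \<le> C"
proof -
  have "\<bar>gauss_deriv n x\<bar> = \<bar>hermite n x\<bar> / exp (x\<^sup>2 / 2)"
    by (simp add: gauss_deriv_def abs_mult exp_minus inverse_eq_divide)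
  also have "\<dots> \<le> C"
    using assms by (subst pos_divide_le_eq) (auto simp: abs_le_iff)
  finally show ?thesis .
qed

text \<open>For odd \<open>n\<close> the factor \<open>\<bar>x\<bar>\<close> is replaced by \<open>(x\<^sup>2 + c) / d\<close>, with \<open>d\<close> twice the point where
  the estimate should be sharp.\<close>

lemma abs_gauss_deriv_odd_leI:
  assumes "(2 * z + c) * q / d \<le> C * exp z" "- ((2 * z + c') * q / d') \<le> C * exp z"
    and "hermite n x = x * q" "2 * z = x\<^sup>2"
    and "0 < d" "4 * c = d\<^sup>2" "0 < d'" "4 * c' = d'\<^sup>2" "0 \<le> C"
  shows "\<bar>gauss_deriv n x\<bar> \<le> C"
proof -
  have amgm: "\<bar>x\<bar> \<le> (x\<^sup>2 + r) / s" if "0 < s" "4 * r = s\<^sup>2" for r s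
  proof -
    have "0 \<le> (\<bar>x\<bar> - s / 2)\<^sup>2"
      by simp
    then have "s * \<bar>x\<bar> \<le> x\<^sup>2 + r"
      using that by (simp add: power2_eq_square algebra_simps)
    then show ?thesis
      using that by (simp add: pos_le_divide_eq mult.commute)
  qed
  have "\<bar>x\<bar> * q \<le> C * exp z"
  proof (cases "0 \<le> q")
    case True
    then have "\<bar>x\<bar> * q \<le> (2 * z + c) / d * q"
      using amgm [OF assms(5,6)] assms(4) by (intro mult_right_mono) auto
    then show ?thesis
      using assms(1) by simp
  next
    case False
    then have "\<bar>x\<bar> * q \<le> 0"
      by (simp add: mult_nonneg_nonpos)
    then show ?thesis
      using assms(9) by (meson exp_ge_zero mult_nonneg_nonneg order_trans)
  qed
  moreover have "- (\<bar>x\<bar> * q) \<le> C * exp z"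
  proof (cases "q \<le> 0")
    case True
    then have "\<bar>x\<bar> * - q \<le> (2 * z + c') / d' * - q"
      using amgm [OF assms(7,8)] assms(4) by (intro mult_right_mono) auto
    then show ?thesis
      using assms(2) by simp
  next
    case False
    then have "- (\<bar>x\<bar> * q) \<le> 0"
      by simp
    then show ?thesis
      using assms(9) by (meson exp_ge_zero mult_nonneg_nonneg order_trans)
  qed
  ultimately have "\<bar>x * q\<bar> \<le> C * exp z"
    by (cases "0 \<le> x") (simp_all add: abs_le_iff)
  moreover have "z = x\<^sup>2 / 2"
    using assms(4) by simp
  ultimately show ?thesis
    using assms(3) by (intro abs_gauss_deriv_leI) (simp_all add: abs_le_iff)
qed

text \<open>
  In each of the following bounds \<open>r\<close> is a visibly nonnegative form of the difference between a
  multiple of a Taylor polynomial of \<open>exp\<close> at \<open>b\<close> and the Hermite polynomial, both in \<open>z = x\<^sup>2 / 2\<close>.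
  The number \<open>E\<close> is a rational lower bound of \<open>exp b\<close>.
\<close>

lemmas taylor_simps = atMost_nat_numeral fact_numeral field_simps power_numeral_reduce

lemma abs_gauss_deriv_2_le_from_0_52:
  assumes "13/25 \<le> \<bar>x\<bar>"
  shows "\<bar>gauss_deriv 2 x\<bar> \<le> 16/25"
proof -
  define z where "z = x\<^sup>2 / 2"
  have z_ge: "27/200 \<le> z"
    using abs_le_square_iff [of "13/25" x] assms by (simp add: z_def power2_eq_square)
  define w where "w = z - 27/200"
  have z_eq: "z = 27/200 + w" and w_nonneg: "0 \<le> w"
    using z_ge by (simp_all add: w_def)
  have bound1: "-1 + 2 * z \<le> 16/25 * exp z"
  proof (rule exp_taylor_bound [where b = "27/200" and E = "143/125" and k = 2
      and r = "1981/6250 * ((w - 2)^2) + 2429/12500 + 307/6250 * w^2"])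
    show "16/25 * (143/125 * (\<Sum>i\<le>2. (z - 27/200) ^ i / fact i)) - (-1 + 2 * z)
      = 1981/6250 * ((w - 2)^2) + 2429/12500 + 307/6250 * w^2"
      unfolding z_eq by (simp add: taylor_simps)
  qed (use z_ge w_nonneg in \<open>simp_all add: power_divide\<close>)
  have bound2: "- (-1 + 2 * z) \<le> 16/25 * exp z"
  proof (rule exp_taylor_bound [where b = "27/200" and E = "143/125" and k = 1
      and r = "27/12500 + 8538/3125 * w"])
    show "16/25 * (143/125 * (\<Sum>i\<le>1. (z - 27/200) ^ i / fact i)) - (- (-1 + 2 * z))
      = 27/12500 + 8538/3125 * w"
      unfolding z_eq by (simp add: taylor_simps)
  qed (use z_ge w_nonneg in \<open>simp_all add: power_divide\<close>)
  show ?thesis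
    using bound1 bound2 by (intro abs_gauss_deriv_leI) (simp_all add: hermite_simps z_def power_divide)
qed

lemma abs_gauss_deriv_2_le_from_1:
  assumes "1 \<le> \<bar>x\<bar>"
  shows "\<bar>gauss_deriv 2 x\<bar> \<le> 447/1000"
proof -
  define z where "z = x\<^sup>2 / 2"
  have z_ge: "1/2 \<le> z"
    using abs_le_square_iff [of "1" x] assms by (simp add: z_def power2_eq_square)
  define w where "w = z - 1/2"
  have z_eq: "z = 1/2 + w" and w_nonneg: "0 \<le> w"
    using z_ge by (simp_all add: w_def)
  have bound1: "-1 + 2 * z \<le> 447/1000 * exp z"
  \<comment> \<open>The quotient \<open>(2 * z - 1) / exp z\<close> is maximal at
    \<open>z = 3/2\<close>, with value about 0.4463, so the tangent of exp at this point
    suffices.\<close>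
  proof (rule exp_taylor_bound [where b = "3/2" and E = "4481/1000" and k = 1
      and r = "3007/1000000 * w"])
    show "447/1000 * (4481/1000 * (\<Sum>i\<le>1. (z - 3/2) ^ i / fact i)) - (-1 + 2 * z)
      = 3007/1000000 * w"
      unfolding z_eq by (simp add: taylor_simps)
  qed (use z_ge w_nonneg in \<open>simp_all add: power_divide\<close>)
  have bound2: "- (-1 + 2 * z) \<le> 447/1000 * exp z"
  proof (rule exp_taylor_bound [where b = "1/2" and E = "206/125" and k = 1
      and r = "46041/62500 + 171041/62500 * w"])
    show "447/1000 * (206/125 * (\<Sum>i\<le>1. (z - 1/2) ^ i / fact i)) - (- (-1 + 2 * z))
      = 46041/62500 + 171041/62500 * w"
      unfolding z_eq by (simp add: taylor_simps)
  qed (use z_ge w_nonneg in \<open>simp_all add: power_divide\<close>)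
  show ?thesis
    using bound1 bound2 by (intro abs_gauss_deriv_leI) (simp_all add: hermite_simps z_def power_divide)
qed

lemma abs_gauss_deriv_2_le_from_2:
  assumes "2 \<le> \<bar>x\<bar>"
  shows "\<bar>gauss_deriv 2 x\<bar> \<le> 41/100"
proof -
  define z where "z = x\<^sup>2 / 2"
  have z_ge: "2 \<le> z"
    using abs_le_square_iff [of "2" x] assms by (simp add: z_def power2_eq_square)
  define w where "w = z - 2"
  have z_eq: "z = 2 + w" and w_nonneg: "0 \<le> w"
    using z_ge by (simp_all add: w_def)
  have bound1: "-1 + 2 * z \<le> 41/100 * exp z"
  proof (rule exp_taylor_bound [where b = "2" and E = "1847/250" and k = 1
      and r = "727/25000 + 25727/25000 * w"])
    show "41/100 * (1847/250 * (\<Sum>i\<le>1. (z - 2) ^ i / fact i)) - (-1 + 2 * z)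
      = 727/25000 + 25727/25000 * w"
      unfolding z_eq by (simp add: taylor_simps)
  qed (use z_ge w_nonneg in \<open>simp_all add: power_divide\<close>)
  have bound2: "- (-1 + 2 * z) \<le> 41/100 * exp z"
  proof (rule exp_taylor_bound [where b = "2" and E = "1847/250" and k = 1
      and r = "150727/25000 + 125727/25000 * w"])
    show "41/100 * (1847/250 * (\<Sum>i\<le>1. (z - 2) ^ i / fact i)) - (- (-1 + 2 * z))
      = 150727/25000 + 125727/25000 * w"
      unfolding z_eq by (simp add: taylor_simps)
  qed (use z_ge w_nonneg in \<open>simp_all add: power_divide\<close>)
  show ?thesis
    using bound1 bound2 by (intro abs_gauss_deriv_leI) (simp_all add: hermite_simps z_def power_divide)
qed

lemma abs_gauss_deriv_2_le_from_2_5: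
  assumes "5/2 \<le> \<bar>x\<bar>"
  shows "\<bar>gauss_deriv 2 x\<bar> \<le> 6/25"
proof -
  define z where "z = x\<^sup>2 / 2"
  have z_ge: "25/8 \<le> z"
    using abs_le_square_iff [of "5/2" x] assms by (simp add: z_def power2_eq_square)
  define w where "w = z - 25/8"
  have z_eq: "z = 25/8 + w" and w_nonneg: "0 \<le> w"
    using z_ge by (simp_all add: w_def)
  have bound1: "-1 + 2 * z \<le> 6/25 * exp z"
  proof (rule exp_taylor_bound [where b = "25/8" and E = "1137/50" and k = 1
      and r = "519/2500 + 2161/625 * w"])
    show "6/25 * (1137/50 * (\<Sum>i\<le>1. (z - 25/8) ^ i / fact i)) - (-1 + 2 * z)
      = 519/2500 + 2161/625 * w"
      unfolding z_eq by (simp add: taylor_simps)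
  qed (use z_ge w_nonneg in \<open>simp_all add: power_divide\<close>)
  have bound2: "- (-1 + 2 * z) \<le> 6/25 * exp z"
  proof (rule exp_taylor_bound [where b = "25/8" and E = "1137/50" and k = 1
      and r = "26769/2500 + 4661/625 * w"])
    show "6/25 * (1137/50 * (\<Sum>i\<le>1. (z - 25/8) ^ i / fact i)) - (- (-1 + 2 * z))
      = 26769/2500 + 4661/625 * w"
      unfolding z_eq by (simp add: taylor_simps)
  qed (use z_ge w_nonneg in \<open>simp_all add: power_divide\<close>)
  show ?thesis
    using bound1 bound2 by (intro abs_gauss_deriv_leI) (simp_all add: hermite_simps z_def power_divide)
qed

lemma abs_gauss_deriv_2_le_from_3:
  assumes "3 \<le> \<bar>x\<bar>"
  shows "\<bar>gauss_deriv 2 x\<bar> \<le> 9/100"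
proof -
  define z where "z = x\<^sup>2 / 2"
  have z_ge: "9/2 \<le> z"
    using abs_le_square_iff [of "3" x] assms by (simp add: z_def power2_eq_square)
  define w where "w = z - 9/2"
  have z_eq: "z = 9/2 + w" and w_nonneg: "0 \<le> w"
    using z_ge by (simp_all add: w_def)
  have bound1: "-1 + 2 * z \<le> 9/100 * exp z"
  proof (rule exp_taylor_bound [where b = "9/2" and E = "449/5" and k = 1
      and r = "41/500 + 3041/500 * w"])
    show "9/100 * (449/5 * (\<Sum>i\<le>1. (z - 9/2) ^ i / fact i)) - (-1 + 2 * z)
      = 41/500 + 3041/500 * w"
      unfolding z_eq by (simp add: taylor_simps)
  qed (use z_ge w_nonneg in \<open>simp_all add: power_divide\<close>)
  have bound2: "- (-1 + 2 * z) \<le> 9/100 * exp z"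
  proof (rule exp_taylor_bound [where b = "9/2" and E = "449/5" and k = 1
      and r = "8041/500 + 5041/500 * w"])
    show "9/100 * (449/5 * (\<Sum>i\<le>1. (z - 9/2) ^ i / fact i)) - (- (-1 + 2 * z))
      = 8041/500 + 5041/500 * w"
      unfolding z_eq by (simp add: taylor_simps)
  qed (use z_ge w_nonneg in \<open>simp_all add: power_divide\<close>)
  show ?thesis
    using bound1 bound2 by (intro abs_gauss_deriv_leI) (simp_all add: hermite_simps z_def power_divide)
qed

lemma abs_gauss_deriv_2_le_from_4:
  assumes "4 \<le> \<bar>x\<bar>"
  shows "\<bar>gauss_deriv 2 x\<bar> \<le> 3/500"
proof -
  define z where "z = x\<^sup>2 / 2"
  have z_ge: "8 \<le> z"
    using abs_le_square_iff [of "4" x] assms by (simp add: z_def power2_eq_square)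
  define w where "w = z - 8"
  have z_eq: "z = 8 + w" and w_nonneg: "0 \<le> w"
    using z_ge by (simp_all add: w_def)
  have bound1: "-1 + 2 * z \<le> 3/500 * exp z"
  proof (rule exp_taylor_bound [where b = "8" and E = "2894" and k = 1
      and r = "591/250 + 3841/250 * w"])
    show "3/500 * (2894 * (\<Sum>i\<le>1. (z - 8) ^ i / fact i)) - (-1 + 2 * z)
      = 591/250 + 3841/250 * w"
      unfolding z_eq by (simp add: taylor_simps)
  qed (use z_ge w_nonneg in \<open>simp_all add: power_divide\<close>)
  have bound2: "- (-1 + 2 * z) \<le> 3/500 * exp z"
  proof (rule exp_taylor_bound [where b = "8" and E = "2894" and k = 1
      and r = "8091/250 + 4841/250 * w"])
    show "3/500 * (2894 * (\<Sum>i\<le>1. (z - 8) ^ i / fact i)) - (- (-1 + 2 * z))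
      = 8091/250 + 4841/250 * w"
      unfolding z_eq by (simp add: taylor_simps)
  qed (use z_ge w_nonneg in \<open>simp_all add: power_divide\<close>)
  show ?thesis
    using bound1 bound2 by (intro abs_gauss_deriv_leI) (simp_all add: hermite_simps z_def power_divide)
qed

lemma abs_gauss_deriv_3_le:
  shows "\<bar>gauss_deriv 3 x\<bar> \<le> 7/5"
proof -
  define z where "z = x\<^sup>2 / 2"
  have z_nonneg: "0 \<le> z"
    by (simp add: z_def)
  have bound1: "(2 * z + 49/4) * (-3 + 2 * z) / 7 \<le> 7/5 * exp z"
  proof (rule exp_taylor_bound [where b = "0" and E = "1" and k = 2
      and r = "87/700 * ((z - 5)^2) + 124/35 + 3/700 * z^2"])
    show "7/5 * (1 * (\<Sum>i\<le>2. (z - 0) ^ i / fact i)) - ((2 * z + 49/4) * (-3 + 2 * z) / 7)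
      = 87/700 * ((z - 5)^2) + 124/35 + 3/700 * z^2"
      by (simp add: taylor_simps)
  qed (use z_nonneg in \<open>simp_all add: power_divide\<close>)
  have bound2: "- ((2 * z + 16/25) * (-3 + 2 * z) / (8/5)) \<le> 7/5 * exp z"
  proof (rule exp_taylor_bound [where b = "0" and E = "1" and k = 2
      and r = "31/10 * ((z - 1/4)^2) + 1/160 + 1/10 * z^2"])
    show "7/5 * (1 * (\<Sum>i\<le>2. (z - 0) ^ i / fact i)) - (- ((2 * z + 16/25) * (-3 + 2 * z) / (8/5)))
      = 31/10 * ((z - 1/4)^2) + 1/160 + 1/10 * z^2"
      by (simp add: taylor_simps)
  qed (use z_nonneg in \<open>simp_all add: power_divide\<close>)
  show ?thesis
    by (rule abs_gauss_deriv_odd_leI [OF bound1 bound2]) (simp_all add: hermite_simps z_def power_divide algebra_simps flip: power_mult)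
qed

lemma abs_gauss_deriv_3_le_from_1_8:
  assumes "9/5 \<le> \<bar>x\<bar>"
  shows "\<bar>gauss_deriv 3 x\<bar> \<le> 2/5"
proof -
  define z where "z = x\<^sup>2 / 2"
  have z_ge: "81/50 \<le> z"
    using abs_le_square_iff [of "9/5" x] assms by (simp add: z_def power2_eq_square)
  define w where "w = z - 81/50"
  have z_eq: "z = 81/50 + w" and w_nonneg: "0 \<le> w"
    using z_ge by (simp_all add: w_def)
  have bound1: "(2 * z + 729/100) * (-3 + 2 * z) / (27/5) \<le> 2/5 * exp z"
  proof (rule exp_taylor_bound [where b = "78/25" and E = "2263/100" and k = 3
      and r = "81101/54000 * (w * (w - 1)^2) + 391/4000 + 2251/13500 * w + 367/54000 * w^3"])
    show "2/5 * (2263/100 * (\<Sum>i\<le>3. (z - 78/25) ^ i / fact i)) - ((2 * z + 729/100) * (-3 + 2 * z) / (27/5))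
      = 81101/54000 * (w * (w - 1)^2) + 391/4000 + 2251/13500 * w + 367/54000 * w^3"
      unfolding z_eq by (simp add: taylor_simps)
  qed (use z_ge w_nonneg in \<open>simp_all add: power_divide\<close>)
  have bound2: "- ((2 * z + 1) * (-3 + 2 * z) / 2) \<le> 2/5 * exp z"
  proof (rule exp_taylor_bound [where b = "81/50" and E = "1263/250" and k = 1
      and r = "1581/625 + 4063/625 * w + 2 * w^2"])
    show "2/5 * (1263/250 * (\<Sum>i\<le>1. (z - 81/50) ^ i / fact i)) - (- ((2 * z + 1) * (-3 + 2 * z) / 2))
      = 1581/625 + 4063/625 * w + 2 * w^2"
      unfolding z_eq by (simp add: taylor_simps)
  qed (use z_ge w_nonneg in \<open>simp_all add: power_divide\<close>)
  show ?thesis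
    by (rule abs_gauss_deriv_odd_leI [OF bound1 bound2]) (simp_all add: hermite_simps z_def power_divide algebra_simps flip: power_mult)
qed

lemma abs_gauss_deriv_4_le:
  shows "\<bar>gauss_deriv 4 x\<bar> \<le> 3"
proof -
  define z where "z = x\<^sup>2 / 2"
  have z_nonneg: "0 \<le> z"
    by (simp add: z_def)
  have bound1: "3 - 12 * z + 4 * z^2 \<le> 3 * exp z"
  proof (rule exp_taylor_bound [where b = "0" and E = "1" and k = 3
      and r = "1/2 * (z * (z - 5/2)^2) + 95/8 * z"])
    show "3 * (1 * (\<Sum>i\<le>3. (z - 0) ^ i / fact i)) - (3 - 12 * z + 4 * z^2)
      = 1/2 * (z * (z - 5/2)^2) + 95/8 * z"
      by (simp add: taylor_simps)
  qed (use z_nonneg in \<open>simp_all add: power_divide\<close>)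
  have bound2: "- (3 - 12 * z + 4 * z^2) \<le> 3 * exp z"
  proof (rule exp_taylor_bound [where b = "0" and E = "1" and k = 1
      and r = "18/5 * ((z - 5/4)^2) + 3/8 + 2/5 * z^2"])
    show "3 * (1 * (\<Sum>i\<le>1. (z - 0) ^ i / fact i)) - (- (3 - 12 * z + 4 * z^2))
      = 18/5 * ((z - 5/4)^2) + 3/8 + 2/5 * z^2"
      by (simp add: taylor_simps)
  qed (use z_nonneg in \<open>simp_all add: power_divide\<close>)
  show ?thesis
    using bound1 bound2 by (intro abs_gauss_deriv_leI) (simp_all add: hermite_simps z_def power_divide)
qed

lemma abs_gauss_deriv_4_le_from_1_5:
  assumes "3/2 \<le> \<bar>x\<bar>"
  shows "\<bar>gauss_deriv 4 x\<bar> \<le> 29/10"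
proof -
  define z where "z = x\<^sup>2 / 2"
  have z_ge: "9/8 \<le> z"
    using abs_le_square_iff [of "3/2" x] assms by (simp add: z_def power2_eq_square)
  define w where "w = z - 9/8"
  have z_eq: "z = 9/8 + w" and w_nonneg: "0 \<le> w"
    using z_ge by (simp_all add: w_def)
  have bound1: "3 - 12 * z + 4 * z^2 \<le> 29/10 * exp z"
  proof (rule exp_taylor_bound [where b = "9/8" and E = "77/25" and k = 2
      and r = "28739/2000 + 2983/250 * w + 233/500 * w^2"])
    show "29/10 * (77/25 * (\<Sum>i\<le>2. (z - 9/8) ^ i / fact i)) - (3 - 12 * z + 4 * z^2)
      = 28739/2000 + 2983/250 * w + 233/500 * w^2"
      unfolding z_eq by (simp add: taylor_simps)
  qed (use z_ge w_nonneg in \<open>simp_all add: power_divide\<close>)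
  have bound2: "- (3 - 12 * z + 4 * z^2) \<le> 29/10 * exp z"
  proof (rule exp_taylor_bound [where b = "9/8" and E = "77/25" and k = 1
      and r = "6989/2000 + 1483/250 * w + 4 * w^2"])
    show "29/10 * (77/25 * (\<Sum>i\<le>1. (z - 9/8) ^ i / fact i)) - (- (3 - 12 * z + 4 * z^2))
      = 6989/2000 + 1483/250 * w + 4 * w^2"
      unfolding z_eq by (simp add: taylor_simps)
  qed (use z_ge w_nonneg in \<open>simp_all add: power_divide\<close>)
  show ?thesis
    using bound1 bound2 by (intro abs_gauss_deriv_leI) (simp_all add: hermite_simps z_def power_divide)
qed

lemma abs_gauss_deriv_4_le_from_2_5:
  assumes "5/2 \<le> \<bar>x\<bar>"
  shows "\<bar>gauss_deriv 4 x\<bar> \<le> 21/50"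
proof -
  define z where "z = x\<^sup>2 / 2"
  have z_ge: "25/8 \<le> z"
    using abs_le_square_iff [of "5/2" x] assms by (simp add: z_def power2_eq_square)
  define w where "w = z - 25/8"
  have z_eq: "z = 25/8 + w" and w_nonneg: "0 \<le> w"
    using z_ge by (simp_all add: w_def)
  have bound1: "3 - 12 * z + 4 * z^2 \<le> 21/50 * exp z"
  proof (rule exp_taylor_bound [where b = "25/8" and E = "1137/50" and k = 2
      and r = "8623/12500 * ((w - 5/2)^2) + 423/625 + 2139/25000 * w^2"])
    show "21/50 * (1137/50 * (\<Sum>i\<le>2. (z - 25/8) ^ i / fact i)) - (3 - 12 * z + 4 * z^2)
      = 8623/12500 * ((w - 5/2)^2) + 423/625 + 2139/25000 * w^2"
      unfolding z_eq by (simp add: taylor_simps)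
  qed (use z_ge w_nonneg in \<open>simp_all add: power_divide\<close>)
  have bound2: "- (3 - 12 * z + 4 * z^2) \<le> 21/50 * exp z"
  proof (rule exp_taylor_bound [where b = "25/8" and E = "1137/50" and k = 1
      and r = "141133/10000 + 56377/2500 * w + 4 * w^2"])
    show "21/50 * (1137/50 * (\<Sum>i\<le>1. (z - 25/8) ^ i / fact i)) - (- (3 - 12 * z + 4 * z^2))
      = 141133/10000 + 56377/2500 * w + 4 * w^2"
      unfolding z_eq by (simp add: taylor_simps)
  qed (use z_ge w_nonneg in \<open>simp_all add: power_divide\<close>)
  show ?thesis
    using bound1 bound2 by (intro abs_gauss_deriv_leI) (simp_all add: hermite_simps z_def power_divide)
qed

lemma abs_gauss_deriv_5_le_from_1_5:
  assumes "3/2 \<le> \<bar>x\<bar>"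
  shows "\<bar>gauss_deriv 5 x\<bar> \<le> 16/5"
proof -
  define z where "z = x\<^sup>2 / 2"
  have z_ge: "9/8 \<le> z"
    using abs_le_square_iff [of "3/2" x] assms by (simp add: z_def power2_eq_square)
  define w where "w = z - 9/8"
  have z_eq: "z = 9/8 + w" and w_nonneg: "0 \<le> w"
    using z_ge by (simp_all add: w_def)
  have bound1: "(2 * z + 25/4) * (15 - 20 * z + 4 * z^2) / 5 \<le> 16/5 * exp z"
  proof (rule exp_taylor_bound [where b = "9/8" and E = "77/25" and k = 3
      and r = "55999/4000 + 29531/1000 * w + 316/125 * w^2 + 16/375 * w^3"])
    show "16/5 * (77/25 * (\<Sum>i\<le>3. (z - 9/8) ^ i / fact i)) - ((2 * z + 25/4) * (15 - 20 * z + 4 * z^2) / 5)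
      = 55999/4000 + 29531/1000 * w + 316/125 * w^2 + 16/375 * w^3"
      unfolding z_eq by (simp add: taylor_simps)
  qed (use z_ge w_nonneg in \<open>simp_all add: power_divide\<close>)
  have bound2: "- ((2 * z + 4) * (15 - 20 * z + 4 * z^2) / 4) \<le> 16/5 * exp z"
  proof (rule exp_taylor_bound [where b = "9/8" and E = "77/25" and k = 2
      and r = "34201/8000 * ((w - 1)^2) + 56713/32000 + 11223/8000 * w^2 + 2 * w^3"])
    show "16/5 * (77/25 * (\<Sum>i\<le>2. (z - 9/8) ^ i / fact i)) - (- ((2 * z + 4) * (15 - 20 * z + 4 * z^2) / 4))
      = 34201/8000 * ((w - 1)^2) + 56713/32000 + 11223/8000 * w^2 + 2 * w^3"
      unfolding z_eq by (simp add: taylor_simps)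
  qed (use z_ge w_nonneg in \<open>simp_all add: power_divide\<close>)
  show ?thesis
    by (rule abs_gauss_deriv_odd_leI [OF bound1 bound2]) (simp_all add: hermite_simps z_def power_divide algebra_simps flip: power_mult)
qed

lemma abs_gauss_deriv_5_le_from_3_5:
  assumes "7/2 \<le> \<bar>x\<bar>"
  shows "\<bar>gauss_deriv 5 x\<bar> \<le> 1/2"
proof -
  define z where "z = x\<^sup>2 / 2"
  have z_ge: "49/8 \<le> z"
    using abs_le_square_iff [of "7/2" x] assms by (simp add: z_def power2_eq_square)
  define w where "w = z - 49/8"
  have z_eq: "z = 49/8 + w" and w_nonneg: "0 \<le> w"
    using z_ge by (simp_all add: w_def)
  have bound1: "(2 * z + 4) * (15 - 20 * z + 4 * z^2) / 4 \<le> 1/2 * exp z"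
  proof (rule exp_taylor_bound [where b = "49/8" and E = "4529/10" and k = 3
      and r = "68531/1280 + 13977/160 * w + 3299/40 * w^2 + 4289/120 * w^3"])
    show "1/2 * (4529/10 * (\<Sum>i\<le>3. (z - 49/8) ^ i / fact i)) - ((2 * z + 4) * (15 - 20 * z + 4 * z^2) / 4)
      = 68531/1280 + 13977/160 * w + 3299/40 * w^2 + 4289/120 * w^3"
      unfolding z_eq by (simp add: taylor_simps)
  qed (use z_ge w_nonneg in \<open>simp_all add: power_divide\<close>)
  have bound2: "- ((2 * z + 1) * (15 - 20 * z + 4 * z^2) / 2) \<le> 1/2 * exp z"
  proof (rule exp_taylor_bound [where b = "49/8" and E = "4529/10" and k = 1
      and r = "325393/640 + 36891/80 * w + 111/2 * w^2 + 4 * w^3"])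
    show "1/2 * (4529/10 * (\<Sum>i\<le>1. (z - 49/8) ^ i / fact i)) - (- ((2 * z + 1) * (15 - 20 * z + 4 * z^2) / 2))
      = 325393/640 + 36891/80 * w + 111/2 * w^2 + 4 * w^3"
      unfolding z_eq by (simp add: taylor_simps)
  qed (use z_ge w_nonneg in \<open>simp_all add: power_divide\<close>)
  show ?thesis
    by (rule abs_gauss_deriv_odd_leI [OF bound1 bound2]) (simp_all add: hermite_simps z_def power_divide algebra_simps flip: power_mult)
qed

lemma abs_gauss_deriv_6_le:
  shows "\<bar>gauss_deriv 6 x\<bar> \<le> 15"
proof -
  define z where "z = x\<^sup>2 / 2"
  have z_nonneg: "0 \<le> z"
    by (simp add: z_def)
  have bound1: "-15 + 90 * z - 60 * z^2 + 8 * z^3 \<le> 15 * exp z"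
  proof (rule exp_taylor_bound [where b = "0" and E = "1" and k = 4
      and r = "50 * ((z - 3/4)^2) + 11/20 * (z^2 * (z - 5)^2) + 15/8 + 15/4 * z^2 + 3/40 * z^4"])
    show "15 * (1 * (\<Sum>i\<le>4. (z - 0) ^ i / fact i)) - (-15 + 90 * z - 60 * z^2 + 8 * z^3)
      = 50 * ((z - 3/4)^2) + 11/20 * (z^2 * (z - 5)^2) + 15/8 + 15/4 * z^2 + 3/40 * z^4"
      by (simp add: taylor_simps)
  qed (use z_nonneg in \<open>simp_all add: power_divide\<close>)
  have bound2: "- (-15 + 90 * z - 60 * z^2 + 8 * z^3) \<le> 15 * exp z"
  proof (rule exp_taylor_bound [where b = "0" and E = "1" and k = 2
      and r = "105/16 * (z * (z - 4)^2) + 23/16 * z^3"])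
    show "15 * (1 * (\<Sum>i\<le>2. (z - 0) ^ i / fact i)) - (- (-15 + 90 * z - 60 * z^2 + 8 * z^3))
      = 105/16 * (z * (z - 4)^2) + 23/16 * z^3"
      by (simp add: taylor_simps)
  qed (use z_nonneg in \<open>simp_all add: power_divide\<close>)
  show ?thesis
    using bound1 bound2 by (intro abs_gauss_deriv_leI) (simp_all add: hermite_simps z_def power_divide)
qed

lemma abs_gauss_deriv_6_le_from_1_5:
  assumes "3/2 \<le> \<bar>x\<bar>"
  shows "\<bar>gauss_deriv 6 x\<bar> \<le> 79/10"
proof -
  define z where "z = x\<^sup>2 / 2"
  have z_ge: "9/8 \<le> z"
    using abs_le_square_iff [of "3/2" x] assms by (simp add: z_def power2_eq_square)
  define w where "w = z - 9/8"
  have z_eq: "z = 9/8 + w" and w_nonneg: "0 \<le> w"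
    using z_ge by (simp_all add: w_def)
  have bound1: "-15 + 90 * z - 60 * z^2 + 8 * z^3 \<le> 79/10 * exp z"
  proof (rule exp_taylor_bound [where b = "9/8" and E = "77/25" and k = 4
      and r = "5917/6000 * (w^2 * (w - 2)^2) + 21031/8000 + 38957/1000 * w + 15458/375 * w^2 + 83/3000 * w^4"])
    show "79/10 * (77/25 * (\<Sum>i\<le>4. (z - 9/8) ^ i / fact i)) - (-15 + 90 * z - 60 * z^2 + 8 * z^3)
      = 5917/6000 * (w^2 * (w - 2)^2) + 21031/8000 + 38957/1000 * w + 15458/375 * w^2 + 83/3000 * w^4"
      unfolding z_eq by (simp add: taylor_simps)
  qed (use z_ge w_nonneg in \<open>simp_all add: power_divide\<close>)
  have bound2: "- (-15 + 90 * z - 60 * z^2 + 8 * z^3) \<le> 79/10 * exp z"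
  proof (rule exp_taylor_bound [where b = "81/40" and E = "303/40" and k = 1
      and r = "33/5 * (w * (w - 5/2)^2) + 221499/8000 + 1587/400 * w + 7/5 * w^3"])
    show "79/10 * (303/40 * (\<Sum>i\<le>1. (z - 81/40) ^ i / fact i)) - (- (-15 + 90 * z - 60 * z^2 + 8 * z^3))
      = 33/5 * (w * (w - 5/2)^2) + 221499/8000 + 1587/400 * w + 7/5 * w^3"
      unfolding z_eq by (simp add: taylor_simps)
  qed (use z_ge w_nonneg in \<open>simp_all add: power_divide\<close>)
  show ?thesis
    using bound1 bound2 by (intro abs_gauss_deriv_leI) (simp_all add: hermite_simps z_def power_divide)
qed

lemma abs_gauss_deriv_6_le_from_3_5:
  assumes "7/2 \<le> \<bar>x\<bar>"
  shows "\<bar>gauss_deriv 6 x\<bar> \<le> 7/10"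
proof -
  define z where "z = x\<^sup>2 / 2"
  have z_ge: "49/8 \<le> z"
    using abs_le_square_iff [of "7/2" x] assms by (simp add: z_def power2_eq_square)
  define w where "w = z - 49/8"
  have z_eq: "z = 49/8 + w" and w_nonneg: "0 \<le> w"
    using z_ge by (simp_all add: w_def)
  have bound1: "-15 + 90 * z - 60 * z^2 + 8 * z^3 \<le> 7/10 * exp z"
  proof (rule exp_taylor_bound [where b = "49/8" and E = "4529/10" and k = 3
      and r = "309523/1600 + 12331/200 * w + 14303/200 * w^2 + 26903/600 * w^3"])
    show "7/10 * (4529/10 * (\<Sum>i\<le>3. (z - 49/8) ^ i / fact i)) - (-15 + 90 * z - 60 * z^2 + 8 * z^3)
      = 309523/1600 + 12331/200 * w + 14303/200 * w^2 + 26903/600 * w^3"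
      unfolding z_eq by (simp add: taylor_simps)
  qed (use z_ge w_nonneg in \<open>simp_all add: power_divide\<close>)
  have bound2: "- (-15 + 90 * z - 60 * z^2 + 8 * z^3) \<le> 7/10 * exp z"
  proof (rule exp_taylor_bound [where b = "49/8" and E = "4529/10" and k = 1
      and r = "704973/1600 + 114481/200 * w + 87 * w^2 + 8 * w^3"])
    show "7/10 * (4529/10 * (\<Sum>i\<le>1. (z - 49/8) ^ i / fact i)) - (- (-15 + 90 * z - 60 * z^2 + 8 * z^3))
      = 704973/1600 + 114481/200 * w + 87 * w^2 + 8 * w^3"
      unfolding z_eq by (simp add: taylor_simps)
  qed (use z_ge w_nonneg in \<open>simp_all add: power_divide\<close>)
  show ?thesis
    using bound1 bound2 by (intro abs_gauss_deriv_leI) (simp_all add: hermite_simps z_def power_divide)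
qed

text \<open>The maximum, about 5.78 near 0.617, is close to the bound. Below 3/2 the quadratic
  Taylor polynomial of exp in \<open>y^2 / 2\<close> is sharp enough; the positive side is split at
  7/10.\<close>

lemma abs_gauss_deriv_5_le: "\<bar>gauss_deriv 5 x\<bar> \<le> 59/10"
proof (cases "3/2 \<le> \<bar>x\<bar>")
  case True
  then show ?thesis
    using abs_gauss_deriv_5_le_from_1_5 [of x] by simp
next
  case False
  define y where "y = \<bar>x\<bar>"
  have y: "0 \<le> y" "y \<le> 3/2"
    using False by (simp_all add: y_def)
  have taylor: "59/10 * (1 + y\<^sup>2 / 2 + y^4 / 8) \<le> 59/10 * exp (y\<^sup>2 / 2)"
    using exp_taylor_le [of "y\<^sup>2 / 2" 2]
    by (simp add: atMost_nat_numeral fact_numeral power_divide flip: power_mult)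
  have "y * (y^4 - 10 * y\<^sup>2 + 15) \<le> 59/10 * (1 + y\<^sup>2 / 2 + y^4 / 8)"
  proof (cases "y \<le> 7/10")
    case True
    \<comment> \<open>The squares are centred near the maximum 0.617. The quintic term is absorbed
      by the quartic one, because \<open>y \<le> 7/10 < 59/80\<close>.\<close>
    have "59/10 * (1 + y\<^sup>2 / 2 + y^4 / 8) - y * (y^4 - 10 * y\<^sup>2 + 15)
        = 10 * (y * (y - 31/50)\<^sup>2) + 307/20 * (y - 4711/7675)\<^sup>2
          + (59/10 - 307/20 * (4711/7675)\<^sup>2) + y^4 * (59/80 - y)"
      by (simp add: field_simps power_numeral_reduce)
    moreover have "0 \<le> 10 * (y * (y - 31/50)\<^sup>2) + 307/20 * (y - 4711/7675)\<^sup>2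
          + (59/10 - 307/20 * (4711/7675)\<^sup>2)"
      using y by (intro add_nonneg_nonneg) (simp_all add: power_divide)
    moreover have "0 \<le> y^4 * (59/80 - y)"
      using True by simp
    ultimately show ?thesis
      by linarith
  next
    case False
    define w where "w = y - 7/10"
    have y_eq: "y = 7/10 + w" and w: "0 \<le> w" "w \<le> 4/5"
      using False y by (simp_all add: w_def)
    have "59/10 * (1 + y\<^sup>2 / 2 + y^4 / 8) - y * (y^4 - 10 * y\<^sup>2 + 15)
        = 227603/800000 + 72827/20000 * w + 90753/4000 * w^2 + w^3 * (1433/200 - 221/80 * w - w * w)"
      unfolding y_eq by (simp add: field_simps power_numeral_reduce)
    moreover have "w * w \<le> 4/5 * (4/5)"
      using w by (intro mult_mono) simp_all
    then have "0 \<le> w^3 * (1433/200 - 221/80 * w - w * w)"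
      using w by (intro mult_nonneg_nonneg) simp_all
    ultimately show ?thesis
      using w zero_le_power2 [of w] by linarith
  qed
  then have "y * (y^4 - 10 * y\<^sup>2 + 15) \<le> 59/10 * exp (y\<^sup>2 / 2)"
    using taylor by linarith
  then have bound1: "hermite 5 y \<le> 59/10 * exp (y\<^sup>2 / 2)"
    by (simp add: hermite_simps)
  have "59/10 * (1 + y\<^sup>2 / 2 + y^4 / 8) + y * (y^4 - 10 * y\<^sup>2 + 15)
      = 10 * (y * (9/4 - y\<^sup>2)) + 59/20 * (y - 75/59)\<^sup>2 + (59/10 - 59/20 * (75/59)\<^sup>2) + 59/80 * y^4 + y^5"
    by (simp add: field_simps power_numeral_reduce)
  moreover have "y\<^sup>2 \<le> (3/2)\<^sup>2"
    using y by (intro power_mono) simp_all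
  then have "0 \<le> 10 * (y * (9/4 - y\<^sup>2)) + 59/20 * (y - 75/59)\<^sup>2 + (59/10 - 59/20 * (75/59)\<^sup>2) + 59/80 * y^4 + y^5"
    using y by (intro add_nonneg_nonneg mult_nonneg_nonneg) (simp_all add: power_divide)
  ultimately have "- (y * (y^4 - 10 * y\<^sup>2 + 15)) \<le> 59/10 * exp (y\<^sup>2 / 2)"
    using taylor by linarith
  then have bound2: "- hermite 5 y \<le> 59/10 * exp (y\<^sup>2 / 2)"
    by (simp add: hermite_simps)
  have "\<bar>gauss_deriv 5 y\<bar> \<le> 59/10"
    using bound1 bound2 by (rule abs_gauss_deriv_leI)
  then show ?thesis
    unfolding y_def abs_gauss_deriv_abs .
qed


section \<open>Exponential majorants for the far tails\<close>

text \<open>With \<open>exp (- 2 * \<bar>x\<bar>)\<close> in place of the Gaussian, sums over points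
  at mutual distance 5 are dominated by geometric series. The threshold 43/10 of the bounds below
  lies under 5 - 13/25 - 33/200 = 4.315: separation, minus radius of the neighbourhood of a spike,
  minus largest grid step.\<close>

lemma abs_gauss_deriv_tailI:
  assumes "\<bar>hermite n y\<bar> \<le> C * exp (y\<^sup>2 / 2 - 2 * y)" "y = \<bar>x\<bar>"
  shows "\<bar>gauss_deriv n x\<bar> \<le> C * exp (- 2 * y)"
proof -
  have "\<bar>gauss_deriv n y\<bar> = \<bar>hermite n y\<bar> / exp (y\<^sup>2 / 2)"
    by (simp add: gauss_deriv_def abs_mult exp_minus inverse_eq_divide)
  also have "\<dots> \<le> C * exp (- 2 * y)"
    using assms(1) by (subst pos_divide_le_eq) (simp_all add: mult.assoc flip: exp_add)
  finally show ?thesis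
    unfolding assms(2) abs_gauss_deriv_abs .
qed

lemma abs_gauss_deriv_2_tail:
  assumes "43/10 \<le> \<bar>x\<bar>"
  shows "\<bar>gauss_deriv 2 x\<bar> \<le> 19/2 * exp (- 2 * \<bar>x\<bar>)"
proof -
  define y where "y = \<bar>x\<bar>"
  define w where "w = y - 43/10"
  have y_eq: "y = 43/10 + w" and w_nonneg: "0 \<le> w"
    using assms by (simp_all add: w_def y_def)
  have "y\<^sup>2 / 2 - 2 * y = 129/200 + 23/10 * w + w\<^sup>2 / 2"
    unfolding y_eq by (simp add: field_simps power2_eq_square)
  then have exponent: "129/200 \<le> y\<^sup>2 / 2 - 2 * y"
    using w_nonneg by simp
  have bound1: "y\<^sup>2 - 1 \<le> 19/2 * exp (y\<^sup>2 / 2 - 2 * y)"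
  proof (rule exp_taylor_bound [where b = "129/200" and E = "381/200" and k = 2
      and r = "243/400 + 132097/4000 * w + 4473331/80000 * w^2 + 166497/8000 * w^3 + 7239/3200 * w^4"])
    show "19/2 * (381/200 * (\<Sum>i\<le>2. (y\<^sup>2 / 2 - 2 * y - 129/200) ^ i / fact i)) - (y\<^sup>2 - 1)
      = 243/400 + 132097/4000 * w + 4473331/80000 * w^2 + 166497/8000 * w^3 + 7239/3200 * w^4"
      unfolding y_eq by (simp add: taylor_simps)
  qed (use w_nonneg exponent in \<open>simp_all add: power_divide\<close>)
  have bound2: "- (y\<^sup>2 - 1) \<le> 19/2 * exp (y\<^sup>2 / 2 - 2 * y)"
  proof (rule exp_taylor_bound [where b = "129/200" and E = "381/200" and k = 2
      and r = "2847/80 + 200897/4000 * w + 4633331/80000 * w^2 + 166497/8000 * w^3 + 7239/3200 * w^4"])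
    show "19/2 * (381/200 * (\<Sum>i\<le>2. (y\<^sup>2 / 2 - 2 * y - 129/200) ^ i / fact i)) - (- (y\<^sup>2 - 1))
      = 2847/80 + 200897/4000 * w + 4633331/80000 * w^2 + 166497/8000 * w^3 + 7239/3200 * w^4"
      unfolding y_eq by (simp add: taylor_simps)
  qed (use w_nonneg exponent in \<open>simp_all add: power_divide\<close>)
  have "\<bar>hermite 2 y\<bar> \<le> 19/2 * exp (y\<^sup>2 / 2 - 2 * y)"
    unfolding hermite_simps by (rule abs_leI [OF bound1 bound2])
  then show ?thesis
    unfolding y_def [symmetric] by (rule abs_gauss_deriv_tailI [OF _ y_def])
qed

lemma abs_gauss_deriv_3_tail:
  assumes "43/10 \<le> \<bar>x\<bar>"
  shows "\<bar>gauss_deriv 3 x\<bar> \<le> 35 * exp (- 2 * \<bar>x\<bar>)"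
proof -
  define y where "y = \<bar>x\<bar>"
  define w where "w = y - 43/10"
  have y_eq: "y = 43/10 + w" and w_nonneg: "0 \<le> w"
    using assms by (simp_all add: w_def y_def)
  have "y\<^sup>2 / 2 - 2 * y = 129/200 + 23/10 * w + w\<^sup>2 / 2"
    unfolding y_eq by (simp add: field_simps power2_eq_square)
  then have exponent: "129/200 \<le> y\<^sup>2 / 2 - 2 * y"
    using w_nonneg by simp
  have bound1: "y * (y\<^sup>2 - 3) \<le> 35 * exp (y\<^sup>2 / 2 - 2 * y)"
  proof (rule exp_taylor_bound [where b = "129/200" and E = "381/200" and k = 2
      and r = "17/250 + 40353/400 * w + 1574343/8000 * w^2 + 60541/800 * w^3 + 2667/320 * w^4"])
    show "35 * (381/200 * (\<Sum>i\<le>2. (y\<^sup>2 / 2 - 2 * y - 129/200) ^ i / fact i)) - (y * (y\<^sup>2 - 3))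
      = 17/250 + 40353/400 * w + 1574343/8000 * w^2 + 60541/800 * w^3 + 2667/320 * w^4"
      unfolding y_eq by (simp add: taylor_simps)
  qed (use w_nonneg exponent in \<open>simp_all add: power_divide\<close>)
  have bound2: "- (y * (y\<^sup>2 - 3)) \<le> 35 * exp (y\<^sup>2 / 2 - 2 * y)"
  proof (rule exp_taylor_bound [where b = "129/200" and E = "381/200" and k = 2
      and r = "66641/500 + 82329/400 * w + 1780743/8000 * w^2 + 62141/800 * w^3 + 2667/320 * w^4"])
    show "35 * (381/200 * (\<Sum>i\<le>2. (y\<^sup>2 / 2 - 2 * y - 129/200) ^ i / fact i)) - (- (y * (y\<^sup>2 - 3)))
      = 66641/500 + 82329/400 * w + 1780743/8000 * w^2 + 62141/800 * w^3 + 2667/320 * w^4"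
      unfolding y_eq by (simp add: taylor_simps)
  qed (use w_nonneg exponent in \<open>simp_all add: power_divide\<close>)
  have "\<bar>hermite 3 y\<bar> \<le> 35 * exp (y\<^sup>2 / 2 - 2 * y)"
    unfolding hermite_simps by (rule abs_leI [OF bound1 bound2])
  then show ?thesis
    unfolding y_def [symmetric] by (rule abs_gauss_deriv_tailI [OF _ y_def])
qed

lemma abs_gauss_deriv_4_tail:
  assumes "43/10 \<le> \<bar>x\<bar>"
  shows "\<bar>gauss_deriv 4 x\<bar> \<le> 125 * exp (- 2 * \<bar>x\<bar>)"
proof -
  define y where "y = \<bar>x\<bar>"
  define w where "w = y - 43/10"
  have y_eq: "y = 43/10 + w" and w_nonneg: "0 \<le> w"
    using assms by (simp_all add: w_def y_def)
  have "y\<^sup>2 / 2 - 2 * y = 129/200 + 23/10 * w + w\<^sup>2 / 2"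
    unfolding y_eq by (simp add: field_simps power2_eq_square)
  then have exponent: "129/200 \<le> y\<^sup>2 / 2 - 2 * y"
    using w_nonneg by simp
  have bound1: "y^4 - 6 * y\<^sup>2 + 3 \<le> 125 * exp (y\<^sup>2 / 2 - 2 * y)"
  proof (rule exp_taylor_bound [where b = "129/200" and E = "381/200" and k = 2
      and r = "41849/10000 + 562519/2000 * w + 1030341/1600 * w^2 + 41063/160 * w^3 + 1841/64 * w^4"])
    show "125 * (381/200 * (\<Sum>i\<le>2. (y\<^sup>2 / 2 - 2 * y - 129/200) ^ i / fact i)) - (y^4 - 6 * y\<^sup>2 + 3)
      = 41849/10000 + 562519/2000 * w + 1030341/1600 * w^2 + 41063/160 * w^3 + 1841/64 * w^4"
      unfolding y_eq by (simp add: taylor_simps)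
  qed (use w_nonneg exponent in \<open>simp_all add: power_divide\<close>)
  have bound2: "- (y^4 - 6 * y\<^sup>2 + 3) \<le> 125 * exp (y\<^sup>2 / 2 - 2 * y)"
  proof (rule exp_taylor_bound [where b = "129/200" and E = "381/200" and k = 2
      and r = "4720651/10000 + 1628231/2000 * w + 1366149/1600 * w^2 + 46567/160 * w^3 + 1969/64 * w^4"])
    show "125 * (381/200 * (\<Sum>i\<le>2. (y\<^sup>2 / 2 - 2 * y - 129/200) ^ i / fact i)) - (- (y^4 - 6 * y\<^sup>2 + 3))
      = 4720651/10000 + 1628231/2000 * w + 1366149/1600 * w^2 + 46567/160 * w^3 + 1969/64 * w^4"
      unfolding y_eq by (simp add: taylor_simps)
  qed (use w_nonneg exponent in \<open>simp_all add: power_divide\<close>)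
  have "\<bar>hermite 4 y\<bar> \<le> 125 * exp (y\<^sup>2 / 2 - 2 * y)"
    unfolding hermite_simps by (rule abs_leI [OF bound1 bound2])
  then show ?thesis
    unfolding y_def [symmetric] by (rule abs_gauss_deriv_tailI [OF _ y_def])
qed

lemma abs_gauss_deriv_5_tail:
  assumes "43/10 \<le> \<bar>x\<bar>"
  shows "\<bar>gauss_deriv 5 x\<bar> \<le> 400 * exp (- 2 * \<bar>x\<bar>)"
proof -
  define y where "y = \<bar>x\<bar>"
  define w where "w = y - 43/10"
  have y_eq: "y = 43/10 + w" and w_nonneg: "0 \<le> w"
    using assms by (simp_all add: w_def y_def)
  have "y\<^sup>2 / 2 - 2 * y = 129/200 + 23/10 * w + w\<^sup>2 / 2"
    unfolding y_eq by (simp add: field_simps power2_eq_square)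
  then have exponent: "129/200 \<le> y\<^sup>2 / 2 - 2 * y"
    using w_nonneg by simp
  have bound1: "y * (y^4 - 10 * y\<^sup>2 + 15) \<le> 400 * exp (y\<^sup>2 / 2 - 2 * y)"
  proof (rule exp_taylor_bound [where b = "129/200" and E = "381/200" and k = 3
      and r = "2248557/100000 + 1165799/2000 * w + 86521/50 * w^2 + 2246609/1000 * w^3 + 216299/200 * w^4 + 8723/40 * w^5 + 127/8 * w^6"])
    show "400 * (381/200 * (\<Sum>i\<le>3. (y\<^sup>2 / 2 - 2 * y - 129/200) ^ i / fact i)) - (y * (y^4 - 10 * y\<^sup>2 + 15))
      = 2248557/100000 + 1165799/2000 * w + 86521/50 * w^2 + 2246609/1000 * w^3 + 216299/200 * w^4 + 8723/40 * w^5 + 127/8 * w^6"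
      unfolding y_eq by (simp add: taylor_simps)
  qed (use w_nonneg exponent in \<open>simp_all add: power_divide\<close>)
  have bound2: "- (y * (y^4 - 10 * y\<^sup>2 + 15)) \<le> 400 * exp (y\<^sup>2 / 2 - 2 * y)"
  proof (rule exp_taylor_bound [where b = "129/200" and E = "381/200" and k = 3
      and r = "150151443/100000 + 5844601/2000 * w + 76564/25 * w^2 + 2596409/1000 * w^3 + 224899/200 * w^4 + 8803/40 * w^5 + 127/8 * w^6"])
    show "400 * (381/200 * (\<Sum>i\<le>3. (y\<^sup>2 / 2 - 2 * y - 129/200) ^ i / fact i)) - (- (y * (y^4 - 10 * y\<^sup>2 + 15)))
      = 150151443/100000 + 5844601/2000 * w + 76564/25 * w^2 + 2596409/1000 * w^3 + 224899/200 * w^4 + 8803/40 * w^5 + 127/8 * w^6"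
      unfolding y_eq by (simp add: taylor_simps)
  qed (use w_nonneg exponent in \<open>simp_all add: power_divide\<close>)
  have "\<bar>hermite 5 y\<bar> \<le> 400 * exp (y\<^sup>2 / 2 - 2 * y)"
    unfolding hermite_simps by (rule abs_leI [OF bound1 bound2])
  then show ?thesis
    unfolding y_def [symmetric] by (rule abs_gauss_deriv_tailI [OF _ y_def])
qed

lemma abs_gauss_deriv_6_tail:
  assumes "43/10 \<le> \<bar>x\<bar>"
  shows "\<bar>gauss_deriv 6 x\<bar> \<le> 1100 * exp (- 2 * \<bar>x\<bar>)"
proof -
  define y where "y = \<bar>x\<bar>"
  define w where "w = y - 43/10"
  have y_eq: "y = 43/10 + w" and w_nonneg: "0 \<le> w"
    using assms by (simp_all add: w_def y_def)
  have "y\<^sup>2 / 2 - 2 * y = 129/200 + 23/10 * w + w\<^sup>2 / 2"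
    unfolding y_eq by (simp add: field_simps power2_eq_square)
  then have exponent: "129/200 \<le> y\<^sup>2 / 2 - 2 * y"
    using w_nonneg by simp
  have bound1: "y^6 - 15 * y^4 + 45 * y\<^sup>2 - 15 \<le> 1100 * exp (y\<^sup>2 / 2 - 2 * y)"
  proof (rule exp_taylor_bound [where b = "129/200" and E = "381/200" and k = 3
      and r = "85288451/1000000 + 19128171/50000 * w + 1540623/500 * w^2 + 21308039/4000 * w^3 + 2216709/800 * w^4 + 18453/32 * w^5 + 1365/32 * w^6"])
    show "1100 * (381/200 * (\<Sum>i\<le>3. (y\<^sup>2 / 2 - 2 * y - 129/200) ^ i / fact i)) - (y^6 - 15 * y^4 + 45 * y\<^sup>2 - 15)
      = 85288451/1000000 + 19128171/50000 * w + 1540623/500 * w^2 + 21308039/4000 * w^3 + 2216709/800 * w^4 + 18453/32 * w^5 + 1365/32 * w^6"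
      unfolding y_eq by (simp add: taylor_simps)
  qed (use w_nonneg exponent in \<open>simp_all add: power_divide\<close>)
  have bound2: "- (y^6 - 15 * y^4 + 45 * y\<^sup>2 - 15) \<le> 1100 * exp (y\<^sup>2 / 2 - 2 * y)"
  proof (rule exp_taylor_bound [where b = "129/200" and E = "381/200" and k = 3
      and r = "4105711549/1000000 + 462836829/50000 * w + 10099449/1000 * w^2 + 31965159/4000 * w^3 + 2636469/800 * w^4 + 100521/160 * w^5 + 1429/32 * w^6"])
    show "1100 * (381/200 * (\<Sum>i\<le>3. (y\<^sup>2 / 2 - 2 * y - 129/200) ^ i / fact i)) - (- (y^6 - 15 * y^4 + 45 * y\<^sup>2 - 15))
      = 4105711549/1000000 + 462836829/50000 * w + 10099449/1000 * w^2 + 31965159/4000 * w^3 + 2636469/800 * w^4 + 100521/160 * w^5 + 1429/32 * w^6"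
      unfolding y_eq by (simp add: taylor_simps)
  qed (use w_nonneg exponent in \<open>simp_all add: power_divide\<close>)
  have "\<bar>hermite 6 y\<bar> \<le> 1100 * exp (y\<^sup>2 / 2 - 2 * y)"
    unfolding hermite_simps by (rule abs_leI [OF bound1 bound2])
  then show ?thesis
    unfolding y_def [symmetric] by (rule abs_gauss_deriv_tailI [OF _ y_def])
qed

section \<open>Sums over separated sets\<close>

lemma exp_uminus_le:
  fixes b :: real
  assumes "0 \<le> b" "1 \<le> c * (1 + b / 8 + (b / 8)^2 / 2 + (b / 8)^3 / 6 + (b / 8)^4 / 24)^8" "0 \<le> c"
  shows "exp (- b) \<le> c"
proof -
  have "1 \<le> c * exp b"
    using assms(2) mult_left_mono [OF exp_lower_power [OF assms(1)] assms(3)] by linarith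
  then show ?thesis
    by (simp add: exp_minus inverse_eq_divide divide_le_eq)
qed

section \<open>The Gaussian derivatives near the origin\<close>

text \<open>As the wavelet is \<open>- gauss_deriv 2\<close>, this is its uniform concavity near the
  centre, the source of the concavity of the certificate near a spike. The value at 13/25 is about
  1.267.\<close>

lemma gauss_deriv_4_ge:
  assumes "\<bar>x\<bar> \<le> 13/25"
  shows "5/4 \<le> gauss_deriv 4 x"
proof -
  \<comment> \<open>In terms of the distance \<open>r\<close> of \<open>x^2\<close> from its largest
    value, the polynomial to be bounded has only positive coefficients.\<close>
  define r where "r = 169/625 - x\<^sup>2"
  have x2: "x\<^sup>2 = 169/625 - r" and r: "0 \<le> r" "r \<le> 169/625"
    using abs_le_square_iff [of x "13/25"] assms by (simp_all add: r_def power_divide)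
  have "0 \<le> (4472007/976562500) + r * ((2127529/390625) + r * ((4493/1250) + r * (1/2)))"
    using r by (intro add_nonneg_nonneg mult_nonneg_nonneg) simp_all
  moreover have "((x\<^sup>2)\<^sup>2 - 6 * x\<^sup>2 + 3) * (1 - x\<^sup>2 / 2) - 5/4 = (4472007/976562500) + r * ((2127529/390625) + r * ((4493/1250) + r * (1/2)))"
    unfolding x2 by (simp add: field_simps power_numeral_reduce)
  ultimately have "5/4 \<le> ((x\<^sup>2)\<^sup>2 - 6 * x\<^sup>2 + 3) * (1 - x\<^sup>2 / 2)"
    by linarith
  also have "\<dots> \<le> ((x\<^sup>2)\<^sup>2 - 6 * x\<^sup>2 + 3) * exp (- (x\<^sup>2 / 2))"
  proof (rule mult_left_mono)
    show "1 - x\<^sup>2 / 2 \<le> exp (- (x\<^sup>2 / 2))"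
      using exp_ge_add_one_self [of "- (x\<^sup>2 / 2)"] by simp
    show "0 \<le> (x\<^sup>2)\<^sup>2 - 6 * x\<^sup>2 + 3"
      unfolding x2 using r by (simp add: field_simps power_numeral_reduce)
  qed
  also have "\<dots> = gauss_deriv 4 x"
    by (simp add: gauss_deriv_def hermite_simps flip: power_mult)
  finally show ?thesis .
qed

lemma gauss_deriv_2_nonpos: "\<bar>x\<bar> \<le> 1 \<Longrightarrow> gauss_deriv 2 x \<le> 0"
  by (simp add: gauss_deriv_def hermite_simps abs_square_le_1 mult_nonpos_nonneg)

text \<open>From \<open>1 - x^2 / 2 \<le> exp (- (x^2 / 2)) \<le> 1\<close>, as in the next lemma.
  Such expansions control the diagonal blocks of the linear system, where the arguments are at most
  \<tau>.\<close>

lemma gauss_deriv_2_near_0: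
  assumes "\<bar>x\<bar> \<le> 1"
  shows "- 1 \<le> gauss_deriv 2 x" "gauss_deriv 2 x \<le> - 1 + 3/2 * x\<^sup>2"
proof -
  have x2: "x\<^sup>2 \<le> 1"
    using assms by (simp add: abs_square_le_1)
  have "(1 - x\<^sup>2) * exp (- (x\<^sup>2 / 2)) \<le> 1 * 1"
    using x2 by (intro mult_mono) simp_all
  then show "- 1 \<le> gauss_deriv 2 x"
    by (simp add: gauss_deriv_def hermite_simps algebra_simps)
  have "1 - 3/2 * x\<^sup>2 \<le> (1 - x\<^sup>2) * (1 - x\<^sup>2 / 2)"
    using zero_le_power2 [of "x\<^sup>2"] by (simp add: field_simps power2_eq_square)
  also have "\<dots> \<le> (1 - x\<^sup>2) * exp (- (x\<^sup>2 / 2))"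
    using x2 exp_ge_add_one_self [of "- (x\<^sup>2 / 2)"] by (intro mult_left_mono) simp_all
  finally show "gauss_deriv 2 x \<le> - 1 + 3/2 * x\<^sup>2"
    by (simp add: gauss_deriv_def hermite_simps algebra_simps)
qed

lemma gauss_deriv_3_near_0:
  assumes "0 \<le> x" "x \<le> 1"
  shows "gauss_deriv 3 x \<le> 3 * x" "3 * x - 5/2 * x^3 \<le> gauss_deriv 3 x"
proof -
  have x2: "x\<^sup>2 \<le> 1"
    using assms by (simp add: power_le_one)
  have eq: "gauss_deriv 3 x = x * ((3 - x\<^sup>2) * exp (- (x\<^sup>2 / 2)))"
    by (simp add: gauss_deriv_def hermite_simps algebra_simps)
  have "(3 - x\<^sup>2) * exp (- (x\<^sup>2 / 2)) \<le> 3 * 1"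
    using x2 by (intro mult_mono) simp_all
  then have "x * ((3 - x\<^sup>2) * exp (- (x\<^sup>2 / 2))) \<le> x * 3"
    using assms(1) by (intro mult_left_mono) simp_all
  then show "gauss_deriv 3 x \<le> 3 * x"
    using eq by simp
  have "3 - 5/2 * x\<^sup>2 \<le> (3 - x\<^sup>2) * (1 - x\<^sup>2 / 2)"
    using zero_le_power2 [of "x\<^sup>2"] by (simp add: field_simps power2_eq_square)
  also have "\<dots> \<le> (3 - x\<^sup>2) * exp (- (x\<^sup>2 / 2))"
    using x2 exp_ge_add_one_self [of "- (x\<^sup>2 / 2)"] by (intro mult_left_mono) simp_all
  finally have "x * (3 - 5/2 * x\<^sup>2) \<le> x * ((3 - x\<^sup>2) * exp (- (x\<^sup>2 / 2)))"
    using assms(1) by (rule mult_left_mono)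
  then show "3 * x - 5/2 * x^3 \<le> gauss_deriv 3 x"
    unfolding eq by (simp add: algebra_simps power2_eq_square power3_eq_cube)
qed

lemma abs_gauss_deriv_5_near_0:
  assumes "\<bar>x\<bar> \<le> 1"
  shows "\<bar>gauss_deriv 5 x\<bar> \<le> 15 * \<bar>x\<bar>"
proof -
  have x2: "0 \<le> x\<^sup>2" "x\<^sup>2 \<le> 1"
    using assms by (simp_all add: abs_square_le_1)
  have x4: "x^4 = x\<^sup>2 * x\<^sup>2"
    by (simp flip: power_add)
  have "x\<^sup>2 * x\<^sup>2 \<le> x\<^sup>2 * 1"
    using x2 by (intro mult_left_mono)
  then have "\<bar>x^4 - 10 * x\<^sup>2 + 15\<bar> \<le> 15"
    unfolding x4 abs_le_iff using x2 mult_nonneg_nonneg [OF x2(1) x2(1)] by linarith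
  then have "\<bar>x\<bar> * \<bar>x^4 - 10 * x\<^sup>2 + 15\<bar> * exp (- (x\<^sup>2 / 2)) \<le> \<bar>x\<bar> * 15 * 1"
    by (intro mult_mono) simp_all
  then show ?thesis
    by (simp add: gauss_deriv_def hermite_simps abs_mult)
qed

text \<open>Each of the consecutive half-open intervals of length 5 starting at \<open>d\<close>
  holds at most one value \<open>r a\<close>. So the sum is dominated by a geometric series of ratio
  \<open>exp (- 10) \<le> 1 / 20000\<close>.\<close>

lemma exp_sum_separated_le:
  fixes r :: "'a \<Rightarrow> real"
  assumes A: "finite A" and sep: "\<And>a b. a \<in> A \<Longrightarrow> b \<in> A \<Longrightarrow> a \<noteq> b \<Longrightarrow> 5 \<le> \<bar>r a - r b\<bar>"
    and ge: "\<And>a. a \<in> A \<Longrightarrow> d \<le> r a"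
  shows "(\<Sum>a\<in>A. exp (- 2 * r a)) \<le> 20000 / 19999 * exp (- 2 * d)"
proof -
  define k where "k a = nat \<lfloor>(r a - d) / 5\<rfloor>" for a
  have k: "5 * real (k a) \<le> r a - d" "r a - d < 5 * real (k a) + 5" if "a \<in> A" for a
  proof -
    have "0 \<le> \<lfloor>(r a - d) / 5\<rfloor>"
      using ge [OF that] by simp
    then have "real (k a) = of_int \<lfloor>(r a - d) / 5\<rfloor>"
      by (simp add: k_def)
    moreover have "of_int \<lfloor>(r a - d) / 5\<rfloor> \<le> (r a - d) / 5" "(r a - d) / 5 < of_int \<lfloor>(r a - d) / 5\<rfloor> + 1"
      using floor_correct [of "(r a - d) / 5"] by simp_all
    ultimately show "5 * real (k a) \<le> r a - d" "r a - d < 5 * real (k a) + 5"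
      by (simp_all add: field_simps)
  qed
  have "inj_on k A"
  proof (rule inj_onI, rule ccontr)
    fix a b
    assume "a \<in> A" "b \<in> A" "k a = k b" "a \<noteq> b"
    then show False
      using sep [of a b] k [of a] k [of b] by simp
  qed
  have q: "exp (- 10 :: real) \<le> 1 / 20000"
    by (rule exp_uminus_le) (simp_all add: field_simps)
  have "(\<Sum>a\<in>A. exp (- 2 * r a)) \<le> (\<Sum>a\<in>A. exp (- 2 * d) * (1 / 20000) ^ k a)"
  proof (rule sum_mono)
    fix a
    assume "a \<in> A"
    then have "exp (- 2 * r a) \<le> exp (- 2 * d + real (k a) * (- 10))"
      using k(1) by fastforce
    also have "\<dots> = exp (- 2 * d) * exp (- 10) ^ k a"
      by (simp only: exp_add exp_of_nat_mult)
    also have "\<dots> \<le> exp (- 2 * d) * (1 / 20000) ^ k a"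
      using q by (intro mult_left_mono power_mono) simp_all
    finally show "exp (- 2 * r a) \<le> exp (- 2 * d) * (1 / 20000) ^ k a" .
  qed
  also have "\<dots> = exp (- 2 * d) * (\<Sum>j\<in>k ` A. (1 / 20000) ^ j)"
    using \<open>inj_on k A\<close> by (simp add: sum.reindex sum_distrib_left)
  also have "(\<Sum>j\<in>k ` A. (1 / 20000 :: real) ^ j) \<le> (\<Sum>j. (1 / 20000) ^ j)"
    using A by (intro sum_le_suminf) (auto intro!: summable_geometric)
  also have "(\<Sum>j. (1 / 20000 :: real) ^ j) = 20000 / 19999"
    by (subst suminf_geometric) simp_all
  finally show ?thesis
    by (simp add: mult.commute)
qed

text \<open>On either side of \<open>y\<close> the distances to \<open>y\<close> are again
  separated, so two geometric series suffice; 2001/1000 exceeds twice 20000/19999.\<close>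

lemma sum_separated_tail_le:
  fixes A :: "real set" and f :: "real \<Rightarrow> real"
  assumes A: "finite A" and sep: "\<And>a b. a \<in> A \<Longrightarrow> b \<in> A \<Longrightarrow> a \<noteq> b \<Longrightarrow> 5 \<le> \<bar>a - b\<bar>"
    and far: "\<And>a. a \<in> A \<Longrightarrow> d \<le> \<bar>y - a\<bar>"
    and f: "\<And>a. a \<in> A \<Longrightarrow> f a \<le> c * exp (- 2 * \<bar>y - a\<bar>)" and c: "0 \<le> c"
  shows "sum f A \<le> 2001/1000 * c * exp (- 2 * d)"
proof -
  have "sum f A \<le> (\<Sum>a\<in>A. c * exp (- 2 * \<bar>y - a\<bar>))"
    using f by (rule sum_mono)
  also have "\<dots> = c * (\<Sum>a\<in>A. exp (- 2 * \<bar>y - a\<bar>))"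
    by (simp add: sum_distrib_left)
  also have "(\<Sum>a\<in>A. exp (- 2 * \<bar>y - a\<bar>)) = (\<Sum>a\<in>{a \<in> A. y \<le> a} \<union> {a \<in> A. a < y}. exp (- 2 * \<bar>y - a\<bar>))"
    by (intro sum.cong) auto
  also have "\<dots> = (\<Sum>a\<in>{a \<in> A. y \<le> a}. exp (- 2 * \<bar>y - a\<bar>)) + (\<Sum>a\<in>{a \<in> A. a < y}. exp (- 2 * \<bar>y - a\<bar>))"
    using A by (intro sum.union_disjoint) auto
  also have "\<dots> \<le> 20000 / 19999 * exp (- 2 * d) + 20000 / 19999 * exp (- 2 * d)"
  proof (intro add_mono exp_sum_separated_le)
    show "5 \<le> \<bar>\<bar>y - a\<bar> - \<bar>y - b\<bar>\<bar>" if "a \<in> {a \<in> A. y \<le> a}" "b \<in> {a \<in> A. y \<le> a}" "a \<noteq> b" for a b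
      using that sep [of a b] by auto
    show "5 \<le> \<bar>\<bar>y - a\<bar> - \<bar>y - b\<bar>\<bar>" if "a \<in> {a \<in> A. a < y}" "b \<in> {a \<in> A. a < y}" "a \<noteq> b" for a b
      using that sep [of a b] by auto
    show "d \<le> \<bar>y - a\<bar>" if "a \<in> {a \<in> A. y \<le> a}" for a
      using that far by blast
    show "d \<le> \<bar>y - a\<bar>" if "a \<in> {a \<in> A. a < y}" for a
      using that far by blast
  qed (use A in auto)
  also have "\<dots> \<le> 2001/1000 * exp (- 2 * d)"
    by (simp add: field_simps)
  finally show ?thesis
    using c by (simp add: mult_left_mono mult.left_commute)
qed

text \<open>Three points at mutual distance at least 5 cannot all be closer than 5 to
  \<open>y\<close>. So at most two terms fall under \<open>M\<close>, and the others form a tail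
  with \<open>2001/1000 * exp (- 10) \<le> 1 / 9995\<close>.\<close>

lemma sum_separated_le:
  fixes A :: "real set" and f :: "real \<Rightarrow> real"
  assumes A: "finite A" and sep: "\<And>a b. a \<in> A \<Longrightarrow> b \<in> A \<Longrightarrow> a \<noteq> b \<Longrightarrow> 5 \<le> \<bar>a - b\<bar>"
    and single: "\<And>a. a \<in> A \<Longrightarrow> f a \<le> M"
    and pair: "\<And>a b. a \<in> A \<Longrightarrow> b \<in> A \<Longrightarrow> a \<noteq> b \<Longrightarrow> f a + f b \<le> M" and M: "0 \<le> M"
    and tail: "\<And>a. a \<in> A \<Longrightarrow> 5 \<le> \<bar>y - a\<bar> \<Longrightarrow> f a \<le> c * exp (- 2 * \<bar>y - a\<bar>)" and c: "0 \<le> c"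
  shows "sum f A \<le> M + c / 9995"
proof -
  let ?B = "{a \<in> A. \<bar>y - a\<bar> < 5}" and ?C = "{a \<in> A. 5 \<le> \<bar>y - a\<bar>}"
  have "sum f A = sum f ?B + sum f ?C"
    using A by (subst sum.union_disjoint [symmetric]) (auto intro!: sum.cong)
  moreover have "sum f ?B \<le> M"
  proof -
    consider "?B = {}" | a where "?B = {a}" | a b where "a \<in> ?B" "b \<in> ?B" "a \<noteq> b"
      by blast
    then show ?thesis
    proof cases
      case 1
      then show ?thesis
        unfolding 1 using M by simp
    next
      case 2
      then show ?thesis
        using single [of a] by auto
    next
      case 3
      have "z = a \<or> z = b" if "z \<in> ?B" for z
      proof (rule ccontr)
        assume "\<not> ?thesis"
        then have "5 \<le> \<bar>a - b\<bar>" "5 \<le> \<bar>a - z\<bar>" "5 \<le> \<bar>b - z\<bar>"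
          using that 3 sep by auto
        then show False
          using that 3 by (simp add: abs_less_iff) linarith
      qed
      then have "?B = {a, b}"
        using 3(1,2) by blast
      moreover have "f a + f b \<le> M"
        using 3 by (intro pair) auto
      ultimately show ?thesis
        using 3(3) by simp
    qed
  qed
  moreover have "sum f ?C \<le> c / 9995"
  proof -
    have q: "exp (- 10 :: real) \<le> 1 / 20000"
      by (rule exp_uminus_le) (simp_all add: field_simps)
    have "sum f ?C \<le> 2001/1000 * c * exp (- 2 * 5)"
      using A sep tail c by (intro sum_separated_tail_le [of _ _ y]) auto
    also have "\<dots> \<le> 2001/1000 * c * (1 / 20000)"
      using q c by (intro mult_left_mono) simp_all
    also have "\<dots> \<le> c / 9995"
      using c by simp
    finally show ?thesis .
  qed
  ultimately show ?thesis
    by linarith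
qed

text \<open>Either one argument is below 3/2 in modulus, and then the other is at least 7/2, or both
  are at least 3/2 and one of them at least 5/2. This explains the ranges of the bounds for
  derivatives 4, 5 and 6.\<close>

lemma pair_bound:
  fixes h :: "real \<Rightarrow> real"
  assumes "\<And>x. h x \<le> A" "\<And>x. 7/2 \<le> \<bar>x\<bar> \<Longrightarrow> h x \<le> D" "\<And>x. 3/2 \<le> \<bar>x\<bar> \<Longrightarrow> h x \<le> B"
    "\<And>x. 5/2 \<le> \<bar>x\<bar> \<Longrightarrow> h x \<le> C" "A + D \<le> M" "B + C \<le> M" "5 \<le> \<bar>x - x'\<bar>"
  shows "h x + h x' \<le> M"
proof -
  consider "\<bar>x\<bar> < 3/2" | "\<bar>x'\<bar> < 3/2" | "3/2 \<le> \<bar>x\<bar>" "5/2 \<le> \<bar>x'\<bar>" | "3/2 \<le> \<bar>x'\<bar>" "5/2 \<le> \<bar>x\<bar>"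
    using assms(7) by linarith
  then show ?thesis
  proof cases
    case 1
    then have "7/2 \<le> \<bar>x'\<bar>"
      using assms(7) by linarith
    then show ?thesis
      using assms(1) [of x] assms(2) [of x'] assms(5) by linarith
  next
    case 2
    then have "7/2 \<le> \<bar>x\<bar>"
      using assms(7) by linarith
    then show ?thesis
      using assms(1) [of x'] assms(2) [of x] assms(5) by linarith
  next
    case 3
    then show ?thesis
      using assms(3) [of x] assms(4) [of x'] assms(6) by linarith
  next
    case 4
    then show ?thesis
      using assms(3) [of x'] assms(4) [of x] assms(6) by linarith
  qed
qed

text \<open>At most two points of the set are closer than 5 to \<open>y\<close>, and then not both are closer than \<open>5/2\<close>.\<close>

lemma sum_abs_gauss_deriv_le:
  fixes A :: "real set"
  assumes A: "finite A" and sep: "\<And>a b. a \<in> A \<Longrightarrow> b \<in> A \<Longrightarrow> a \<noteq> b \<Longrightarrow> 5 \<le> \<bar>a - b\<bar>"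
  shows "(\<Sum>a\<in>A. \<bar>gauss_deriv 4 (y - a)\<bar>) \<le> 69/20"
    and "(\<Sum>a\<in>A. \<bar>gauss_deriv 5 (y - a)\<bar>) \<le> 129/20"
    and "(\<Sum>a\<in>A. \<bar>gauss_deriv 6 (y - a)\<bar>) \<le> 16"
proof -
  have diff: "5 \<le> \<bar>(y - a) - (y - b)\<bar>" if "a \<in> A" "b \<in> A" "a \<noteq> b" for a b
    using sep [OF that] by simp
  have far: "\<bar>gauss_deriv 4 x\<bar> \<le> 21/50" if "7/2 \<le> \<bar>x\<bar>" for x
    using that by (intro abs_gauss_deriv_4_le_from_2_5) simp
  \<comment> \<open>171/50 is 3 + 21/50, one point near the centre and one far away. Below, 32/5 is
    both 59/10 + 1/2 and 16/5 + 16/5, and 79/5 is 79/10 + 79/10.\<close>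
  have "(\<Sum>a\<in>A. \<bar>gauss_deriv 4 (y - a)\<bar>) \<le> 171/50 + 125 / 9995"
  proof (rule sum_separated_le [OF A sep, where y = y])
    fix a b
    assume "a \<in> A" "b \<in> A" "a \<noteq> b"
    then show "\<bar>gauss_deriv 4 (y - a)\<bar> + \<bar>gauss_deriv 4 (y - b)\<bar> \<le> 171/50"
      by (intro pair_bound [OF abs_gauss_deriv_4_le far abs_gauss_deriv_4_le_from_1_5
            abs_gauss_deriv_4_le_from_2_5] diff) simp_all
  next
    fix a
    show "\<bar>gauss_deriv 4 (y - a)\<bar> \<le> 171/50"
      using abs_gauss_deriv_4_le [of "y - a"] by simp
    show "\<bar>gauss_deriv 4 (y - a)\<bar> \<le> 125 * exp (- 2 * \<bar>y - a\<bar>)" if "5 \<le> \<bar>y - a\<bar>"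
      using that by (intro abs_gauss_deriv_4_tail) simp
  qed simp_all
  then show "(\<Sum>a\<in>A. \<bar>gauss_deriv 4 (y - a)\<bar>) \<le> 69/20"
    by simp
  have "(\<Sum>a\<in>A. \<bar>gauss_deriv 5 (y - a)\<bar>) \<le> 32/5 + 400 / 9995"
  proof (rule sum_separated_le [OF A sep, where y = y])
    fix a b
    assume "a \<in> A" "b \<in> A" "a \<noteq> b"
    then show "\<bar>gauss_deriv 5 (y - a)\<bar> + \<bar>gauss_deriv 5 (y - b)\<bar> \<le> 32/5"
      by (intro pair_bound [OF abs_gauss_deriv_5_le abs_gauss_deriv_5_le_from_3_5
            abs_gauss_deriv_5_le_from_1_5 abs_gauss_deriv_5_le_from_1_5] diff) simp_all
  next
    fix a
    show "\<bar>gauss_deriv 5 (y - a)\<bar> \<le> 32/5"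
      using abs_gauss_deriv_5_le [of "y - a"] by simp
    show "\<bar>gauss_deriv 5 (y - a)\<bar> \<le> 400 * exp (- 2 * \<bar>y - a\<bar>)" if "5 \<le> \<bar>y - a\<bar>"
      using that by (intro abs_gauss_deriv_5_tail) simp
  qed simp_all
  then show "(\<Sum>a\<in>A. \<bar>gauss_deriv 5 (y - a)\<bar>) \<le> 129/20"
    by simp
  have "(\<Sum>a\<in>A. \<bar>gauss_deriv 6 (y - a)\<bar>) \<le> 79/5 + 1100 / 9995"
  proof (rule sum_separated_le [OF A sep, where y = y])
    fix a b
    assume "a \<in> A" "b \<in> A" "a \<noteq> b"
    then show "\<bar>gauss_deriv 6 (y - a)\<bar> + \<bar>gauss_deriv 6 (y - b)\<bar> \<le> 79/5"
      by (intro pair_bound [OF abs_gauss_deriv_6_le abs_gauss_deriv_6_le_from_3_5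
            abs_gauss_deriv_6_le_from_1_5 abs_gauss_deriv_6_le_from_1_5] diff) simp_all
  next
    fix a
    show "\<bar>gauss_deriv 6 (y - a)\<bar> \<le> 79/5"
      using abs_gauss_deriv_6_le [of "y - a"] by simp
    show "\<bar>gauss_deriv 6 (y - a)\<bar> \<le> 1100 * exp (- 2 * \<bar>y - a\<bar>)" if "5 \<le> \<bar>y - a\<bar>"
      using that by (intro abs_gauss_deriv_6_tail) simp
  qed simp_all
  then show "(\<Sum>a\<in>A. \<bar>gauss_deriv 6 (y - a)\<bar>) \<le> 16"
    by simp
qed

section \<open>Interpolation and linear systems\<close>

text \<open>Taylor expansion at \<open>x\<close> in both directions; with the weights
  \<open>v\<close> and \<open>u\<close> the first-order terms cancel. Multiplying out by
  \<open>u + v\<close> avoids a division, and a spike that sits on a sample is the harmless case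
  \<open>u = 0\<close>.\<close>

lemma interpolation_error:
  fixes f :: "real \<Rightarrow> real"
  assumes f: "\<And>x. (f has_real_derivative f' x) (at x)" "\<And>x. (f' has_real_derivative f'' x) (at x)"
    and B: "\<And>z. x - v \<le> z \<Longrightarrow> z \<le> x + u \<Longrightarrow> \<bar>f'' z\<bar> \<le> B"
    and uv: "0 \<le> u" "0 \<le> v"
  shows "\<bar>v * f (x + u) + u * f (x - v) - (u + v) * f x\<bar> \<le> (u + v) * (u * v / 2) * B"
proof (cases "u = 0 \<or> v = 0")
  case True
  then show ?thesis
    by auto
next
  case False
  then have pos: "0 < u" "0 < v"
    using uv by auto
  define diff where "diff m = (if m = 0 then f else if m = Suc 0 then f' else f'')" for m :: nat
  have diff: "\<forall>m t. m < 2 \<and> x - v \<le> t \<and> t \<le> x + u \<longrightarrow> DERIV (diff m) t :> diff (Suc m) t"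
    using f by (auto simp: diff_def less_2_cases_iff)
  obtain s where s: "x < s" "s < x + u" "f (x + u) = f x + u * f' x + u\<^sup>2 / 2 * f'' s"
    using Taylor_up [OF _ _ diff, of f x] pos by (auto simp: diff_def numeral_2_eq_2 mult.commute)
  obtain t where t: "x - v < t" "t < x" "f (x - v) = f x - v * f' x + v\<^sup>2 / 2 * f'' t"
    using Taylor_down [OF _ _ diff, of f x] pos by (auto simp: diff_def numeral_2_eq_2 mult.commute)
  have eq: "v * f (x + u) + u * f (x - v) - (u + v) * f x = u * v / 2 * (u * f'' s + v * f'' t)"
    unfolding s(3) t(3) by (simp add: field_simps power2_eq_square)
  have "\<bar>u * f'' s + v * f'' t\<bar> \<le> u * B + v * B"
    using B [of s] B [of t] s t pos
    by (intro order_trans [OF abs_triangle_ineq] add_mono) (auto simp: abs_mult)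
  then have "\<bar>u * v / 2\<bar> * \<bar>u * f'' s + v * f'' t\<bar> \<le> u * v / 2 * (u * B + v * B)"
    using pos by (simp add: mult_left_mono)
  then show ?thesis
    unfolding eq abs_mult by (simp add: algebra_simps)
qed

lemma second_difference_le:
  fixes f :: "real \<Rightarrow> real"
  assumes f: "\<And>x. (f has_real_derivative f' x) (at x)" "\<And>x. (f' has_real_derivative f'' x) (at x)"
    and B: "\<And>z. \<bar>f'' z\<bar> \<le> B" and h: "0 < h"
  shows "\<bar>2 * f x - f (x - h) - f (x + h)\<bar> \<le> h\<^sup>2 * B"
proof -
  have "\<bar>h * f (x + h) + h * f (x - h) - (h + h) * f x\<bar> \<le> (h + h) * (h * h / 2) * B"
    using f B h by (intro interpolation_error) auto
  moreover have eq: "h * f (x + h) + h * f (x - h) - (h + h) * f x = - h * (2 * f x - f (x - h) - f (x + h))"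
    by (simp add: algebra_simps)
  moreover have "(h + h) * (h * h / 2) * B = h * (h\<^sup>2 * B)"
    by (simp add: power2_eq_square)
  ultimately have "h * \<bar>2 * f x - f (x - h) - f (x + h)\<bar> \<le> h * (h\<^sup>2 * B)"
    unfolding eq abs_mult using h by (simp only: abs_minus_cancel abs_of_pos)
  then show ?thesis
    using h by (simp only: mult_le_cancel_left_pos)
qed

text \<open>Fixed-point iteration of \<open>r - L x\<close> from 0: the increments decay like
  \<open>\<rho> ^ n * R\<close> in the maximum norm, so every coordinate converges, and the
  geometric series bounds the limit.\<close>

lemma diagonally_dominant_solution:
  fixes L :: "'a \<Rightarrow> 'a \<Rightarrow> real"
  assumes A: "finite A" and row: "\<And>i. i \<in> A \<Longrightarrow> (\<Sum>k\<in>A. \<bar>L i k\<bar>) \<le> \<rho>" and \<rho>: "0 \<le> \<rho>" "\<rho> < 1"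
    and r: "\<And>i. i \<in> A \<Longrightarrow> \<bar>r i\<bar> \<le> R" and R: "0 \<le> R"
  shows "\<exists>x. (\<forall>i\<in>A. x i + (\<Sum>k\<in>A. L i k * x k) = r i) \<and> (\<forall>i\<in>A. \<bar>x i\<bar> \<le> R / (1 - \<rho>))"
proof -
  have apply_row: "\<bar>\<Sum>k\<in>A. L i k * v k\<bar> \<le> \<rho> * c" if "i \<in> A" "\<And>k. k \<in> A \<Longrightarrow> \<bar>v k\<bar> \<le> c" "0 \<le> c" for i c v
  proof -
    have "\<bar>\<Sum>k\<in>A. L i k * v k\<bar> \<le> (\<Sum>k\<in>A. \<bar>L i k\<bar> * c)"
      using that by (intro order_trans [OF sum_abs] sum_mono) (simp add: abs_mult mult_left_mono)
    also have "\<dots> \<le> \<rho> * c"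
      using row [OF that(1)] that(3) by (simp add: mult_right_mono flip: sum_distrib_right)
    finally show ?thesis .
  qed
  define X where "X = rec_nat (\<lambda>i. 0) (\<lambda>_ x i. r i - (\<Sum>k\<in>A. L i k * x k))"
  have X: "X 0 i = 0" "X (Suc n) i = r i - (\<Sum>k\<in>A. L i k * X n k)" for n i
    by (simp_all add: X_def)
  have step: "\<bar>X (Suc n) i - X n i\<bar> \<le> \<rho> ^ n * R" if "i \<in> A" for n i
    using that
  proof (induction n arbitrary: i)
    case 0
    then show ?case
      using r by (simp add: X)
  next
    case (Suc n)
    have "X (Suc (Suc n)) i - X (Suc n) i = - (\<Sum>k\<in>A. L i k * (X (Suc n) k - X n k))"
      by (simp add: X(2) [of "Suc n"] X(2) [of n i] right_diff_distrib sum_subtractf)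
    then have "\<bar>X (Suc (Suc n)) i - X (Suc n) i\<bar> \<le> \<rho> * (\<rho> ^ n * R)"
      using apply_row [OF Suc.prems Suc.IH] \<rho> R by simp
    then show ?case
      by simp
  qed
  have geometric: "summable (\<lambda>n. \<rho> ^ n * R)" "(\<Sum>n. \<rho> ^ n * R) = R / (1 - \<rho>)"
    using \<rho> by (auto intro!: summable_mult2 summable_geometric simp: suminf_mult2 [symmetric] suminf_geometric)
  define x where "x i = (\<Sum>n. X (Suc n) i - X n i)" for i
  have summable: "summable (\<lambda>n. X (Suc n) i - X n i)" if "i \<in> A" for i
    using step [OF that] by (intro summable_comparison_test [OF _ geometric(1)]) auto
  have lim: "(\<lambda>n. X n i) \<longlonglongrightarrow> x i" if "i \<in> A" for i
    using summable_LIMSEQ [OF summable [OF that]] sum_lessThan_telescope [of "\<lambda>n. X n i"]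
    by (simp add: x_def X(1))
  show ?thesis
  proof (intro exI [of _ x] conjI ballI)
    fix i
    assume i: "i \<in> A"
    have "(\<lambda>n. r i - (\<Sum>k\<in>A. L i k * X n k)) \<longlonglongrightarrow> r i - (\<Sum>k\<in>A. L i k * x k)"
      using lim by (intro tendsto_intros)
    then have "(\<lambda>n. X (Suc n) i) \<longlonglongrightarrow> r i - (\<Sum>k\<in>A. L i k * x k)"
      by (simp add: X)
    then show "x i + (\<Sum>k\<in>A. L i k * x k) = r i"
      using LIMSEQ_unique [OF LIMSEQ_Suc [OF lim [OF i]]] by fastforce
  next
    fix i
    assume i: "i \<in> A"
    have abs_summable: "summable (\<lambda>n. \<bar>X (Suc n) i - X n i\<bar>)"
      using step [OF i] by (intro summable_comparison_test [OF _ geometric(1)]) auto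
    have "\<bar>x i\<bar> \<le> (\<Sum>n. \<bar>X (Suc n) i - X n i\<bar>)"
      unfolding x_def by (rule summable_rabs [OF abs_summable])
    also have "\<dots> \<le> (\<Sum>n. \<rho> ^ n * R)"
      by (rule suminf_le [OF step [OF i] abs_summable geometric(1)])
    finally show "\<bar>x i\<bar> \<le> R / (1 - \<rho>)"
      using geometric(2) by simp
  qed
qed

text \<open>
  Applied with \<open>m = 2\<close>, \<open>interp\<close> interpolates the wavelet (which is \<open>- gauss_deriv 2\<close>) linearly between
  the two translates at distances \<open>u\<close> and \<open>\<tau> - u\<close>, and \<open>slope\<close> is their difference, normalised to have
  derivative close to 1 at 0. The index \<open>m\<close> counts derivatives.
\<close>

definition interp :: "nat \<Rightarrow> real \<Rightarrow> real \<Rightarrow> real \<Rightarrow> real" where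
  "interp m \<tau> u y = - ((\<tau> - u) * gauss_deriv m (y + u) + u * gauss_deriv m (y - (\<tau> - u))) / \<tau>"

definition slope :: "nat \<Rightarrow> real \<Rightarrow> real \<Rightarrow> real \<Rightarrow> real" where
  "slope m \<tau> u y = (gauss_deriv m (y + u) - gauss_deriv m (y - (\<tau> - u))) / (3 * \<tau>)"

lemma has_real_derivative_gauss_deriv_chain [derivative_intros]:
  "(f has_real_derivative f') (at x) \<Longrightarrow>
    ((\<lambda>x. gauss_deriv m (f x)) has_real_derivative gauss_deriv (Suc m) (f x) * f') (at x)"
  by (rule DERIV_chain2 [OF has_real_derivative_gauss_deriv])

text \<open>The factor 1/8 comes from \<open>u * (\<tau> - u) \<le> \<tau>^2 / 4\<close>. The
  derivative is only bounded within \<tau> of \<open>y\<close>, so that its zeros can be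
  exploited.\<close>

lemma interp_error:
  assumes u: "0 \<le> u" "u \<le> \<tau>" "0 < \<tau>"
    and B: "\<And>z. \<bar>z - y\<bar> \<le> \<tau> \<Longrightarrow> \<bar>gauss_deriv (m + 2) z\<bar> \<le> B"
  shows "\<bar>interp m \<tau> u y + gauss_deriv m y\<bar> \<le> \<tau>\<^sup>2 / 8 * B"
proof -
  let ?v = "\<tau> - u"
  have "0 \<le> B"
    using B [of y] u by fastforce
  have "\<bar>?v * gauss_deriv m (y + u) + u * gauss_deriv m (y - ?v) - (u + ?v) * gauss_deriv m y\<bar>
      \<le> (u + ?v) * (u * ?v / 2) * B"
    using u B has_real_derivative_gauss_deriv
    by (intro interpolation_error [where f' = "gauss_deriv (Suc m)" and f'' = "gauss_deriv (m + 2)"]) auto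
  moreover have "?v * gauss_deriv m (y + u) + u * gauss_deriv m (y - ?v) - (u + ?v) * gauss_deriv m y
      = - \<tau> * (interp m \<tau> u y + gauss_deriv m y)"
    using u by (simp add: interp_def field_simps)
  ultimately have "\<tau> * \<bar>interp m \<tau> u y + gauss_deriv m y\<bar> \<le> \<tau> * (u * ?v / 2 * B)"
    using u by (simp add: abs_mult)
  then have "\<bar>interp m \<tau> u y + gauss_deriv m y\<bar> \<le> u * ?v / 2 * B"
    using u by simp
  also have "\<dots> \<le> \<tau>\<^sup>2 / 8 * B"
  proof (rule mult_right_mono)
    show "u * ?v / 2 \<le> \<tau>\<^sup>2 / 8"
      using zero_le_power2 [of "u - ?v"] by (simp add: power2_eq_square algebra_simps)
  qed fact
  finally show ?thesis .
qed

lemma abs_interp_le: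
  assumes u: "0 \<le> u" "u \<le> \<tau>" "0 < \<tau>"
    and B: "\<And>z. \<bar>z - y\<bar> \<le> \<tau> \<Longrightarrow> \<bar>gauss_deriv m z\<bar> \<le> B"
  shows "\<bar>interp m \<tau> u y\<bar> \<le> B"
proof -
  have "\<bar>(\<tau> - u) * gauss_deriv m (y + u) + u * gauss_deriv m (y - (\<tau> - u))\<bar> \<le> (\<tau> - u) * B + u * B"
    using u B by (intro order_trans [OF abs_triangle_ineq] add_mono) (auto simp: abs_mult intro!: mult_left_mono)
  then have "\<bar>(\<tau> - u) * gauss_deriv m (y + u) + u * gauss_deriv m (y - (\<tau> - u))\<bar> \<le> \<tau> * B"
    by (simp add: algebra_simps)
  then show ?thesis
    using u by (simp add: interp_def field_simps)
qed

text \<open>By the mean value theorem the two translates differ by \<tau> times a value of the next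
  derivative; the remaining divisor 3 is \<open>gauss_deriv 4 0\<close>.\<close>

lemma abs_slope_le:
  assumes u: "0 \<le> u" "u \<le> \<tau>" "0 < \<tau>"
    and B: "\<And>z. \<bar>z - y\<bar> \<le> \<tau> \<Longrightarrow> \<bar>gauss_deriv (Suc m) z\<bar> \<le> B"
  shows "\<bar>slope m \<tau> u y\<bar> \<le> B / 3"
proof -
  obtain z where z: "y - (\<tau> - u) < z" "z < y + u"
    "gauss_deriv m (y + u) - gauss_deriv m (y - (\<tau> - u)) = (y + u - (y - (\<tau> - u))) * gauss_deriv (Suc m) z"
    using MVT2 [of "y - (\<tau> - u)" "y + u" "gauss_deriv m" "gauss_deriv (Suc m)"] u
      has_real_derivative_gauss_deriv by auto
  then have "slope m \<tau> u y = gauss_deriv (Suc m) z / 3"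
    using u by (simp add: slope_def)
  then show ?thesis
    using B [of z] z(1,2) u by (simp add: abs_le_iff [of "z - y"])
qed

lemma has_real_derivative_interp:
  "\<tau> \<noteq> 0 \<Longrightarrow> ((\<lambda>x. interp m \<tau> u (x - t)) has_real_derivative interp (Suc m) \<tau> u (x - t)) (at x)"
  unfolding interp_def by (auto intro!: derivative_eq_intros simp: field_simps)

lemma has_real_derivative_slope:
  "\<tau> \<noteq> 0 \<Longrightarrow> ((\<lambda>x. slope m \<tau> u (x - t)) has_real_derivative slope (Suc m) \<tau> u (x - t)) (at x)"
  unfolding slope_def by (auto intro!: derivative_eq_intros simp: field_simps)

section \<open>The dual certificate\<close>

text \<open>
  Here \<open>\<sigma> = 1\<close>, \<open>N\<close> consists of corrupted samples, \<open>p t\<close> is the sample to the left of the spike \<open>t\<close>,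
  and \<open>dual \<alpha> \<gamma> (m + 2)\<close> is the \<open>m\<close>-th derivative of the certificate.
\<close>

locale spike_noise =
  fixes T N :: "real set" and \<tau> :: real and p e g :: "real \<Rightarrow> real"
  assumes finite_T: "finite T" and finite_N: "finite N"
    and sep_T: "\<And>a b. a \<in> T \<Longrightarrow> b \<in> T \<Longrightarrow> a \<noteq> b \<Longrightarrow> 5 \<le> \<bar>a - b\<bar>"
    and sep_N: "\<And>a b. a \<in> N \<Longrightarrow> b \<in> N \<Longrightarrow> a \<noteq> b \<Longrightarrow> 5 \<le> \<bar>a - b\<bar>"
    and \<tau>_bounds: "31/400 \<le> \<tau>" "\<tau> \<le> 33/200"
    and p_bounds: "\<And>t. t \<in> T \<Longrightarrow> p t \<le> t" "\<And>t. t \<in> T \<Longrightarrow> t \<le> p t + \<tau>"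
    and e_sign: "\<And>t. \<bar>e t\<bar> = 1" and g_sign: "\<And>s. \<bar>g s\<bar> = 1"
begin

definition noise :: "nat \<Rightarrow> real \<Rightarrow> real" where
  "noise m x = (\<Sum>s\<in>N. g s * (2 * gauss_deriv m (x - s) - gauss_deriv m (x - s - \<tau>) - gauss_deriv m (x - s + \<tau>)))"

definition spike_part :: "(real \<Rightarrow> real) \<Rightarrow> (real \<Rightarrow> real) \<Rightarrow> nat \<Rightarrow> real \<Rightarrow> real \<Rightarrow> real" where
  "spike_part \<alpha> \<gamma> m x t = \<alpha> t * interp m \<tau> (t - p t) (x - t) + \<gamma> t * slope m \<tau> (t - p t) (x - t)"

text \<open>The noise is subtracted because \<open>noise\<close> is written with
  \<open>gauss_deriv 2\<close>, minus the wavelet. In \<open>interp\<close> this sign is built in,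
  and in \<open>slope\<close> it is absorbed by the order of the difference.\<close>

definition dual :: "(real \<Rightarrow> real) \<Rightarrow> (real \<Rightarrow> real) \<Rightarrow> nat \<Rightarrow> real \<Rightarrow> real" where
  "dual \<alpha> \<gamma> m x = (\<Sum>t\<in>T. spike_part \<alpha> \<gamma> m x t) - noise m x"

lemma \<tau>_pos: "0 < \<tau>"
  using \<tau>_bounds by simp

lemma \<tau>_square: "\<tau>\<^sup>2 \<le> 1089/40000"
  using power_mono [OF \<tau>_bounds(2), of 2] \<tau>_bounds by (simp add: power2_eq_square)

lemma offset: "t \<in> T \<Longrightarrow> 0 \<le> t - p t" "t \<in> T \<Longrightarrow> t - p t \<le> \<tau>"
  using p_bounds [of t] by simp_all

lemma has_real_derivative_dual: "(dual \<alpha> \<gamma> m has_real_derivative dual \<alpha> \<gamma> (Suc m) x) (at x)"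
proof -
  have "((\<lambda>x. spike_part \<alpha> \<gamma> m x t) has_real_derivative spike_part \<alpha> \<gamma> (Suc m) x t) (at x)" for t
    unfolding spike_part_def using \<tau>_pos
    by (auto intro!: derivative_eq_intros has_real_derivative_interp has_real_derivative_slope)
  moreover have "(noise m has_real_derivative noise (Suc m) x) (at x)"
    unfolding noise_def [abs_def] by (auto intro!: derivative_eq_intros simp: mult.commute)
  ultimately show ?thesis
    unfolding dual_def [abs_def] by (intro DERIV_diff DERIV_sum)
qed

text \<open>The second difference is taken of the whole sum \<open>F\<close>, not term by term: the
  Taylor remainder then is evaluated at points common to all summands, where the separation of
  \<open>N\<close> bounds the sum.\<close>

lemma abs_noise_le:
  assumes "\<And>y. (\<Sum>s\<in>N. \<bar>gauss_deriv (m + 2) (y - s)\<bar>) \<le> M"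
  shows "\<bar>noise m x\<bar> \<le> \<tau>\<^sup>2 * M"
proof -
  define F where "F k y = (\<Sum>s\<in>N. g s * gauss_deriv k (y - s))" for k y
  have F: "(F k has_real_derivative F (Suc k) y) (at y)" for k y
    unfolding F_def [abs_def] by (auto intro!: derivative_eq_intros simp: mult.commute)
  have "\<bar>F (m + 2) y\<bar> \<le> M" for y
  proof -
    have "\<bar>F (m + 2) y\<bar> \<le> (\<Sum>s\<in>N. \<bar>gauss_deriv (m + 2) (y - s)\<bar>)"
      unfolding F_def by (intro order_trans [OF sum_abs]) (simp add: abs_mult g_sign)
    also have "\<dots> \<le> M"
      by (rule assms)
    finally show ?thesis .
  qed
  then have "\<bar>2 * F m x - F m (x - \<tau>) - F m (x + \<tau>)\<bar> \<le> \<tau>\<^sup>2 * M"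
    using F [of m] F [of "Suc m"] \<tau>_pos by (intro second_difference_le) simp_all
  moreover have "2 * F m x - F m (x - \<tau>) - F m (x + \<tau>) = noise m x"
    unfolding F_def noise_def sum_distrib_left sum_subtractf [symmetric]
    by (intro sum.cong) (simp_all add: algebra_simps)
  ultimately show ?thesis
    by simp
qed

text \<open>\<open>noise 3\<close> keeps its factor \<tau>^2 because it drives \<gamma>, which is
  later compared with \<tau> itself.\<close>

lemma noise_bounds: "\<bar>noise 2 x\<bar> \<le> 47/500" "\<bar>noise 3 x\<bar> \<le> 129/20 * \<tau>\<^sup>2" "\<bar>noise 4 x\<bar> \<le> 1089/2500"
proof -
  have "\<bar>noise 2 x\<bar> \<le> \<tau>\<^sup>2 * (69/20)"
    using sum_abs_gauss_deriv_le(1) [OF finite_N sep_N] by (intro abs_noise_le) simp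
  then show "\<bar>noise 2 x\<bar> \<le> 47/500"
    using \<tau>_square by simp
  show "\<bar>noise 3 x\<bar> \<le> 129/20 * \<tau>\<^sup>2"
    using abs_noise_le [of 3 "129/20" x] sum_abs_gauss_deriv_le(2) [OF finite_N sep_N] by (simp add: mult.commute)
  have "\<bar>noise 4 x\<bar> \<le> \<tau>\<^sup>2 * 16"
    using sum_abs_gauss_deriv_le(3) [OF finite_N sep_N] by (intro abs_noise_le) simp
  then show "\<bar>noise 4 x\<bar> \<le> 1089/2500"
    using \<tau>_square by simp
qed

text \<open>Translates sit at samples, distances are measured from the spike; passing between the
  two costs at most \<open>exp (33/100) \<le> 7/5\<close>.\<close>

lemma exp_shift_le:
  assumes "\<bar>z - y\<bar> \<le> \<tau>"
  shows "exp (- 2 * \<bar>z\<bar>) \<le> 7/5 * exp (- 2 * \<bar>y\<bar>)"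
proof -
  have "5/7 \<le> exp (- (33/100) :: real)"
    using exp_taylor_le [of "- (33/100)" 3] by (simp add: atMost_nat_numeral fact_numeral power_divide)
  then have "exp (33/100 :: real) \<le> 7/5"
    by (simp add: exp_minus field_simps)
  moreover have "exp (- 2 * \<bar>z\<bar>) \<le> exp (33/100 + - 2 * \<bar>y\<bar>)"
    using assms \<tau>_bounds by simp
  then have "exp (- 2 * \<bar>z\<bar>) \<le> exp (33/100) * exp (- 2 * \<bar>y\<bar>)"
    by (simp only: exp_add)
  ultimately show ?thesis
    by (meson exp_ge_zero mult_right_mono order_trans)
qed

lemma abs_spike_part_tail_le:
  assumes t: "t \<in> T" and far: "112/25 \<le> \<bar>x - t\<bar>"
    and tail: "\<And>z. 43/10 \<le> \<bar>z\<bar> \<Longrightarrow> \<bar>gauss_deriv m z\<bar> \<le> c * exp (- 2 * \<bar>z\<bar>)"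
      "\<And>z. 43/10 \<le> \<bar>z\<bar> \<Longrightarrow> \<bar>gauss_deriv (Suc m) z\<bar> \<le> c' * exp (- 2 * \<bar>z\<bar>)"
    and c: "0 \<le> c" "0 \<le> c'" and coeffs: "\<bar>\<alpha> t\<bar> \<le> A" "\<bar>\<gamma> t\<bar> \<le> B"
  shows "\<bar>spike_part \<alpha> \<gamma> m x t\<bar> \<le> 7/5 * (A * c + B * c' / 3) * exp (- 2 * \<bar>x - t\<bar>)"
proof -
  let ?E = "exp (- 2 * \<bar>x - t\<bar>)"
  have shift: "C * exp (- 2 * \<bar>z\<bar>) \<le> C * (7/5 * ?E)" if "\<bar>z - (x - t)\<bar> \<le> \<tau>" "0 \<le> C" for z C
    using exp_shift_le [OF that(1)] that(2) by (rule mult_left_mono)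
  have ge: "43/10 \<le> \<bar>z\<bar>" if "\<bar>z - (x - t)\<bar> \<le> \<tau>" for z
    using that far \<tau>_bounds by linarith
  have "\<bar>gauss_deriv m z\<bar> \<le> c * (7/5 * ?E)" if "\<bar>z - (x - t)\<bar> \<le> \<tau>" for z
    using tail(1) [OF ge [OF that]] shift [OF that c(1)] by (rule order_trans)
  from abs_interp_le [OF offset [OF t] \<tau>_pos this]
  have interp: "\<bar>interp m \<tau> (t - p t) (x - t)\<bar> \<le> c * (7/5 * ?E)" .
  have "\<bar>gauss_deriv (Suc m) z\<bar> \<le> c' * (7/5 * ?E)" if "\<bar>z - (x - t)\<bar> \<le> \<tau>" for z
    using tail(2) [OF ge [OF that]] shift [OF that c(2)] by (rule order_trans)
  from abs_slope_le [OF offset [OF t] \<tau>_pos this]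
  have slope: "\<bar>slope m \<tau> (t - p t) (x - t)\<bar> \<le> c' * (7/5 * ?E) / 3" .
  have AB: "0 \<le> A" "0 \<le> B"
    using coeffs abs_ge_zero order_trans by blast+
  have "\<bar>\<alpha> t\<bar> * \<bar>interp m \<tau> (t - p t) (x - t)\<bar> \<le> A * (c * (7/5 * ?E))"
    by (rule mult_mono [OF coeffs(1) interp AB(1) abs_ge_zero])
  moreover have "\<bar>\<gamma> t\<bar> * \<bar>slope m \<tau> (t - p t) (x - t)\<bar> \<le> B * (c' * (7/5 * ?E) / 3)"
    by (rule mult_mono [OF coeffs(2) slope AB(2) abs_ge_zero])
  ultimately have "\<bar>spike_part \<alpha> \<gamma> m x t\<bar> \<le> A * (c * (7/5 * ?E)) + B * (c' * (7/5 * ?E) / 3)"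
    unfolding spike_part_def by (intro order_trans [OF abs_triangle_ineq]) (simp add: abs_mult)
  then show ?thesis
    by (simp add: algebra_simps)
qed

text \<open>The factor 14007/5000 is 2001/1000 from the geometric series times 7/5 from the shift to
  the samples.\<close>

lemma sum_spike_part_tail_le:
  assumes S: "S \<subseteq> T" and d: "112/25 \<le> d" "\<And>t. t \<in> S \<Longrightarrow> d \<le> \<bar>x - t\<bar>"
    and tail: "\<And>z. 43/10 \<le> \<bar>z\<bar> \<Longrightarrow> \<bar>gauss_deriv m z\<bar> \<le> c * exp (- 2 * \<bar>z\<bar>)"
      "\<And>z. 43/10 \<le> \<bar>z\<bar> \<Longrightarrow> \<bar>gauss_deriv (Suc m) z\<bar> \<le> c' * exp (- 2 * \<bar>z\<bar>)"
    and c: "0 \<le> c" "0 \<le> c'" and AB: "0 \<le> A" "0 \<le> B"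
    and coeffs: "\<And>t. t \<in> T \<Longrightarrow> \<bar>\<alpha> t\<bar> \<le> A" "\<And>t. t \<in> T \<Longrightarrow> \<bar>\<gamma> t\<bar> \<le> B"
  shows "(\<Sum>t\<in>S. \<bar>spike_part \<alpha> \<gamma> m x t\<bar>) \<le> 14007/5000 * (A * c + B * c' / 3) * exp (- 2 * d)"
proof -
  have "(\<Sum>t\<in>S. \<bar>spike_part \<alpha> \<gamma> m x t\<bar>) \<le> 2001/1000 * (7/5 * (A * c + B * c' / 3)) * exp (- 2 * d)"
  proof (rule sum_separated_tail_le)
    show "finite S"
      using S finite_T by (rule finite_subset)
    show "5 \<le> \<bar>a - b\<bar>" if "a \<in> S" "b \<in> S" "a \<noteq> b" for a b
      using S sep_T that by blast
    show "\<bar>spike_part \<alpha> \<gamma> m x t\<bar> \<le> 7/5 * (A * c + B * c' / 3) * exp (- 2 * \<bar>x - t\<bar>)" if "t \<in> S" for t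
      using that S d tail c coeffs by (intro abs_spike_part_tail_le) force+
  qed (use d c AB in auto)
  then show ?thesis
    by simp
qed

section \<open>The linear system for the spike coefficients\<close>

text \<open>The 2 by 2 block of the system at one spike is close to the identity.
  \<open>slope 3\<close> is near 1 because \<open>gauss_deriv 3 x\<close> is nearly
  \<open>3 * x\<close> and the distances to the two samples add up to \<tau>; the mixed entries are
  of order \<tau> and \<tau>^3.\<close>

lemma diagonal_bounds:
  assumes t: "t \<in> T"
  shows "\<bar>interp 2 \<tau> (t - p t) 0 - 1\<bar> \<le> 103/10000" "\<bar>slope 2 \<tau> (t - p t) 0\<bar> \<le> 33/400"
    and "\<bar>interp 3 \<tau> (t - p t) 0\<bar> \<le> 15/8 * \<tau>^3" "\<bar>slope 3 \<tau> (t - p t) 0 - 1\<bar> \<le> 227/10000"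
proof -
  define u where "u = t - p t"
  define v where "v = \<tau> - u"
  have uv: "0 \<le> u" "u \<le> \<tau>" "0 \<le> v" "v \<le> \<tau>" "u \<le> 1" "v \<le> 1"
    using offset [OF t] \<tau>_bounds by (simp_all add: u_def v_def)
  have at_0: "gauss_deriv 2 0 = - 1" "gauss_deriv 3 0 = 0"
    by (simp_all add: gauss_deriv_def hermite_simps)
  have odd: "gauss_deriv 3 (- v) = - gauss_deriv 3 v" and even: "gauss_deriv 2 (- v) = gauss_deriv 2 v"
    using gauss_deriv_minus [of 3 v] gauss_deriv_minus [of 2 v] by simp_all
  have "\<bar>interp 2 \<tau> u 0 + gauss_deriv 2 0\<bar> \<le> \<tau>\<^sup>2 / 8 * 3"
    using uv \<tau>_pos abs_gauss_deriv_4_le by (intro interp_error) simp_all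
  then show "\<bar>interp 2 \<tau> (t - p t) 0 - 1\<bar> \<le> 103/10000"
    using \<tau>_square at_0 by (simp flip: u_def)
  \<comment> \<open>As \<open>gauss_deriv 5\<close> vanishes at 0, it is at most 15 \<tau> on the
    window, which gains the third power of \<tau>.\<close>
  have "\<bar>interp 3 \<tau> u 0 + gauss_deriv 3 0\<bar> \<le> \<tau>\<^sup>2 / 8 * (15 * \<tau>)"
  proof (rule interp_error)
    fix z
    assume z: "\<bar>z - 0\<bar> \<le> \<tau>"
    then have "\<bar>gauss_deriv 5 z\<bar> \<le> 15 * \<bar>z\<bar>"
      using \<tau>_bounds by (intro abs_gauss_deriv_5_near_0) simp
    then show "\<bar>gauss_deriv (3 + 2) z\<bar> \<le> 15 * \<tau>"
      using z by simp
  qed (use uv \<tau>_pos in auto)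
  then show "\<bar>interp 3 \<tau> (t - p t) 0\<bar> \<le> 15/8 * \<tau>^3"
    using at_0 by (simp add: power2_eq_square power3_eq_cube flip: u_def)
  have "u\<^sup>2 \<le> \<tau>\<^sup>2" "v\<^sup>2 \<le> \<tau>\<^sup>2"
    using uv by (auto intro: power_mono)
  then have "\<bar>gauss_deriv 2 u - gauss_deriv 2 v\<bar> \<le> 3/2 * \<tau>\<^sup>2"
    using gauss_deriv_2_near_0 [of u] gauss_deriv_2_near_0 [of v] uv by linarith
  also have "\<dots> \<le> 3 * \<tau> * (33/400)"
    using \<tau>_bounds \<tau>_pos by (simp add: power2_eq_square)
  finally show "\<bar>slope 2 \<tau> (t - p t) 0\<bar> \<le> 33/400"
    using \<tau>_pos even by (simp add: slope_def divide_le_eq mult.commute flip: u_def v_def)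
  have "u\<^sup>2 * u \<le> \<tau>\<^sup>2 * u" "v\<^sup>2 * v \<le> \<tau>\<^sup>2 * v"
    using uv by (auto intro!: mult_right_mono power_mono)
  then have "u^3 + v^3 \<le> \<tau>\<^sup>2 * \<tau>"
    by (simp add: v_def power2_eq_square power3_eq_cube algebra_simps)
  also have "\<dots> \<le> 1089/40000 * \<tau>"
    using \<tau>_square \<tau>_pos by (intro mult_right_mono) simp_all
  finally have "\<bar>gauss_deriv 3 u + gauss_deriv 3 v - 3 * \<tau>\<bar> \<le> 3 * \<tau> * (227/10000)"
    using gauss_deriv_3_near_0 [of u] gauss_deriv_3_near_0 [of v] uv \<tau>_pos by (simp add: abs_le_iff v_def)
  moreover have "slope 3 \<tau> u 0 - 1 = (gauss_deriv 3 u + gauss_deriv 3 v - 3 * \<tau>) / (3 * \<tau>)"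
    using odd \<tau>_pos by (simp add: slope_def field_simps flip: v_def)
  ultimately show "\<bar>slope 3 \<tau> (t - p t) 0 - 1\<bar> \<le> 227/10000"
    using \<tau>_pos by (simp add: divide_le_eq mult.commute flip: u_def)
qed

lemma exp_uminus_10: "exp (- 10 :: real) \<le> 1 / 20000"
  by (rule exp_uminus_le) (simp_all add: field_simps)

lemma off_diagonal_bounds:
  assumes t: "t \<in> T" and AB: "0 \<le> A" "0 \<le> B"
    and coeffs: "\<And>k. k \<in> T \<Longrightarrow> \<bar>\<alpha> k\<bar> \<le> A" "\<And>k. k \<in> T \<Longrightarrow> \<bar>\<gamma> k\<bar> \<le> B"
  shows "(\<Sum>k\<in>T - {t}. \<bar>spike_part \<alpha> \<gamma> 2 t k\<bar>) \<le> 3/20000 * (19/2 * A + 35 / 3 * B)"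
    and "(\<Sum>k\<in>T - {t}. \<bar>spike_part \<alpha> \<gamma> 3 t k\<bar>) \<le> 3/20000 * (35 * A + 125 / 3 * B)"
proof -
  have exp_le: "14007/5000 * C * exp (- 2 * 5) \<le> 3/20000 * C" if "0 \<le> C" for C :: real
    using mult_left_mono [OF exp_uminus_10, of "14007/5000 * C"] that by simp
  have "(\<Sum>k\<in>T - {t}. \<bar>spike_part \<alpha> \<gamma> 2 t k\<bar>) \<le> 14007/5000 * (A * (19/2) + B * 35 / 3) * exp (- 2 * 5)"
    using t sep_T AB coeffs abs_gauss_deriv_2_tail abs_gauss_deriv_3_tail
    by (intro sum_spike_part_tail_le) auto
  also have "\<dots> \<le> 3/20000 * (A * (19/2) + B * 35 / 3)"
    using AB by (intro exp_le) simp
  finally show "(\<Sum>k\<in>T - {t}. \<bar>spike_part \<alpha> \<gamma> 2 t k\<bar>) \<le> 3/20000 * (19/2 * A + 35 / 3 * B)"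
    by (simp add: mult.commute)
  have "(\<Sum>k\<in>T - {t}. \<bar>spike_part \<alpha> \<gamma> 3 t k\<bar>) \<le> 14007/5000 * (A * 35 + B * 125 / 3) * exp (- 2 * 5)"
    using t sep_T AB coeffs abs_gauss_deriv_3_tail abs_gauss_deriv_4_tail
    by (intro sum_spike_part_tail_le) auto
  also have "\<dots> \<le> 3/20000 * (A * 35 + B * 125 / 3)"
    using AB by (intro exp_le) simp
  finally show "(\<Sum>k\<in>T - {t}. \<bar>spike_part \<alpha> \<gamma> 3 t k\<bar>) \<le> 3/20000 * (35 * A + 125 / 3 * B)"
    by (simp add: mult.commute)
qed

text \<open>In the index set \<open>T\<close> times bool, \<open>True\<close> stands for the value
  equation and the unknown \<alpha>, \<open>False\<close> for the derivative equation and the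
  unknown \<gamma>. With the identity split off, the row sums are below 0.097 and 0.043. The
  right-hand side is at most 1 + 0.094, and 1.094 / 0.9 < 61/50.\<close>

lemma interpolation_coefficients_exist:
  obtains \<alpha> \<gamma> where "\<And>t. t \<in> T \<Longrightarrow> dual \<alpha> \<gamma> 2 t = e t" "\<And>t. t \<in> T \<Longrightarrow> dual \<alpha> \<gamma> 3 t = 0"
    "\<And>t. t \<in> T \<Longrightarrow> \<bar>\<alpha> t\<bar> \<le> 61/50" "\<And>t. t \<in> T \<Longrightarrow> \<bar>\<gamma> t\<bar> \<le> 61/50"
proof -
  let ?I = "T \<times> (UNIV :: bool set)"
  define ord :: "bool \<Rightarrow> nat" where "ord i = (if i then 2 else 3)" for i
  define basis where "basis j m k x =
    (if j then interp m \<tau> (k - p k) (x - k) else slope m \<tau> (k - p k) (x - k))" for j m k x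
  define L where "L a b = basis (snd b) (ord (snd a)) (fst b) (fst a) - (if a = b then 1 else 0)"
    for a b :: "real \<times> bool"
  define r where "r a = (if snd a then e (fst a) else 0) + noise (ord (snd a)) (fst a)" for a :: "real \<times> bool"
  have row: "(\<Sum>b\<in>?I. \<bar>L a b\<bar>) \<le> 1/10" if "a \<in> ?I" for a
  proof -
    obtain t i where a: "a = (t, i)"
      by (cases a)
    then have t: "t \<in> T"
      using that by simp
    have off: "\<bar>L a (k, True)\<bar> + \<bar>L a (k, False)\<bar>
        = \<bar>spike_part (\<lambda>_. 1) (\<lambda>_. 0) (ord i) t k\<bar> + \<bar>spike_part (\<lambda>_. 0) (\<lambda>_. 1) (ord i) t k\<bar>" if "k \<noteq> t" for k
      using that by (simp add: a L_def basis_def spike_part_def)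
    have "(\<Sum>b\<in>?I. \<bar>L a b\<bar>) = (\<Sum>k\<in>T. \<Sum>j\<in>UNIV. \<bar>L a (k, j)\<bar>)"
      by (simp add: sum.cartesian_product)
    also have "\<dots> = (\<Sum>k\<in>T. \<bar>L a (k, True)\<bar> + \<bar>L a (k, False)\<bar>)"
      by (simp add: UNIV_bool add.commute)
    also have "\<dots> = \<bar>L a (t, True)\<bar> + \<bar>L a (t, False)\<bar> + (\<Sum>k\<in>T - {t}. \<bar>L a (k, True)\<bar> + \<bar>L a (k, False)\<bar>)"
      using finite_T t by (simp add: sum.remove)
    also have "(\<Sum>k\<in>T - {t}. \<bar>L a (k, True)\<bar> + \<bar>L a (k, False)\<bar>)
        = (\<Sum>k\<in>T - {t}. \<bar>spike_part (\<lambda>_. 1) (\<lambda>_. 0) (ord i) t k\<bar>)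
          + (\<Sum>k\<in>T - {t}. \<bar>spike_part (\<lambda>_. 0) (\<lambda>_. 1) (ord i) t k\<bar>)"
      unfolding sum.distrib [symmetric] using off by (intro sum.cong) auto
    finally have split: "(\<Sum>b\<in>?I. \<bar>L a b\<bar>) = \<bar>L a (t, True)\<bar> + \<bar>L a (t, False)\<bar>
        + ((\<Sum>k\<in>T - {t}. \<bar>spike_part (\<lambda>_. 1) (\<lambda>_. 0) (ord i) t k\<bar>)
          + (\<Sum>k\<in>T - {t}. \<bar>spike_part (\<lambda>_. 0) (\<lambda>_. 1) (ord i) t k\<bar>))" .
    have "\<tau>^3 \<le> (33/200)^3"
      using \<tau>_bounds by (intro power_mono) simp_all
    then show ?thesis
      using diagonal_bounds [OF t] off_diagonal_bounds [OF t, of 1 0 "\<lambda>_. 1" "\<lambda>_. 0"]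
        off_diagonal_bounds [OF t, of 0 1 "\<lambda>_. 0" "\<lambda>_. 1"]
      unfolding split by (cases i) (simp_all add: a L_def basis_def ord_def power3_eq_cube)
  qed
  have rhs: "\<bar>r a\<bar> \<le> 547/500" if "a \<in> ?I" for a
    using noise_bounds(1,2) [of "fst a"] \<tau>_square e_sign [of "fst a"]
      abs_triangle_ineq [of "e (fst a)" "noise 2 (fst a)"] by (simp add: r_def ord_def)
  have "finite ?I" "0 \<le> (1/10 :: real)" "1/10 < (1 :: real)" "0 \<le> (547/500 :: real)"
    using finite_T by simp_all
  from diagonally_dominant_solution [OF this(1) row this(2,3) rhs this(4)]
  have "\<exists>x. (\<forall>a\<in>?I. x a + (\<Sum>b\<in>?I. L a b * x b) = r a) \<and> (\<forall>a\<in>?I. \<bar>x a\<bar> \<le> 547/500 / (1 - 1/10))" .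
  then obtain x where x: "\<forall>a\<in>?I. x a + (\<Sum>b\<in>?I. L a b * x b) = r a"
    "\<forall>a\<in>?I. \<bar>x a\<bar> \<le> 547/500 / (1 - 1/10)"
    by (elim exE conjE)
  define \<alpha> where "\<alpha> t = x (t, True)" for t
  define \<gamma> where "\<gamma> t = x (t, False)" for t
  have eq: "(\<Sum>k\<in>T. spike_part \<alpha> \<gamma> (ord i) t k) = r (t, i)" if t: "t \<in> T" for t i
  proof -
    have "r (t, i) = (\<Sum>b\<in>?I. (if (t, i) = b then x b else 0)) + (\<Sum>b\<in>?I. L (t, i) b * x b)"
      using bspec [OF x(1), of "(t, i)"] t finite_T by simp
    also have "\<dots> = (\<Sum>b\<in>?I. basis (snd b) (ord i) (fst b) t * x b)"
      unfolding sum.distrib [symmetric] by (intro sum.cong) (auto simp: L_def left_diff_distrib)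
    also have "\<dots> = (\<Sum>k\<in>T. \<Sum>j\<in>UNIV. basis j (ord i) k t * x (k, j))"
      by (simp add: sum.cartesian_product case_prod_beta)
    also have "\<dots> = (\<Sum>k\<in>T. spike_part \<alpha> \<gamma> (ord i) t k)"
      by (simp add: UNIV_bool basis_def spike_part_def \<alpha>_def \<gamma>_def algebra_simps)
    finally show ?thesis
      by simp
  qed
  show ?thesis
  proof
    fix t
    assume t: "t \<in> T"
    show "dual \<alpha> \<gamma> 2 t = e t" "dual \<alpha> \<gamma> 3 t = 0"
      using eq [OF t, of True] eq [OF t, of False] by (simp_all add: dual_def r_def ord_def)
    show "\<bar>\<alpha> t\<bar> \<le> 61/50" "\<bar>\<gamma> t\<bar> \<le> 61/50"
      using bspec [OF x(2), of "(t, True)"] bspec [OF x(2), of "(t, False)"] t by (simp_all add: \<alpha>_def \<gamma>_def)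
  qed
qed

text \<open>A second pass through the equations. In the derivative equation at \<open>t\<close> the
  prescribed value is 0, so solving it for \<open>\<gamma> t\<close>, with the rough bounds inserted
  in the other terms, leaves only small terms. The value equation then puts
  \<open>\<alpha> t\<close> near \<open>e t\<close>.\<close>

lemma coefficient_bounds:
  assumes interpolates: "\<And>t. t \<in> T \<Longrightarrow> dual \<alpha> \<gamma> 2 t = e t" "\<And>t. t \<in> T \<Longrightarrow> dual \<alpha> \<gamma> 3 t = 0"
    and rough: "\<And>t. t \<in> T \<Longrightarrow> \<bar>\<alpha> t\<bar> \<le> 61/50" "\<And>t. t \<in> T \<Longrightarrow> \<bar>\<gamma> t\<bar> \<le> 61/50"
    and t: "t \<in> T"
  shows "\<bar>\<gamma> t\<bar> \<le> 41/200" "\<bar>\<gamma> t\<bar> \<le> 7/5 * \<tau>" "\<bar>\<alpha> t - e t\<bar> \<le> 16/125"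
proof -
  define off where "off m = (\<Sum>k\<in>T - {t}. spike_part \<alpha> \<gamma> m t k)" for m
  have dual: "dual \<alpha> \<gamma> m t = \<alpha> t * interp m \<tau> (t - p t) 0 + \<gamma> t * slope m \<tau> (t - p t) 0 + off m - noise m t" for m
    using finite_T t by (simp add: dual_def off_def sum.remove spike_part_def)
  have abs_off: "\<bar>off m\<bar> \<le> (\<Sum>k\<in>T - {t}. \<bar>spike_part \<alpha> \<gamma> m t k\<bar>)" for m
    unfolding off_def by (rule sum_abs)
  have off: "\<bar>off 2\<bar> \<le> 39/10000" "\<bar>off 3\<bar> \<le> 351/25000"
    using order_trans [OF abs_off off_diagonal_bounds(1) [OF t _ _ rough]]
      order_trans [OF abs_off off_diagonal_bounds(2) [OF t _ _ rough]] by simp_all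
  note diag = diagonal_bounds [OF t]
  have \<gamma>_slope: "\<bar>\<gamma> t * (slope 3 \<tau> (t - p t) 0 - 1)\<bar> \<le> \<bar>\<gamma> t\<bar> * (227/10000)"
    unfolding abs_mult using diag(4) by (intro mult_left_mono) simp_all
  have \<alpha>_interp: "\<bar>\<alpha> t * interp 3 \<tau> (t - p t) 0\<bar> \<le> 61/50 * (15/8 * \<tau>^3)"
    unfolding abs_mult using diag(3) rough(1) [OF t] by (intro mult_mono) simp_all
  have "\<gamma> t = - (\<gamma> t * (slope 3 \<tau> (t - p t) 0 - 1)) - \<alpha> t * interp 3 \<tau> (t - p t) 0 - off 3 + noise 3 t"
    using dual [of 3] interpolates(2) [OF t] by (simp add: right_diff_distrib)
  then have \<gamma>: "\<bar>\<gamma> t\<bar> \<le> \<bar>\<gamma> t\<bar> * (227/10000) + 61/50 * (15/8 * \<tau>^3) + 351/25000 + 129/20 * \<tau>\<^sup>2"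
    using \<gamma>_slope \<alpha>_interp off(2) noise_bounds(2) [of t] by linarith
  have "\<tau>^3 \<le> (33/200)^3"
    using \<tau>_bounds by (intro power_mono) simp_all
  then show \<gamma>_le: "\<bar>\<gamma> t\<bar> \<le> 41/200"
    using \<gamma> \<tau>_square by (simp add: power3_eq_cube)
  have "\<tau>\<^sup>2 \<le> 33/200 * \<tau>" "\<tau>^3 \<le> 1089/40000 * \<tau>"
    using \<tau>_bounds \<tau>_pos \<tau>_square by (simp_all add: power2_eq_square power3_eq_cube mult_right_mono)
  \<comment> \<open>The constant 351/25000 caused by the other spikes is below 0.182 \<tau>, by the
    lower limit for \<tau>. The quadratic and cubic terms carry a factor \<tau> already.\<close>
  then show "\<bar>\<gamma> t\<bar> \<le> 7/5 * \<tau>"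
    using \<gamma> \<tau>_bounds by simp
  have "\<bar>\<alpha> t * (interp 2 \<tau> (t - p t) 0 - 1)\<bar> \<le> 61/50 * (103/10000)"
    unfolding abs_mult using diag(1) rough(1) [OF t] by (intro mult_mono) simp_all
  moreover have "\<bar>\<gamma> t * slope 2 \<tau> (t - p t) 0\<bar> \<le> 41/200 * (33/400)"
    unfolding abs_mult using diag(2) \<gamma>_le by (intro mult_mono) simp_all
  moreover have "\<alpha> t - e t = - (\<alpha> t * (interp 2 \<tau> (t - p t) 0 - 1)) - \<gamma> t * slope 2 \<tau> (t - p t) 0 - off 2 + noise 2 t"
    using dual [of 2] interpolates(1) [OF t] by (simp add: right_diff_distrib)
  ultimately show "\<bar>\<alpha> t - e t\<bar> \<le> 16/125"
    using off(1) noise_bounds(1) [of t] by linarith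
qed

section \<open>The size of the certificate\<close>

text \<open>After multiplication by the sign, the interpolated wavelet at \<open>t\<close>
  contributes at most - 1.04 to the second derivative, whereas the slope term, the other spikes and
  the noise contribute at most 0.404 + 0.065 + 0.436. The second claim is the easy side of the bound
  by 1.\<close>

lemma dual_near_spike:
  assumes coeffs: "\<And>t. t \<in> T \<Longrightarrow> \<bar>\<alpha> t - e t\<bar> \<le> 16/125" "\<And>t. t \<in> T \<Longrightarrow> \<bar>\<gamma> t\<bar> \<le> 41/200"
    and t: "t \<in> T" and near: "\<bar>x - t\<bar> \<le> 13/25"
  shows "e t * dual \<alpha> \<gamma> 4 x < 0" "- 1 < e t * dual \<alpha> \<gamma> 2 x"
proof -
  define y where "y = x - t"
  define \<epsilon> where "\<epsilon> = e t"
  define off where "off m = (\<Sum>k\<in>T - {t}. spike_part \<alpha> \<gamma> m x k)" for m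
  have \<epsilon>: "\<bar>\<epsilon>\<bar> = 1" "\<epsilon> * \<epsilon> = 1"
    using e_sign [of t] abs_mult_self_eq [of "e t"] by (simp_all add: \<epsilon>_def)
  have \<alpha>_le: "\<bar>\<alpha> k\<bar> \<le> 141/125" if "k \<in> T" for k
    using coeffs(1) [OF that] e_sign [of k] by linarith
  have \<epsilon>\<alpha>_eq: "\<epsilon> * (\<alpha> t - e t) = \<epsilon> * \<alpha> t - 1"
    using \<epsilon>(2) by (simp add: \<epsilon>_def right_diff_distrib)
  have "\<bar>\<epsilon> * (\<alpha> t - e t)\<bar> \<le> 16/125"
    using coeffs(1) [OF t] \<epsilon> by (simp add: abs_mult)
  then have \<epsilon>\<alpha>: "109/125 \<le> \<epsilon> * \<alpha> t" "\<epsilon> * \<alpha> t \<le> 141/125"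
    using \<epsilon>\<alpha>_eq by linarith+
  have dual: "\<epsilon> * dual \<alpha> \<gamma> m x = (\<epsilon> * \<alpha> t) * interp m \<tau> (t - p t) y
      + \<epsilon> * (\<gamma> t * slope m \<tau> (t - p t) y) + \<epsilon> * off m - \<epsilon> * noise m x" for m
    using finite_T t by (simp add: dual_def off_def sum.remove spike_part_def y_def algebra_simps)
  \<comment> \<open>112/25 = 5 - 13/25.\<close>
  have far: "112/25 \<le> \<bar>x - k\<bar>" if "k \<in> T - {t}" for k
  proof -
    have "5 \<le> \<bar>k - t\<bar>"
      using sep_T that t by blast
    then show ?thesis
      using near by linarith
  qed
  have q: "exp (- 2 * (112/25) :: real) \<le> 34/250000"
    using exp_uminus_le [of "224/25" "34/250000"] by (simp add: field_simps)
  have off_le: "\<bar>off m\<bar> \<le> 14007/5000 * (141/125 * c + 41/200 * c' / 3) * (34/250000)"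
    if "\<And>z. 43/10 \<le> \<bar>z\<bar> \<Longrightarrow> \<bar>gauss_deriv m z\<bar> \<le> c * exp (- 2 * \<bar>z\<bar>)"
      "\<And>z. 43/10 \<le> \<bar>z\<bar> \<Longrightarrow> \<bar>gauss_deriv (Suc m) z\<bar> \<le> c' * exp (- 2 * \<bar>z\<bar>)" "0 \<le> c" "0 \<le> c'" for m c c'
  proof -
    have "\<bar>off m\<bar> \<le> (\<Sum>k\<in>T - {t}. \<bar>spike_part \<alpha> \<gamma> m x k\<bar>)"
      unfolding off_def by (rule sum_abs)
    also have "\<dots> \<le> 14007/5000 * (141/125 * c + 41/200 * c' / 3) * exp (- 2 * (112/25))"
      using far that \<alpha>_le coeffs(2) by (intro sum_spike_part_tail_le) auto
    also have "\<dots> \<le> 14007/5000 * (141/125 * c + 41/200 * c' / 3) * (34/250000)"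
      using q that by (intro mult_left_mono) auto
    finally show ?thesis .
  qed
  have off: "\<bar>\<epsilon> * off 4\<bar> \<le> 13/200" "\<bar>\<epsilon> * off 2\<bar> \<le> 1/100"
    using off_le [OF abs_gauss_deriv_4_tail, of 400] off_le [OF abs_gauss_deriv_2_tail, of 35]
      abs_gauss_deriv_5_tail abs_gauss_deriv_3_tail \<epsilon> by (simp_all add: abs_mult)
  have noise: "\<bar>\<epsilon> * noise 4 x\<bar> \<le> 1089/2500" "\<bar>\<epsilon> * noise 2 x\<bar> \<le> 47/500"
    using noise_bounds [of x] \<epsilon> by (simp_all add: abs_mult)
  have slopes: "\<bar>slope 4 \<tau> (t - p t) y\<bar> \<le> 59/10 / 3" "\<bar>slope 2 \<tau> (t - p t) y\<bar> \<le> 7/5 / 3"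
    using abs_slope_le [OF offset [OF t] \<tau>_pos, of y 4 "59/10"] abs_gauss_deriv_5_le
      abs_slope_le [OF offset [OF t] \<tau>_pos, of y 2 "7/5"] abs_gauss_deriv_3_le by simp_all
  have "\<bar>\<gamma> t\<bar> * \<bar>slope 4 \<tau> (t - p t) y\<bar> \<le> 41/200 * (59/10 / 3)"
    by (rule mult_mono [OF coeffs(2) [OF t] slopes(1) _ abs_ge_zero]) simp
  moreover have "\<bar>\<gamma> t\<bar> * \<bar>slope 2 \<tau> (t - p t) y\<bar> \<le> 41/200 * (7/5 / 3)"
    by (rule mult_mono [OF coeffs(2) [OF t] slopes(2) _ abs_ge_zero]) simp
  ultimately have slope: "\<bar>\<epsilon> * (\<gamma> t * slope 4 \<tau> (t - p t) y)\<bar> \<le> 41/200 * (59/10 / 3)"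
    "\<bar>\<epsilon> * (\<gamma> t * slope 2 \<tau> (t - p t) y)\<bar> \<le> 41/200 * (7/5 / 3)"
    using \<epsilon> by (simp_all add: abs_mult)
  have "\<bar>interp 4 \<tau> (t - p t) y + gauss_deriv 4 y\<bar> \<le> \<tau>\<^sup>2 / 8 * 15"
    using offset [OF t] \<tau>_pos abs_gauss_deriv_6_le by (intro interp_error) simp_all
  then have "interp 4 \<tau> (t - p t) y \<le> - 599/500"
    using gauss_deriv_4_ge [of y] near \<tau>_square unfolding y_def by linarith
  then have "(\<epsilon> * \<alpha> t) * interp 4 \<tau> (t - p t) y \<le> (\<epsilon> * \<alpha> t) * (- 599/500)"
    using \<epsilon>\<alpha> by (intro mult_left_mono) simp_all
  then have "\<epsilon> * dual \<alpha> \<gamma> 4 x < 0"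
    unfolding dual using \<epsilon>\<alpha>(1) off(1) noise(1) slope(1) by linarith
  then show "e t * dual \<alpha> \<gamma> 4 x < 0"
    by (simp add: \<epsilon>_def)
  have "\<bar>interp 2 \<tau> (t - p t) y + gauss_deriv 2 y\<bar> \<le> \<tau>\<^sup>2 / 8 * 3"
    using offset [OF t] \<tau>_pos abs_gauss_deriv_4_le by (intro interp_error) simp_all
  then have "- 103/10000 \<le> interp 2 \<tau> (t - p t) y"
    using gauss_deriv_2_nonpos [of y] near \<tau>_square unfolding y_def by linarith
  then have "(\<epsilon> * \<alpha> t) * (- 103/10000) \<le> (\<epsilon> * \<alpha> t) * interp 2 \<tau> (t - p t) y"
    using \<epsilon>\<alpha> by (intro mult_left_mono) simp_all
  then have "- 1 < \<epsilon> * dual \<alpha> \<gamma> 2 x"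
    unfolding dual using \<epsilon>\<alpha>(2) off(2) noise(2) slope(2) by linarith
  then show "- 1 < e t * dual \<alpha> \<gamma> 2 x"
    by (simp add: \<epsilon>_def)
qed

text \<open>The interpolated wavelet is replaced by the wavelet at the cost
  \<open>3 * \<tau>^2 / 8 \<le> 103/10000\<close>, so that \<open>gauss_deriv 2\<close> is bounded
  at the exact point \<open>x - t\<close> and not on a window around it.\<close>

lemma abs_spike_part_2_le:
  assumes coeffs: "\<bar>\<alpha> t\<bar> \<le> 141/125" "\<bar>\<gamma> t\<bar> \<le> 41/200" and t: "t \<in> T"
    and a: "\<bar>gauss_deriv 2 (x - t)\<bar> \<le> a" and b: "\<And>z. \<bar>z - (x - t)\<bar> \<le> \<tau> \<Longrightarrow> \<bar>gauss_deriv 3 z\<bar> \<le> b"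
  shows "\<bar>spike_part \<alpha> \<gamma> 2 x t\<bar> \<le> 141/125 * (a + 103/10000) + 41/200 * (b / 3)"
proof -
  have "\<bar>interp 2 \<tau> (t - p t) (x - t) + gauss_deriv 2 (x - t)\<bar> \<le> \<tau>\<^sup>2 / 8 * 3"
    using offset [OF t] \<tau>_pos abs_gauss_deriv_4_le by (intro interp_error) simp_all
  then have "\<bar>interp 2 \<tau> (t - p t) (x - t)\<bar> \<le> a + 103/10000"
    using a \<tau>_square by linarith
  moreover have "\<bar>slope 2 \<tau> (t - p t) (x - t)\<bar> \<le> b / 3"
    using offset [OF t] \<tau>_pos b by (intro abs_slope_le) simp_all
  ultimately have "\<bar>\<alpha> t\<bar> * \<bar>interp 2 \<tau> (t - p t) (x - t)\<bar> + \<bar>\<gamma> t\<bar> * \<bar>slope 2 \<tau> (t - p t) (x - t)\<bar>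
      \<le> 141/125 * (a + 103/10000) + 41/200 * (b / 3)"
    by (intro add_mono mult_mono coeffs abs_ge_zero) simp_all
  then show ?thesis
    unfolding spike_part_def by (intro order_trans [OF abs_triangle_ineq]) (simp add: abs_mult)
qed

text \<open>If the nearer of two spikes is at distance below 1, between 1 and 2, or at least 2, then
  the other is beyond 4, beyond 3, or at least at 5/2. The corresponding sums are 0.876, 0.753 and
  0.812; adding 19/9995 for the tail and 0.094 for the noise stays below 1.\<close>

lemma dual_far_from_spikes:
  assumes coeffs: "\<And>t. t \<in> T \<Longrightarrow> \<bar>\<alpha> t\<bar> \<le> 141/125" "\<And>t. t \<in> T \<Longrightarrow> \<bar>\<gamma> t\<bar> \<le> 41/200"
    and far: "\<And>t. t \<in> T \<Longrightarrow> 13/25 \<le> \<bar>x - t\<bar>"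
  shows "\<bar>dual \<alpha> \<gamma> 2 x\<bar> < 1"
proof -
  note spike_le = abs_spike_part_2_le [where \<alpha> = \<alpha> and \<gamma> = \<gamma>, OF coeffs]
  have f1: "\<bar>spike_part \<alpha> \<gamma> 2 x t\<bar> \<le> 83/100" if "t \<in> T" for t
    using spike_le [OF that that that abs_gauss_deriv_2_le_from_0_52 [OF far [OF that]] abs_gauss_deriv_3_le] by simp
  have f2: "\<bar>spike_part \<alpha> \<gamma> 2 x t\<bar> \<le> 153/250" if "t \<in> T" "1 \<le> \<bar>x - t\<bar>" for t
    using spike_le [OF that(1) that(1) that(1) abs_gauss_deriv_2_le_from_1 [OF that(2)] abs_gauss_deriv_3_le] by simp
  have b: "\<bar>gauss_deriv 3 z\<bar> \<le> 2/5" if "2 \<le> \<bar>y\<bar>" "\<bar>z - y\<bar> \<le> \<tau>" for y z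
    using that \<tau>_bounds by (intro abs_gauss_deriv_3_le_from_1_8) linarith
  have f3: "\<bar>spike_part \<alpha> \<gamma> 2 x t\<bar> \<le> 251/500" if "t \<in> T" "2 \<le> \<bar>x - t\<bar>" for t
    using spike_le [OF that(1) that(1) that(1) abs_gauss_deriv_2_le_from_2 [OF that(2)]
        b [OF that(2)]] by simp
  have f4: "\<bar>spike_part \<alpha> \<gamma> 2 x t\<bar> \<le> 31/100" if "t \<in> T" "5/2 \<le> \<bar>x - t\<bar>" for t
    using spike_le [OF that(1) that(1) that(1) abs_gauss_deriv_2_le_from_2_5 [OF that(2)]
        b [OF order_trans [OF _ that(2)]]] by simp
  have f5: "\<bar>spike_part \<alpha> \<gamma> 2 x t\<bar> \<le> 141/1000" if "t \<in> T" "3 \<le> \<bar>x - t\<bar>" for t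
    using spike_le [OF that(1) that(1) that(1) abs_gauss_deriv_2_le_from_3 [OF that(2)]
        b [OF order_trans [OF _ that(2)]]] by simp
  have f6: "\<bar>spike_part \<alpha> \<gamma> 2 x t\<bar> \<le> 23/500" if "t \<in> T" "4 \<le> \<bar>x - t\<bar>" for t
    using spike_le [OF that(1) that(1) that(1) abs_gauss_deriv_2_le_from_4 [OF that(2)]
        b [OF order_trans [OF _ that(2)]]] by simp
  have pair: "\<bar>spike_part \<alpha> \<gamma> 2 x a\<bar> + \<bar>spike_part \<alpha> \<gamma> 2 x b\<bar> \<le> 22/25"
    if ab: "a \<in> T" "b \<in> T" "a \<noteq> b" "\<bar>x - a\<bar> \<le> \<bar>x - b\<bar>" for a b
  proof -
    have sep: "5 \<le> \<bar>x - a\<bar> + \<bar>x - b\<bar>"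
      using sep_T [OF ab(1-3)] by linarith
    consider "\<bar>x - a\<bar> < 1" | "1 \<le> \<bar>x - a\<bar>" "\<bar>x - a\<bar> < 2" | "2 \<le> \<bar>x - a\<bar>"
      by linarith
    then show ?thesis
    proof cases
      case 1
      then show ?thesis
        using f1 [OF ab(1)] f6 [OF ab(2)] sep by simp
    next
      case 2
      then show ?thesis
        using f2 [OF ab(1)] f5 [OF ab(2)] sep by simp
    next
      case 3
      then show ?thesis
        using f3 [OF ab(1)] f4 [OF ab(2)] sep ab(4) by simp
    qed
  qed
  have "(\<Sum>t\<in>T. \<bar>spike_part \<alpha> \<gamma> 2 x t\<bar>) \<le> 22/25 + 19 / 9995"
  proof (rule sum_separated_le [OF finite_T sep_T, where y = x])
    show "\<bar>spike_part \<alpha> \<gamma> 2 x a\<bar> + \<bar>spike_part \<alpha> \<gamma> 2 x b\<bar> \<le> 22/25" if "a \<in> T" "b \<in> T" "a \<noteq> b" for a b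
      using pair [of a b] pair [of b a] that by (cases "\<bar>x - a\<bar> \<le> \<bar>x - b\<bar>") (simp_all add: add.commute)
    show "\<bar>spike_part \<alpha> \<gamma> 2 x t\<bar> \<le> 22/25" if "t \<in> T" for t
      using f1 [OF that] by simp
    fix t
    assume t: "t \<in> T" "5 \<le> \<bar>x - t\<bar>"
    have "\<bar>spike_part \<alpha> \<gamma> 2 x t\<bar> \<le> 7/5 * (141/125 * (19/2) + 41/200 * 35 / 3) * exp (- 2 * \<bar>x - t\<bar>)"
      using t coeffs abs_gauss_deriv_2_tail abs_gauss_deriv_3_tail by (intro abs_spike_part_tail_le) simp_all
    also have "\<dots> \<le> 19 * exp (- 2 * \<bar>x - t\<bar>)"
      by (intro mult_right_mono) simp_all
    finally show "\<bar>spike_part \<alpha> \<gamma> 2 x t\<bar> \<le> 19 * exp (- 2 * \<bar>x - t\<bar>)" .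
  qed simp_all
  moreover have "\<bar>\<Sum>t\<in>T. spike_part \<alpha> \<gamma> 2 x t\<bar> \<le> (\<Sum>t\<in>T. \<bar>spike_part \<alpha> \<gamma> 2 x t\<bar>)"
    by (rule sum_abs)
  ultimately show ?thesis
    unfolding dual_def using noise_bounds(1) [of x] by linarith
qed

text \<open>Stated with \<open>gauss_deriv 2\<close>, minus the wavelet, whence the value
  \<open>- e t\<close> at the spikes.\<close>

lemma certificate_exists:
  obtains b c where "\<And>t. t \<in> T \<Longrightarrow> \<bar>b t\<bar> < 2" "\<And>t. t \<in> T \<Longrightarrow> \<bar>c t\<bar> < 2"
    "\<And>t. t \<in> T \<Longrightarrow>
      (\<Sum>k\<in>T. b k * gauss_deriv 2 (t - p k) + c k * gauss_deriv 2 (t - p k - \<tau>)) + noise 2 t = - e t"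
    "\<And>x. x \<notin> T \<Longrightarrow>
      \<bar>(\<Sum>k\<in>T. b k * gauss_deriv 2 (x - p k) + c k * gauss_deriv 2 (x - p k - \<tau>)) + noise 2 x\<bar> < 1"
proof -
  obtain \<alpha> \<gamma> where interpolates: "\<And>t. t \<in> T \<Longrightarrow> dual \<alpha> \<gamma> 2 t = e t" "\<And>t. t \<in> T \<Longrightarrow> dual \<alpha> \<gamma> 3 t = 0"
    and rough: "\<And>t. t \<in> T \<Longrightarrow> \<bar>\<alpha> t\<bar> \<le> 61/50" "\<And>t. t \<in> T \<Longrightarrow> \<bar>\<gamma> t\<bar> \<le> 61/50"
    using interpolation_coefficients_exist by blast
  have \<gamma>_le: "\<bar>\<gamma> t\<bar> \<le> 41/200" if "t \<in> T" for t
    by (rule coefficient_bounds(1) [OF interpolates rough that])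
  have \<gamma>_le_\<tau>: "\<bar>\<gamma> t\<bar> \<le> 7/5 * \<tau>" if "t \<in> T" for t
    by (rule coefficient_bounds(2) [OF interpolates rough that])
  have \<alpha>_near: "\<bar>\<alpha> t - e t\<bar> \<le> 16/125" if "t \<in> T" for t
    by (rule coefficient_bounds(3) [OF interpolates rough that])
  have \<alpha>_le: "\<bar>\<alpha> t\<bar> \<le> 141/125" if "t \<in> T" for t
    using \<alpha>_near [OF that] e_sign [of t] by linarith
  \<comment> \<open>\<open>b\<close> and \<open>c\<close> undo the change of coordinates: they
    collect the coefficients of the translates by \<open>p t\<close> and \<open>p t + \<tau>\<close>
    in \<open>interp\<close> and \<open>slope\<close>.\<close>
  define b where "b t = (\<alpha> t * (\<tau> - (t - p t)) - \<gamma> t / 3) / \<tau>" for t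
  define c where "c t = (\<alpha> t * (t - p t) + \<gamma> t / 3) / \<tau>" for t
  have dual: "(\<Sum>k\<in>T. b k * gauss_deriv 2 (x - p k) + c k * gauss_deriv 2 (x - p k - \<tau>)) + noise 2 x
      = - dual \<alpha> \<gamma> 2 x" for x
  proof -
    have "b k * gauss_deriv 2 (x - p k) + c k * gauss_deriv 2 (x - p k - \<tau>) = - spike_part \<alpha> \<gamma> 2 x k" for k
    proof -
      have args: "x - k + (k - p k) = x - p k" "x - k - (\<tau> - (k - p k)) = x - p k - \<tau>"
        by simp_all
      show ?thesis
        unfolding spike_part_def interp_def slope_def args b_def c_def using \<tau>_pos by (simp add: field_simps)
    qed
    then show ?thesis
      by (simp add: dual_def sum_negf)
  qed
  \<comment> \<open>141/125 + 7/15 < 2. The sign \<delta> treats \<open>b\<close> and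
    \<open>c\<close> together.\<close>
  have coeff_le: "\<bar>(\<alpha> t * r + \<delta> * \<gamma> t / 3) / \<tau>\<bar> < 2" if "t \<in> T" "0 \<le> r" "r \<le> \<tau>" "\<bar>\<delta>\<bar> = 1" for t r \<delta>
  proof -
    have "\<bar>\<alpha> t * r\<bar> \<le> 141/125 * \<tau>"
      unfolding abs_mult using \<alpha>_le [OF that(1)] that by (intro mult_mono) simp_all
    moreover have "\<bar>\<delta> * \<gamma> t / 3\<bar> \<le> 7/15 * \<tau>"
      using \<gamma>_le_\<tau> [OF that(1)] that(4) by (simp add: abs_mult)
    ultimately have "\<bar>\<alpha> t * r + \<delta> * \<gamma> t / 3\<bar> < 2 * \<tau>"
      using \<tau>_pos by linarith
    then show ?thesis
      using \<tau>_pos by (simp add: divide_less_eq)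
  qed
  show ?thesis
  proof
    show "\<bar>b t\<bar> < 2" if "t \<in> T" for t
      using coeff_le [OF that, of "\<tau> - (t - p t)" "- 1"] offset [OF that] by (simp add: b_def)
    show "\<bar>c t\<bar> < 2" if "t \<in> T" for t
      using coeff_le [OF that, of "t - p t" 1] offset [OF that] by (simp add: c_def)
    show "(\<Sum>k\<in>T. b k * gauss_deriv 2 (t - p k) + c k * gauss_deriv 2 (t - p k - \<tau>)) + noise 2 t = - e t"
      if "t \<in> T" for t
      unfolding dual interpolates(1) [OF that] ..
    fix x
    assume x: "x \<notin> T"
    have "\<bar>dual \<alpha> \<gamma> 2 x\<bar> < 1"
    proof (cases "\<exists>t\<in>T. \<bar>x - t\<bar> \<le> 13/25")
      case False
      then show ?thesis
        using \<alpha>_le \<gamma>_le by (intro dual_far_from_spikes) (auto simp: not_le less_imp_le)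
    next
      case True
      then obtain t where t: "t \<in> T" "\<bar>x - t\<bar> \<le> 13/25"
        by blast
      \<comment> \<open>Taylor expansion at the spike: value 1, derivative 0 and a negative second
        derivative in between leave a value strictly below 1.\<close>
      define diff where "diff m z = e t * dual \<alpha> \<gamma> (m + 2) z" for m z
      have "\<forall>m z. m < 2 \<and> t - 13/25 \<le> z \<and> z \<le> t + 13/25 \<longrightarrow> DERIV (diff m) z :> diff (Suc m) z"
        unfolding diff_def [abs_def] using has_real_derivative_dual by (auto intro!: DERIV_cmult)
      moreover have "x \<noteq> t"
        using x t by blast
      moreover have "t - 13/25 \<le> x" "x \<le> t + 13/25"
        using t(2) by linarith+
      ultimately obtain z where z: "if x < t then x < z \<and> z < t else t < z \<and> z < x"
        "diff 0 x = (\<Sum>m<2. diff m t / fact m * (x - t) ^ m) + diff 2 z / fact 2 * (x - t) ^ 2"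
        using Taylor [of 2 diff "diff 0" "t - 13/25" "t + 13/25" t x] by auto
      have "\<bar>z - t\<bar> \<le> 13/25"
        using z(1) t(2) by (auto split: if_splits)
      then have "diff 2 z < 0"
        using dual_near_spike(1) [of \<alpha> \<gamma> t z] \<alpha>_near \<gamma>_le t(1) by (simp add: diff_def)
      then have "diff 2 z / 2 * (x - t)\<^sup>2 < 0"
        using \<open>x \<noteq> t\<close> by (simp add: mult_neg_pos)
      moreover have "diff 0 t = 1" "diff 1 t = 0"
        using interpolates [OF t(1)] e_sign [of t] abs_mult_self_eq [of "e t"]
        by (simp_all add: diff_def numeral_2_eq_2 numeral_3_eq_3)
      moreover have "diff 0 x = diff 0 t + diff 1 t * (x - t) + diff 2 z / 2 * (x - t)\<^sup>2"
        using z(2) by (simp add: numeral_2_eq_2)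
      ultimately have "diff 0 x < 1"
        by simp
      then have "e t * dual \<alpha> \<gamma> 2 x < 1"
        by (simp add: diff_def numeral_2_eq_2)
      moreover have "- 1 < e t * dual \<alpha> \<gamma> 2 x"
        using dual_near_spike(2) [of \<alpha> \<gamma> t x] \<alpha>_near \<gamma>_le t by blast
      ultimately have "\<bar>e t * dual \<alpha> \<gamma> 2 x\<bar> < 1"
        by linarith
      then show ?thesis
        by (simp add: abs_mult e_sign)
    qed
    then show "\<bar>(\<Sum>k\<in>T. b k * gauss_deriv 2 (x - p k) + c k * gauss_deriv 2 (x - p k - \<tau>)) + noise 2 x\<bar> < 1"
      unfolding dual by simp
  qed
qed

end

section \<open>Signed measures\<close>

lemma signed_measure_empty: "signed_measure M \<nu> \<Longrightarrow> \<nu> {} = 0"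
  by (simp add: signed_measure_def)

lemma signed_measure_sums:
  "\<lbrakk>signed_measure M \<nu>; range A \<subseteq> sets M; disjoint_family A\<rbrakk> \<Longrightarrow> (\<lambda>i. \<nu> (A i)) sums \<nu> (\<Union>i. A i)"
  for A :: "nat \<Rightarrow> 'a set"
  by (simp add: signed_measure_def)

lemma signed_measure_uminus: "signed_measure M \<nu> \<Longrightarrow> signed_measure M (\<lambda>A. - \<nu> A)"
  by (auto simp: signed_measure_def intro: sums_minus)

lemma signed_measure_Un:
  assumes "signed_measure M \<nu>" "A \<in> sets M" "B \<in> sets M" "A \<inter> B = {}"
  shows "\<nu> (A \<union> B) = \<nu> A + \<nu> B"
proof -
  have "disjoint_family (binaryset A B)"
    using assms(4) by (auto simp: disjoint_family_on_def binaryset_def)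
  then have "(\<lambda>i. \<nu> (binaryset A B i)) sums \<nu> (A \<union> B)"
    using signed_measure_sums [OF assms(1), of "binaryset A B"] assms(2,3)
    by (simp add: range_binaryset_eq UN_binaryset_eq)
  moreover have "(\<lambda>i. \<nu> (binaryset A B i)) sums (\<nu> A + \<nu> B)"
    using signed_measure_empty [OF assms(1)] by (rule binaryset_sums)
  ultimately show ?thesis
    by (rule sums_unique2)
qed

lemma signed_measure_Diff:
  assumes "signed_measure M \<nu>" "A \<in> sets M" "B \<in> sets M" "B \<subseteq> A"
  shows "\<nu> (A - B) = \<nu> A - \<nu> B"
  using signed_measure_Un [OF assms(1), of B "A - B"] assms(2-4)
  by (simp add: Un_absorb1)

lemma signed_measure_Int_Diff:
  assumes "signed_measure M \<nu>" "A \<in> sets M" "B \<in> sets M"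
  shows "\<nu> A = \<nu> (A \<inter> B) + \<nu> (A - B)"
proof -
  have "A \<inter> B \<inter> (A - B) = {}"
    by blast
  then show ?thesis
    using signed_measure_Un [OF assms(1), of "A \<inter> B" "A - B"] assms(2,3)
    by (simp add: Int_Diff_Un)
qed

lemma signed_measure_Un_Int:
  assumes "signed_measure M \<nu>" "A \<in> sets M" "B \<in> sets M"
  shows "\<nu> (A \<union> B) + \<nu> (A \<inter> B) = \<nu> A + \<nu> B"
  using signed_measure_Int_Diff [OF assms(1) assms(3) assms(2)]
    signed_measure_Un [OF assms(1), of A "B - A"] assms(2,3)
  by (simp add: Int_commute)

lemma signed_measure_incseq:
  assumes sm: "signed_measure M \<nu>" and A: "range A \<subseteq> sets M" "incseq A"
  shows "(\<lambda>n. \<nu> (A n)) \<longlonglongrightarrow> \<nu> (\<Union>n. A n)"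
proof -
  have partial: "(\<Sum>i\<le>n. \<nu> (disjointed A i)) = \<nu> (A n)" for n
  proof (induction n)
    case (Suc n)
    have "\<nu> (disjointed A (Suc n)) = \<nu> (A (Suc n)) - \<nu> (A n)"
      using A signed_measure_Diff [OF sm, of "A (Suc n)" "A n"]
      by (simp add: disjointed_mono incseq_Suc_iff image_subset_iff)
    then show ?case
      using Suc by simp
  qed (simp add: disjointed_def)
  have "(\<lambda>i. \<nu> (disjointed A i)) sums \<nu> (\<Union>i. disjointed A i)"
    using A by (intro signed_measure_sums [OF sm] disjoint_family_disjointed sets.range_disjointed_sets)
  then show ?thesis
    by (simp add: sums_def_le partial UN_disjointed_eq)
qed

lemma signed_measure_decseq:
  assumes sm: "signed_measure M \<nu>" and A: "range A \<subseteq> sets M" "decseq A"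
  shows "(\<lambda>n. \<nu> (A n)) \<longlonglongrightarrow> \<nu> (\<Inter>n. A n)"
proof -
  have sets: "A n \<in> sets M" for n
    using A by auto
  have sub: "A n \<subseteq> A 0" for n
    using A by (simp add: decseqD)
  have "(\<lambda>n. \<nu> (A 0 - A n)) \<longlonglongrightarrow> \<nu> (\<Union>n. A 0 - A n)"
    using A by (intro signed_measure_incseq [OF sm]) (auto simp: incseq_def decseq_def)
  moreover have "\<nu> (A 0 - A n) = \<nu> (A 0) - \<nu> (A n)" for n
    using sets sub by (intro signed_measure_Diff [OF sm])
  moreover have "\<nu> (\<Union>n. A 0 - A n) = \<nu> (A 0) - \<nu> (\<Inter>n. A n)"
    using signed_measure_Diff [OF sm, of "A 0" "\<Inter>n. A n"] sets by (simp add: INT_lower)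
  ultimately have "(\<lambda>n. \<nu> (A 0) - \<nu> (A n)) \<longlonglongrightarrow> \<nu> (A 0) - \<nu> (\<Inter>n. A n)"
    by simp
  from tendsto_diff [OF tendsto_const [of "\<nu> (A 0)"] this] show ?thesis
    by simp
qed

section \<open>Boundedness, Hahn and Jordan decompositions\<close>

text \<open>If \<nu> is unbounded on subsets of \<open>X\<close>, choose \<open>B\<close> inside
  with \<open>\<bar>\<nu> B\<bar> > \<bar>\<nu> X\<bar> + 1\<close>. Then \<open>B\<close> and
  \<open>X - B\<close> both exceed 1 in modulus, and \<nu> is unbounded on one of them. Keeping that
  one and iterating discards disjoint sets of modulus at least 1, against the convergence of their
  sum.\<close>

lemma signed_measure_bounded:
  assumes sm: "signed_measure M \<nu>"
  obtains b where "\<And>A. A \<in> sets M \<Longrightarrow> \<bar>\<nu> A\<bar> \<le> b"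
proof -
  define unbounded where
    "unbounded X \<longleftrightarrow> X \<in> sets M \<and> (\<forall>b. \<exists>B\<in>sets M. B \<subseteq> X \<and> b < \<bar>\<nu> B\<bar>)" for X
  have bounded: "\<exists>b. \<forall>B\<in>sets M. B \<subseteq> X \<longrightarrow> \<bar>\<nu> B\<bar> \<le> b" if "X \<in> sets M" "\<not> unbounded X" for X
    using that unfolding unbounded_def by (meson not_less)
  have split: "\<exists>Y. unbounded Y \<and> Y \<subseteq> X \<and> 1 \<le> \<bar>\<nu> (X - Y)\<bar>" if X: "unbounded X" for X
  proof -
    have X_sets: "X \<in> sets M"
      using X by (simp add: unbounded_def)
    obtain B where B: "B \<in> sets M" "B \<subseteq> X" "\<bar>\<nu> X\<bar> + 1 < \<bar>\<nu> B\<bar>"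
      using X by (auto simp: unbounded_def)
    have diff: "\<nu> (X - B) = \<nu> X - \<nu> B"
      using X_sets B by (intro signed_measure_Diff [OF sm])
    have "unbounded B \<or> unbounded (X - B)"
    proof (rule ccontr)
      assume "\<not> ?thesis"
      then obtain b c where b: "\<And>A. A \<in> sets M \<Longrightarrow> A \<subseteq> B \<Longrightarrow> \<bar>\<nu> A\<bar> \<le> b"
        and c: "\<And>A. A \<in> sets M \<Longrightarrow> A \<subseteq> X - B \<Longrightarrow> \<bar>\<nu> A\<bar> \<le> c"
        using bounded [of B] bounded [of "X - B"] B X_sets by (metis sets.Diff)
      obtain A where A: "A \<in> sets M" "A \<subseteq> X" "b + c < \<bar>\<nu> A\<bar>"
        using X unfolding unbounded_def by blast
      have "\<nu> A = \<nu> (A \<inter> B) + \<nu> (A - B)"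
        using A B by (intro signed_measure_Int_Diff [OF sm])
      moreover have "\<bar>\<nu> (A \<inter> B)\<bar> \<le> b" "\<bar>\<nu> (A - B)\<bar> \<le> c"
        using A B by (intro b c; auto)+
      ultimately show False
        using A(3) by linarith
    qed
    then show ?thesis
    proof
      assume "unbounded B"
      then show ?thesis
        using B diff by (intro exI [of _ B]) auto
    next
      assume "unbounded (X - B)"
      moreover have "X - (X - B) = B"
        using B by auto
      ultimately show ?thesis
        using B by (intro exI [of _ "X - B"]) auto
    qed
  qed
  have "\<not> unbounded (space M)"
  proof
    assume "unbounded (space M)"
    then obtain X where X: "\<And>n. unbounded (X n)"
      "\<And>n. X (Suc n) \<subseteq> X n \<and> 1 \<le> \<bar>\<nu> (X n - X (Suc n))\<bar>"
      using dependent_nat_choice [of "\<lambda>_. unbounded" "\<lambda>_ X Y. Y \<subseteq> X \<and> 1 \<le> \<bar>\<nu> (X - Y)\<bar>"] split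
      by metis
    have "decseq X"
      using X(2) by (simp add: decseq_Suc_iff)
    have "disjoint_family (\<lambda>n. X n - X (Suc n))"
      unfolding disjoint_family_on_def
    proof (intro ballI impI)
      fix m n :: nat
      assume "m \<noteq> n"
      then consider "Suc m \<le> n" | "Suc n \<le> m"
        by linarith
      then show "(X m - X (Suc m)) \<inter> (X n - X (Suc n)) = {}"
        using decseqD [OF \<open>decseq X\<close>] by cases blast+
    qed
    moreover have "range (\<lambda>n. X n - X (Suc n)) \<subseteq> sets M"
      using X(1) by (auto simp: unbounded_def)
    ultimately have "summable (\<lambda>n. \<nu> (X n - X (Suc n)))"
      using signed_measure_sums [OF sm] by (blast intro: sums_summable)
    then have "(\<lambda>n. \<nu> (X n - X (Suc n))) \<longlonglongrightarrow> 0"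
      by (rule summable_LIMSEQ_zero)
    from LIMSEQ_D [OF this, of 1] obtain n where "\<bar>\<nu> (X n - X (Suc n))\<bar> < 1"
      by auto
    then show False
      using X(2) [of n] by linarith
  qed
  then obtain b where "\<And>B. B \<in> sets M \<Longrightarrow> B \<subseteq> space M \<Longrightarrow> \<bar>\<nu> B\<bar> \<le> b"
    using bounded [of "space M"] by blast
  then show ?thesis
    by (intro that) (simp add: sets.sets_into_space)
qed

text \<open>\<open>P\<close> attains the supremum \<open>m\<close> of \<nu>: removing a negative
  part from \<open>P\<close>, or adding a positive set outside, would exceed \<open>m\<close>. It is
  the limes inferior of sets \<open>A n\<close> that miss \<open>m\<close> by less than
  \<open>(1/2)^n\<close>.\<close>

lemma signed_measure_Hahn:
  assumes sm: "signed_measure M \<nu>"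
  obtains P where "P \<in> sets M" "\<And>A. A \<in> sets M \<Longrightarrow> A \<subseteq> P \<Longrightarrow> 0 \<le> \<nu> A"
    "\<And>A. A \<in> sets M \<Longrightarrow> A \<inter> P = {} \<Longrightarrow> \<nu> A \<le> 0"
proof -
  define m where "m = (SUP A\<in>sets M. \<nu> A)"
  obtain b where b: "\<And>A. A \<in> sets M \<Longrightarrow> \<bar>\<nu> A\<bar> \<le> b"
    using signed_measure_bounded [OF sm] by blast
  have bdd: "bdd_above (\<nu> ` sets M)"
    using b by (intro bdd_aboveI2 [of _ _ b]) (simp add: abs_le_iff)
  have le_m: "\<nu> A \<le> m" if "A \<in> sets M" for A
    unfolding m_def using that bdd by (rule cSUP_upper)
  have "\<exists>A\<in>sets M. m - (1/2)^n < \<nu> A" for n :: nat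
    using less_cSUP_iff [OF _ bdd, of "m - (1/2)^n"] by (auto simp: m_def)
  then obtain A where A: "\<And>n. A n \<in> sets M" "\<And>n. m - (1/2)^n < \<nu> (A n)" for n :: nat
    by metis
  \<comment> \<open>As the union has measure at most \<open>m\<close>, intersecting with one more
    \<open>A k\<close> loses no more than the defect of that set; the defects form a geometric
    series.\<close>
  have partial: "m - 2 * (1/2)^n + (1/2)^(n + j) \<le> \<nu> (\<Inter>k\<in>{n..n + j}. A k)" for n j
  proof (induction j)
    case 0
    then show ?case
      using A(2) [of n] by simp
  next
    case (Suc j)
    let ?C = "\<Inter>k\<in>{n..n + j}. A k"
    have C: "?C \<in> sets M"
      using A(1) by (intro sets.finite_INT) auto
    have "(\<Inter>k\<in>{n..n + Suc j}. A k) = ?C \<inter> A (n + Suc j)"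
      by (auto simp: le_Suc_eq)
    moreover have "\<nu> (?C \<union> A (n + Suc j)) + \<nu> (?C \<inter> A (n + Suc j)) = \<nu> ?C + \<nu> (A (n + Suc j))"
      using C A(1) by (intro signed_measure_Un_Int [OF sm])
    moreover have "\<nu> (?C \<union> A (n + Suc j)) \<le> m"
      using C A(1) by (intro le_m) auto
    ultimately show ?case
      using Suc A(2) [of "n + Suc j"] by simp
  qed
  define C where "C n = (\<Inter>k\<in>{n..}. A k)" for n
  have C_sets: "C n \<in> sets M" for n
    unfolding C_def using A(1) by (intro sets.countable_INT) auto
  have C_ge: "m - 2 * (1/2)^n \<le> \<nu> (C n)" for n
  proof (rule LIMSEQ_le_const)
    have "(\<lambda>j. \<nu> (\<Inter>k\<in>{n..n + j}. A k)) \<longlonglongrightarrow> \<nu> (\<Inter>j. \<Inter>k\<in>{n..n + j}. A k)"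
    proof (rule signed_measure_decseq [OF sm])
      show "range (\<lambda>j. \<Inter>k\<in>{n..n + j}. A k) \<subseteq> sets M"
        using A(1) by (auto intro!: sets.finite_INT)
      show "decseq (\<lambda>j. \<Inter>k\<in>{n..n + j}. A k)"
        by (auto simp: decseq_def)
    qed
    moreover have "(\<Inter>j. \<Inter>k\<in>{n..n + j}. A k) = C n"
      by (force simp: C_def le_iff_add)
    ultimately show "(\<lambda>j. \<nu> (\<Inter>k\<in>{n..n + j}. A k)) \<longlonglongrightarrow> \<nu> (C n)"
      by simp
    have "m - 2 * (1/2)^n \<le> \<nu> (\<Inter>k\<in>{n..n + j}. A k)" for j
      using partial [of n j] zero_le_power [of "1/2 :: real" "n + j"] by linarith
    then show "\<exists>N. \<forall>j\<ge>N. m - 2 * (1/2)^n \<le> \<nu> (\<Inter>k\<in>{n..n + j}. A k)"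
      by blast
  qed
  define P where "P = (\<Union>n. C n)"
  have P: "P \<in> sets M"
    unfolding P_def using C_sets by blast
  have "incseq C"
    unfolding incseq_def C_def by (intro allI impI INF_superset_mono) auto
  then have lim: "(\<lambda>n. \<nu> (C n)) \<longlonglongrightarrow> \<nu> P"
    unfolding P_def using C_sets by (intro signed_measure_incseq [OF sm]) auto
  have "(\<lambda>n. m - 2 * (1/2)^n) \<longlonglongrightarrow> m - 2 * 0"
    by (intro tendsto_intros LIMSEQ_realpow_zero) auto
  then have "m \<le> \<nu> P"
    using LIMSEQ_le [OF _ lim] C_ge by (metis diff_zero mult_zero_right)
  show ?thesis
  proof
    show "P \<in> sets M"
      by (rule P)
    show "0 \<le> \<nu> A" if "A \<in> sets M" "A \<subseteq> P" for A
      using le_m [of "P - A"] signed_measure_Diff [OF sm P that] \<open>m \<le> \<nu> P\<close> P that by simp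
    show "\<nu> A \<le> 0" if "A \<in> sets M" "A \<inter> P = {}" for A
      using le_m [of "P \<union> A"] signed_measure_Un [OF sm P that(1)] \<open>m \<le> \<nu> P\<close> P that
      by (simp add: Int_commute)
  qed
qed


lemma
  shows space_upper_variation [simp]: "space (upper_variation M \<nu>) = space M"
    and sets_upper_variation [simp, measurable_cong]: "sets (upper_variation M \<nu>) = sets M"
  by (simp_all add: upper_variation_def)

text \<open>For a Hahn set \<open>P\<close> the defining supremum is attained at
  \<open>A \<inter> P\<close>. Countable additivity is inherited from \<nu>, and with it the right
  to read off \<open>measure_of\<close>.\<close>

lemma emeasure_upper_variation:
  assumes sm: "signed_measure M \<nu>" and P: "P \<in> sets M"
    and pos: "\<And>A. A \<in> sets M \<Longrightarrow> A \<subseteq> P \<Longrightarrow> 0 \<le> \<nu> A"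
    and neg: "\<And>A. A \<in> sets M \<Longrightarrow> A \<inter> P = {} \<Longrightarrow> \<nu> A \<le> 0"
    and A: "A \<in> sets M"
  shows "emeasure (upper_variation M \<nu>) A = ennreal (\<nu> (A \<inter> P))"
proof -
  let ?f = "\<lambda>A. SUP B\<in>{B \<in> sets M. B \<subseteq> A}. ennreal (\<nu> B)"
  have f: "?f A = ennreal (\<nu> (A \<inter> P))" if A: "A \<in> sets M" for A
  proof (intro antisym SUP_least)
    fix B
    assume "B \<in> {B \<in> sets M. B \<subseteq> A}"
    then have B: "B \<in> sets M" "B \<subseteq> A"
      by auto
    have "\<nu> B = \<nu> (B \<inter> P) + \<nu> (B - P)" "\<nu> (A \<inter> P) = \<nu> (A \<inter> P \<inter> B) + \<nu> (A \<inter> P - B)"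
      using A B P by (auto intro!: signed_measure_Int_Diff [OF sm])
    moreover have "\<nu> (B - P) \<le> 0" "0 \<le> \<nu> (A \<inter> P - B)"
      using A B P by (auto intro!: pos neg)
    moreover have "A \<inter> P \<inter> B = B \<inter> P"
      using B by auto
    ultimately show "ennreal (\<nu> B) \<le> ennreal (\<nu> (A \<inter> P))"
      by (intro ennreal_leI) simp
  next
    show "ennreal (\<nu> (A \<inter> P)) \<le> ?f A"
      using A P by (intro SUP_upper) auto
  qed
  have "emeasure (upper_variation M \<nu>) A = ?f A"
  proof (rule emeasure_measure_of)
    show "upper_variation M \<nu> = measure_of (space M) (sets M) ?f"
      by (simp add: upper_variation_def)
    show "sets M \<subseteq> Pow (space M)"
      by (rule sets.space_closed)
    show "A \<in> sets (upper_variation M \<nu>)"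
      using A by simp
    show "positive (sets (upper_variation M \<nu>)) ?f"
      using f [of "{}"] signed_measure_empty [OF sm] by (simp add: positive_def)
    show "countably_additive (sets (upper_variation M \<nu>)) ?f"
    proof (rule countably_additiveI)
      fix B :: "nat \<Rightarrow> _"
      assume B: "range B \<subseteq> sets (upper_variation M \<nu>)" "disjoint_family B"
      then have B_sets: "B i \<in> sets M" for i
        by auto
      have "(\<lambda>i. \<nu> (B i \<inter> P)) sums \<nu> (\<Union>i. B i \<inter> P)"
        using B P by (intro signed_measure_sums [OF sm]) (auto simp: disjoint_family_on_def)
      then have "(\<Sum>i. ennreal (\<nu> (B i \<inter> P))) = ennreal (\<nu> (\<Union>i. B i \<inter> P))"
        using B_sets P by (intro suminf_ennreal_eq pos) auto
      then show "(\<Sum>i. ?f (B i)) = ?f (\<Union>i. B i)"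
        using B_sets by (simp add: f)
    qed
  qed
  then show ?thesis
    using f [OF A] by simp
qed

text \<open>Everything is read off from a Hahn set and its complement. The inequality with
  \<open>tv_norm\<close> is the direction that weak duality consumes.\<close>

lemma Jordan_decomposition:
  assumes sm: "signed_measure M \<nu>"
  defines "U \<equiv> upper_variation M \<nu>" and "L \<equiv> upper_variation M (\<lambda>A. - \<nu> A)"
  shows "finite_measure U" "finite_measure L"
    and "\<And>A. A \<in> sets M \<Longrightarrow> \<nu> A = measure U A - measure L A"
    and "ereal (measure U (space M) + measure L (space M)) \<le> tv_norm M \<nu>"
    and "\<And>A. A \<in> sets M \<Longrightarrow> (\<And>B. B \<in> sets M \<Longrightarrow> B \<subseteq> A \<Longrightarrow> \<nu> B = 0) \<Longrightarrow> measure U A = 0 \<and> measure L A = 0"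
proof -
  obtain P where P: "P \<in> sets M" and pos: "\<And>A. A \<in> sets M \<Longrightarrow> A \<subseteq> P \<Longrightarrow> 0 \<le> \<nu> A"
    and neg: "\<And>A. A \<in> sets M \<Longrightarrow> A \<inter> P = {} \<Longrightarrow> \<nu> A \<le> 0"
    using signed_measure_Hahn [OF sm] by blast
  have emeasure_U: "emeasure U A = ennreal (\<nu> (A \<inter> P))" if "A \<in> sets M" for A
    unfolding U_def using sm P pos neg that by (rule emeasure_upper_variation)
  have emeasure_L: "emeasure L A = ennreal (- \<nu> (A - P))" if A: "A \<in> sets M" for A
  proof -
    have "emeasure L A = ennreal (- \<nu> (A \<inter> (space M - P)))"
      unfolding L_def
    proof (rule emeasure_upper_variation [OF signed_measure_uminus [OF sm]])
      fix B
      assume B: "B \<in> sets M"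
      show "0 \<le> - \<nu> B" if "B \<subseteq> space M - P"
        using neg [OF B] that by auto
      show "- \<nu> B \<le> 0" if "B \<inter> (space M - P) = {}"
        using pos [OF B] that sets.sets_into_space [OF B] by auto
    qed (use P A in auto)
    moreover have "A \<inter> (space M - P) = A - P"
      using sets.sets_into_space [OF A] by auto
    ultimately show ?thesis
      by simp
  qed
  have measure_U: "measure U A = \<nu> (A \<inter> P)" if "A \<in> sets M" for A
    using emeasure_U [OF that] pos [of "A \<inter> P"] that P by (simp add: measure_def)
  have measure_L: "measure L A = - \<nu> (A - P)" if "A \<in> sets M" for A
    using emeasure_L [OF that] neg [of "A - P"] that P by (simp add: measure_def Diff_Int_distrib2)
  show "finite_measure U" "finite_measure L"
    using emeasure_U [of "space M"] emeasure_L [of "space M"]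
    by (auto intro!: finite_measureI simp: U_def L_def)
  show "\<nu> A = measure U A - measure L A" if "A \<in> sets M" for A
    using signed_measure_Int_Diff [OF sm that P] measure_U [OF that] measure_L [OF that] by simp
  show "measure U A = 0 \<and> measure L A = 0"
    if A: "A \<in> sets M" and null: "\<And>B. B \<in> sets M \<Longrightarrow> B \<subseteq> A \<Longrightarrow> \<nu> B = 0" for A
    using measure_U [OF A] measure_L [OF A] null [of "A \<inter> P"] null [of "A - P"] A P by auto
  let ?Q = "{P, space M - P}"
  have "measure U (space M) + measure L (space M) = \<bar>\<nu> P\<bar> + \<bar>\<nu> (space M - P)\<bar>"
    using measure_U [of "space M"] measure_L [of "space M"] pos [OF P] neg [of "space M - P"] P
      sets.sets_into_space [OF P] by (simp add: Int_absorb1 Diff_Int_distrib2)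
  also have "\<dots> = (\<Sum>A\<in>?Q. \<bar>\<nu> A\<bar>)"
  \<comment> \<open>On an empty space the two blocks coincide and the sum over \<open>?Q\<close> has
    a single term.\<close>
  proof (cases "P = space M - P")
    case True
    then have "P = {}"
      by auto
    then show ?thesis
      using True signed_measure_empty [OF sm] by simp
  qed simp
  finally have eq: "measure U (space M) + measure L (space M) = (\<Sum>A\<in>?Q. \<bar>\<nu> A\<bar>)" .
  show "ereal (measure U (space M) + measure L (space M)) \<le> tv_norm M \<nu>"
    unfolding tv_norm_def eq
  proof (rule SUP_upper)
    show "?Q \<in> {P. finite P \<and> P \<subseteq> sets M \<and> disjoint P \<and> \<Union> P = space M}"
      using P sets.sets_into_space [OF P] by (auto simp: disjoint_def)
  qed
qed

text \<open>Boundedness makes each \<open>f i\<close> integrable for both Jordan parts, which are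
  finite measures, so that linearity of the integral applies.\<close>

lemma signed_integral_sum:
  assumes "signed_measure M \<nu>"
    and "\<And>i. i \<in> A \<Longrightarrow> f i \<in> borel_measurable M" "\<And>i x. i \<in> A \<Longrightarrow> \<bar>f i x\<bar> \<le> B"
  shows "signed_integral M \<nu> (\<lambda>x. \<Sum>i\<in>A. q i * f i x) = (\<Sum>i\<in>A. q i * signed_integral M \<nu> (f i))"
proof -
  have "integral\<^sup>L N (\<lambda>x. \<Sum>i\<in>A. q i * f i x) = (\<Sum>i\<in>A. q i * integral\<^sup>L N (f i))"
    if "finite_measure N" "sets N = sets M" for N
  proof -
    have "integrable N (f i)" if "i \<in> A" for i
    proof (rule finite_measure.integrable_const_bound [OF \<open>finite_measure N\<close>])
      show "AE x in N. norm (f i x) \<le> B"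
        using assms(3) [OF that] by simp
      show "f i \<in> borel_measurable N"
        using assms(2) [OF that] unfolding measurable_cong_sets [OF \<open>sets N = sets M\<close> refl] .
    qed
    then show ?thesis
      by (subst Bochner_Integration.integral_sum) auto
  qed
  then have "integral\<^sup>L (upper_variation M \<mu>) (\<lambda>x. \<Sum>i\<in>A. q i * f i x)
      = (\<Sum>i\<in>A. q i * integral\<^sup>L (upper_variation M \<mu>) (f i))" if "finite_measure (upper_variation M \<mu>)" for \<mu>
    using that by simp
  from this [OF Jordan_decomposition(1) [OF assms(1)]] this [OF Jordan_decomposition(2) [OF assms(1)]]
  show ?thesis
    unfolding signed_integral_def right_diff_distrib sum_subtractf by simp
qed

lemma signed_integral_finite_support:
  fixes \<nu> :: "real set \<Rightarrow> real"
  assumes sm: "signed_measure borel \<nu>" and T: "finite T" "supported_on borel T \<nu>"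
    and f: "f \<in> borel_measurable borel"
  shows "signed_integral borel \<nu> f = (\<Sum>t\<in>T. \<nu> {t} * f t)"
proof -
  define U where "U = upper_variation borel \<nu>"
  define L where "L = upper_variation borel (\<lambda>A. - \<nu> A)"
  note jordan = Jordan_decomposition [OF sm, folded U_def L_def]
  have T_sets: "- T \<in> sets borel"
    using T(1) by (intro borel_open open_Compl finite_imp_closed)
  have null: "measure U (- T) = 0 \<and> measure L (- T) = 0"
    using T(2) by (intro jordan(5) T_sets) (auto simp: supported_on_def disjoint_eq_subset_Compl)
  have integral: "integral\<^sup>L N f = (\<Sum>t\<in>T. measure N {t} * f t)"
    if N: "finite_measure N" "sets N = sets borel" "measure N (- T) = 0" for N
  proof -
    interpret finite_measure N
      by fact
    have space: "space N = UNIV"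
      using sets_eq_imp_space_eq [OF N(2)] by simp
    have integrable_point: "integrable N (indicat_real {t})" for t
      using N(2) by (intro integrable_const_bound [of _ 1]) auto
    have "emeasure N (- T) = 0"
      using N(3) by (simp add: emeasure_eq_measure)
    then have "AE x in N. x \<notin> - T"
      using T_sets N(2) by (intro AE_not_in) (auto simp: null_sets_def)
    then have "AE x in N. f x = (\<Sum>t\<in>T. indicator {t} x * f t)"
    proof (rule AE_mp, intro AE_I2 impI)
      fix x
      assume "x \<notin> - T"
      then show "f x = (\<Sum>t\<in>T. indicator {t} x * f t)"
        using T(1) by (simp add: indicator_def if_distrib sum.delta' cong: if_cong)
    qed
    then have "integral\<^sup>L N f = integral\<^sup>L N (\<lambda>x. \<Sum>t\<in>T. indicator {t} x * f t)"
      by (intro integral_cong_AE) (unfold measurable_cong_sets [OF N(2) refl], use f in measurable)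
    also have "\<dots> = (\<Sum>t\<in>T. integral\<^sup>L N (\<lambda>x. indicator {t} x * f t))"
      using integrable_point by (intro Bochner_Integration.integral_sum) simp
    also have "\<dots> = (\<Sum>t\<in>T. measure N {t} * f t)"
      using N(2) space by simp
    finally show ?thesis .
  qed
  have "signed_integral borel \<nu> f = (\<Sum>t\<in>T. measure U {t} * f t) - (\<Sum>t\<in>T. measure L {t} * f t)"
    using integral [of U] integral [of L] jordan(1,2) null
    by (simp add: signed_integral_def U_def L_def)
  also have "\<dots> = (\<Sum>t\<in>T. \<nu> {t} * f t)"
    by (simp add: jordan(3) left_diff_distrib sum_subtractf)
  finally show ?thesis .
qed

section \<open>Optimality from dual certificates\<close>

lemma signed_measure_spikes:
  assumes "finite T"
  shows "signed_measure M (spikes T a)"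
  unfolding signed_measure_def
proof (intro conjI allI impI)
  show "spikes T a {} = 0"
    by (simp add: spikes_def dirac_def)
  fix A :: "nat \<Rightarrow> 'a set"
  assume "disjoint_family A"
  then have "(\<lambda>i. indicat_real (A i) t) sums indicat_real (\<Union>i. A i) t" for t
    by (intro indicator_sums) (auto simp: disjoint_family_on_def)
  then show "(\<lambda>i. spikes T a (A i)) sums spikes T a (\<Union>i. A i)"
    unfolding spikes_def dirac_def by (intro sums_sum sums_mult)
qed

lemma spikes_singleton: "finite T \<Longrightarrow> t \<in> T \<Longrightarrow> spikes T a {t} = a t"
  by (simp add: spikes_def dirac_def indicator_def if_distrib sum.delta' cong: if_cong)

lemma supported_on_spikes: "T \<subseteq> J \<Longrightarrow> supported_on M J (spikes T a)"
  by (auto simp: supported_on_def spikes_def dirac_def indicator_def intro!: sum.neutral)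

text \<open>A point lies in at most one block of a disjoint family, so each
  \<open>\<bar>a t\<bar>\<close> is counted at most once.\<close>

lemma tv_norm_spikes_le:
  assumes T: "finite T"
  shows "tv_norm M (spikes T a) \<le> ereal (\<Sum>t\<in>T. \<bar>a t\<bar>)"
  unfolding tv_norm_def
proof (rule SUP_least)
  fix P
  assume "P \<in> {P. finite P \<and> P \<subseteq> sets M \<and> disjoint P \<and> \<Union> P = space M}"
  then have P: "finite P" "disjoint P"
    by auto
  have at_most_one: "(\<Sum>A\<in>P. indicat_real A t) \<le> 1" for t
  proof -
    have "(\<Sum>A\<in>P. indicat_real A t) = real (card {A \<in> P. t \<in> A})"
      using P(1) by (simp add: indicator_def sum.If_cases Int_def)
    also have "card {A \<in> P. t \<in> A} \<le> Suc 0"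
      using P by (subst card_le_Suc0_iff_eq) (auto simp: disjoint_def)
    finally show ?thesis
      by simp
  qed
  have "(\<Sum>A\<in>P. \<bar>spikes T a A\<bar>) \<le> (\<Sum>A\<in>P. \<Sum>t\<in>T. \<bar>a t\<bar> * indicat_real A t)"
    unfolding spikes_def dirac_def
    by (intro sum_mono order_trans [OF sum_abs]) (simp add: abs_mult)
  also have "\<dots> = (\<Sum>t\<in>T. \<bar>a t\<bar> * (\<Sum>A\<in>P. indicat_real A t))"
    by (subst sum.swap) (simp add: sum_distrib_left)
  also have "\<dots> \<le> (\<Sum>t\<in>T. \<bar>a t\<bar> * 1)"
    using at_most_one by (intro sum_mono mult_left_mono) auto
  finally show "ereal (\<Sum>A\<in>P. \<bar>spikes T a A\<bar>) \<le> ereal (\<Sum>t\<in>T. \<bar>a t\<bar>)"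
    by simp
qed

lemma signed_measure_eq_spikes:
  fixes \<nu> :: "real set \<Rightarrow> real"
  assumes sm: "signed_measure borel \<nu>" and T: "finite T" "supported_on borel T \<nu>"
  shows "signed_measure_eq borel \<nu> (spikes T (\<lambda>t. \<nu> {t}))"
  unfolding signed_measure_eq_def
proof
  fix A :: "real set"
  assume A: "A \<in> sets borel"
  have finite_sets: "B \<in> sets borel" if "finite B" for B :: "real set"
    using that by (intro borel_closed finite_imp_closed)
  have points: "\<nu> B = (\<Sum>t\<in>B. \<nu> {t})" if "finite B" for B
    using that
  proof induction
    case empty
    then show ?case
      using signed_measure_empty [OF sm] by simp
  next
    case (insert t B)
    then show ?case
      using signed_measure_Un [OF sm, of "{t}" B] finite_sets [of B] by simp
  qed
  have "\<nu> (A - T) = 0"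
    using T(2) A finite_sets [OF T(1)] by (auto simp: supported_on_def)
  then have "\<nu> A = \<nu> (A \<inter> T)"
    using signed_measure_Int_Diff [OF sm A finite_sets [OF T(1)]] by simp
  also have "\<dots> = (\<Sum>t\<in>A \<inter> T. \<nu> {t})"
    using T(1) by (intro points) simp
  also have "\<dots> = (\<Sum>t\<in>T. if t \<in> A then \<nu> {t} else 0)"
    using T(1) by (subst Int_commute) (rule sum.inter_restrict)
  also have "\<dots> = spikes T (\<lambda>t. \<nu> {t}) A"
    unfolding spikes_def dirac_def by (intro sum.cong) (auto simp: indicator_def)
  finally show "\<nu> A = spikes T (\<lambda>t. \<nu> {t}) A" .
qed

text \<open>Weak duality with strict complementary slackness. Certificates are required for all sign
  patterns \<open>e\<close> and \<open>g\<close>, because the one that settles uniqueness depends on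
  the competitor.\<close>

lemma unique_solution_criterion:
  fixes K :: "real \<Rightarrow> real" and T J :: "real set" and n :: nat and s w y :: "nat \<Rightarrow> real"
  defines "Q \<equiv> \<lambda>q x. \<Sum>i=1..n. q i * K (s i - x)"
  assumes K: "continuous_on UNIV K" "\<And>x. \<bar>K x\<bar> \<le> B"
    and T: "finite T" "T \<subseteq> J"
    and y: "\<And>i. i \<in> {1..n} \<Longrightarrow> y i = convolve K (spikes T a) (s i) + w i"
    and lam: "0 < lam"
    and cert: "\<And>e g. \<forall>t. \<bar>e t\<bar> = 1 \<Longrightarrow> \<forall>i. \<bar>g i\<bar> = 1 \<Longrightarrow>
      \<exists>q. (\<forall>t\<in>T. Q q t = e t) \<and> (\<forall>x. x \<notin> T \<longrightarrow> \<bar>Q q x\<bar> < 1) \<and>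
        (\<forall>i\<in>{1..n}. if w i = 0 then \<bar>q i\<bar> < lam else q i = lam * g i)"
  shows "is_unique_solution lam K J n s y (spikes T a) w"
proof -
  let ?\<mu> = "spikes T a"
  \<comment> \<open>\<open>cert\<close> asks for signs of modulus 1 everywhere, hence the value 1 at
    0.\<close>
  define sg :: "real \<Rightarrow> real" where "sg x = (if x < 0 then - 1 else 1)" for x
  have sg: "\<bar>sg x\<bar> = 1" "x * sg x = \<bar>x\<bar>" "sg x * x = \<bar>x\<bar>" for x
    by (simp_all add: sg_def)
  have K_cont: "continuous_on UNIV (\<lambda>t. K (x - t))" for x
    by (rule continuous_on_compose2 [OF K(1)]) (auto intro!: continuous_intros)
  have K_meas: "(\<lambda>t. K (x - t)) \<in> borel_measurable borel" for x
    by (rule borel_measurable_continuous_onI [OF K_cont])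
  have Q_meas: "Q q \<in> borel_measurable borel" for q
    unfolding Q_def by (intro borel_measurable_sum borel_measurable_times K_meas) simp
  \<comment> \<open>The right-hand side is the same for all feasible pairs; this is how the
    constraints enter.\<close>
  have pairing: "signed_integral borel \<nu> (Q q) + (\<Sum>i=1..n. q i * v i) = (\<Sum>i=1..n. q i * y i)"
    if "feasible K J n s y \<nu> v" for \<nu> v q
  proof -
    have "signed_integral borel \<nu> (Q q) = (\<Sum>i=1..n. q i * convolve K \<nu> (s i))"
      unfolding Q_def convolve_def using that K(2)
      by (intro signed_integral_sum K_meas) (auto simp: feasible_def)
    then have "signed_integral borel \<nu> (Q q) + (\<Sum>i=1..n. q i * v i)
        = (\<Sum>i=1..n. q i * (convolve K \<nu> (s i) + v i))"
      by (simp add: distrib_left sum.distrib)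
    also have "\<dots> = (\<Sum>i=1..n. q i * y i)"
      using that by (intro sum.cong) (auto simp: feasible_def)
    finally show ?thesis .
  qed
  have feasible: "feasible K J n s y ?\<mu> w"
    using y T signed_measure_spikes supported_on_spikes by (auto simp: feasible_def)
  have integral_T: "signed_integral borel \<nu> (Q q) = (\<Sum>t\<in>T. \<nu> {t} * Q q t)"
    if "signed_measure borel \<nu>" "supported_on borel T \<nu>" for \<nu> q
    using that T(1) Q_meas by (intro signed_integral_finite_support)
  have integral_\<mu>: "signed_integral borel ?\<mu> (Q q) = (\<Sum>t\<in>T. a t * Q q t)" for q
    using integral_T [OF signed_measure_spikes supported_on_spikes] T(1)
    by (simp add: spikes_singleton)
  obtain q where "\<forall>t\<in>T. Q q t = sg (a t)" "\<forall>x. x \<notin> T \<longrightarrow> \<bar>Q q x\<bar> < 1"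
    "\<forall>i\<in>{1..n}. if w i = 0 then \<bar>q i\<bar> < lam else q i = lam * sg (w i)"
    using cert [of "\<lambda>t. sg (a t)" "\<lambda>i. sg (w i)"] sg(1) by blast
  note q = this [rule_format]
  have Q_le: "\<bar>Q q x\<bar> \<le> 1" for x
    using q(1,2) [of x] sg(1) by (cases "x \<in> T") auto
  have q_le: "\<bar>q i\<bar> \<le> lam" if "i \<in> {1..n}" for i
    using q(3) [OF that] sg(1) [of "w i"] lam by (auto split: if_splits simp: abs_mult)
  define opt where "opt = (\<Sum>t\<in>T. \<bar>a t\<bar>) + lam * (\<Sum>i=1..n. \<bar>w i\<bar>)"
  have "(\<Sum>i=1..n. q i * w i) = (\<Sum>i=1..n. lam * \<bar>w i\<bar>)"
  proof (intro sum.cong refl)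
    fix i
    assume "i \<in> {1..n}"
    then show "q i * w i = lam * \<bar>w i\<bar>"
      using q(3) [of i] sg(3) [of "w i"] by (auto split: if_splits)
  qed
  moreover have "(\<Sum>t\<in>T. a t * Q q t) = (\<Sum>t\<in>T. \<bar>a t\<bar>)"
    using q(1) sg(2) by (intro sum.cong) auto
  ultimately have opt: "(\<Sum>i=1..n. q i * y i) = opt"
    using pairing [OF feasible, of q] integral_\<mu> [of q] by (simp add: opt_def sum_distrib_left)
  have objective_\<mu>: "objective lam n ?\<mu> w \<le> ereal opt"
    using add_right_mono [OF tv_norm_spikes_le [OF T(1)], of borel a "ereal (lam * (\<Sum>i=1..n. \<bar>w i\<bar>))"]
    by (simp add: objective_def opt_def)
  have main: "ereal opt \<le> objective lam n \<nu> v \<and>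
      (objective lam n \<nu> v \<le> ereal opt \<longrightarrow>
        supported_on borel T \<nu> \<and> (\<forall>i\<in>{1..n}. w i = 0 \<longrightarrow> v i = 0))"
    if feas: "feasible K J n s y \<nu> v" for \<nu> v
  proof -
    have sm: "signed_measure borel \<nu>"
      using feas by (simp add: feasible_def)
    define U where "U = upper_variation borel \<nu>"
    define L where "L = upper_variation borel (\<lambda>A. - \<nu> A)"
    note jordan = Jordan_decomposition [OF sm, folded U_def L_def]
    interpret U: finite_measure U by (rule jordan(1))
    interpret L: finite_measure L by (rule jordan(2))
    have sets: "sets U = sets borel" "sets L = sets borel" "space U = UNIV" "space L = UNIV"
      by (simp_all add: U_def L_def)
    have meas: "Q q \<in> borel_measurable U" "Q q \<in> borel_measurable L"
      unfolding measurable_cong_sets [OF sets(1) refl] measurable_cong_sets [OF sets(2) refl] by (rule Q_meas)+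
    have int: "integrable U (Q q)" "integrable L (Q q)"
      using Q_le meas by (auto intro!: U.integrable_const_bound [of _ 1] L.integrable_const_bound [of _ 1])
    \<comment> \<open>The duality gap in three nonnegative parts: how far \<open>Q q\<close> is from
      1 on the positive part of \<nu>, from - 1 on the negative part, and \<open>q i * v i\<close>
      from \<open>lam * \<bar>v i\<bar>\<close>. A competitor that is as good as \<open>opt\<close>
      makes all three vanish.\<close>
    define dU where "dU = (\<integral>x. 1 - Q q x \<partial>U)"
    define dL where "dL = (\<integral>x. 1 + Q q x \<partial>L)"
    define dv where "dv = (\<Sum>i=1..n. lam * \<bar>v i\<bar> - q i * v i)"
    have dv_term: "0 \<le> lam * \<bar>v i\<bar> - q i * v i" if "i \<in> {1..n}" for i
    proof -
      have "q i * v i \<le> \<bar>q i\<bar> * \<bar>v i\<bar>"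
        using abs_ge_self [of "q i * v i"] by (simp add: abs_mult)
      also have "\<dots> \<le> lam * \<bar>v i\<bar>"
        using q_le [OF that] by (intro mult_right_mono) auto
      finally show ?thesis
        by simp
    qed
    have nonneg: "0 \<le> 1 - Q q x" "0 \<le> 1 + Q q x" for x
      using Q_le [of x] by (auto simp: abs_le_iff)
    have ge: "0 \<le> dU" "0 \<le> dL" "0 \<le> dv"
      unfolding dU_def dL_def dv_def using nonneg dv_term by (auto intro!: integral_nonneg_AE sum_nonneg)
    have "opt = signed_integral borel \<nu> (Q q) + (\<Sum>i=1..n. q i * v i)"
      using pairing [OF feas, of q] opt by simp
    also have "signed_integral borel \<nu> (Q q) = (measure U UNIV - dU) + (measure L UNIV - dL)"
      using int sets by (simp add: signed_integral_def dU_def dL_def flip: U_def L_def)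
    also have "(\<Sum>i=1..n. q i * v i) = lam * (\<Sum>i=1..n. \<bar>v i\<bar>) - dv"
      by (simp add: dv_def sum_subtractf sum_distrib_left)
    finally have gap: "measure U UNIV + measure L UNIV + lam * (\<Sum>i=1..n. \<bar>v i\<bar>) = opt + (dU + dL + dv)"
      by simp
    have lower: "ereal (opt + (dU + dL + dv)) \<le> objective lam n \<nu> v"
      using add_right_mono [OF jordan(4), of "ereal (lam * (\<Sum>i=1..n. \<bar>v i\<bar>))"] gap
      by (simp add: objective_def)
    show ?thesis
    proof (intro conjI impI)
      have "ereal opt \<le> ereal (opt + (dU + dL + dv))"
        using ge by simp
      then show "ereal opt \<le> objective lam n \<nu> v"
        using lower by (rule order_trans)
      assume "objective lam n \<nu> v \<le> ereal opt"
      with lower have "ereal (opt + (dU + dL + dv)) \<le> ereal opt"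
        by (rule order_trans)
      then have zero: "dU = 0" "dL = 0" "dv = 0"
        using ge by simp_all
      have T_sets: "- T \<in> sets borel"
        using T(1) by (intro borel_open open_Compl finite_imp_closed)
      have Q_lt: "Q q x = 1 \<Longrightarrow> x \<in> T" "Q q x = - 1 \<Longrightarrow> x \<in> T" for x
        using q(2) [of x] by fastforce+
      have "integrable U (\<lambda>x. 1 - Q q x)"
        using int by simp
      then have "AE x in U. 1 - Q q x = 0"
        using zero(1) nonneg(1) by (intro iffD1 [OF integral_nonneg_eq_0_iff_AE]) (simp_all add: dU_def)
      then have "AE x in U. x \<notin> - T"
        by (rule AE_mp) (use Q_lt in auto)
      then have null_U: "measure U (- T) = 0"
        using T_sets sets by (subst (asm) AE_iff_measurable [OF _ refl])
          (auto simp: measure_def Compl_eq)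
      have "integrable L (\<lambda>x. 1 + Q q x)"
        using int by simp
      then have "AE x in L. 1 + Q q x = 0"
        using zero(2) nonneg(2) by (intro iffD1 [OF integral_nonneg_eq_0_iff_AE]) (simp_all add: dL_def)
      then have "AE x in L. x \<notin> - T"
        by (rule AE_mp) (use Q_lt in \<open>auto simp: add_eq_0_iff\<close>)
      then have null_L: "measure L (- T) = 0"
        using T_sets sets by (subst (asm) AE_iff_measurable [OF _ refl])
          (auto simp: measure_def Compl_eq)
      show "supported_on borel T \<nu>"
        unfolding supported_on_def
      proof (intro ballI impI)
        fix A
        assume A: "A \<in> sets borel" "A \<inter> T = {}"
        have "measure U A \<le> measure U (- T)" "measure L A \<le> measure L (- T)"
          using A T_sets sets by (auto intro!: U.finite_measure_mono L.finite_measure_mono)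
        then have "measure U A = 0" "measure L A = 0"
          using null_U null_L by (simp_all add: order_antisym)
        then show "\<nu> A = 0"
          using jordan(3) [OF A(1)] by simp
      qed
      show "\<forall>i\<in>{1..n}. w i = 0 \<longrightarrow> v i = 0"
      proof (intro ballI impI)
        fix i
        assume i: "i \<in> {1..n}" "w i = 0"
        have "lam * \<bar>v i\<bar> - q i * v i = 0"
          using zero(3) dv_term i(1) unfolding dv_def by (subst (asm) sum_nonneg_eq_0_iff) auto
        moreover have "q i * v i \<le> \<bar>q i\<bar> * \<bar>v i\<bar>"
          using abs_ge_self [of "q i * v i"] by (simp add: abs_mult)
        ultimately have "(lam - \<bar>q i\<bar>) * \<bar>v i\<bar> \<le> 0"
          by (simp add: left_diff_distrib)
        moreover have "0 < lam - \<bar>q i\<bar>"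
          using q(3) [OF i(1)] i(2) by simp
        ultimately show "v i = 0"
          by (simp add: mult_le_0_iff)
      qed
    qed
  qed
  have solution: "is_solution lam K J n s y ?\<mu> w"
    unfolding is_solution_def using feasible main objective_\<mu> by (auto intro: order_trans)
  have unique: "signed_measure_eq borel \<nu> ?\<mu> \<and> (\<forall>i\<in>{1..n}. v i = w i)"
    if sol: "is_solution lam K J n s y \<nu> v" for \<nu> v
  proof -
    have feas: "feasible K J n s y \<nu> v"
      using sol by (simp add: is_solution_def)
    have "objective lam n \<nu> v \<le> objective lam n ?\<mu> w"
      using sol feasible by (simp add: is_solution_def)
    then have "objective lam n \<nu> v \<le> ereal opt"
      using objective_\<mu> by (rule order_trans)
    then have supp: "supported_on borel T \<nu>" "\<And>i. i \<in> {1..n} \<Longrightarrow> w i = 0 \<Longrightarrow> v i = 0"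
      using main [OF feas] by auto
    have sm: "signed_measure borel \<nu>"
      using feas by (simp add: feasible_def)
    define h where "h t = \<nu> {t} - a t" for t
    define d where "d i = v i - w i" for i
    obtain p where "\<forall>t\<in>T. Q p t = sg (h t)"
      "\<forall>i\<in>{1..n}. if w i = 0 then \<bar>p i\<bar> < lam else p i = lam * sg (d i)"
      using cert [of "\<lambda>t. sg (h t)" "\<lambda>i. sg (d i)"] sg(1) by blast
    note p = this [rule_format]
    have "(\<Sum>t\<in>T. \<nu> {t} * Q p t) + (\<Sum>i=1..n. p i * v i) = (\<Sum>t\<in>T. a t * Q p t) + (\<Sum>i=1..n. p i * w i)"
      using pairing [OF feas, of p] pairing [OF feasible, of p] integral_T [OF sm supp(1), of p]
        integral_\<mu> [of p] by simp
    then have "(\<Sum>t\<in>T. h t * Q p t) + (\<Sum>i=1..n. p i * d i) = 0"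
      by (simp add: h_def d_def left_diff_distrib right_diff_distrib sum_subtractf)
    moreover have "(\<Sum>t\<in>T. h t * Q p t) = (\<Sum>t\<in>T. \<bar>h t\<bar>)"
      using p(1) sg(2) by (intro sum.cong) auto
    moreover have "(\<Sum>i=1..n. p i * d i) = (\<Sum>i=1..n. lam * \<bar>d i\<bar>)"
    proof (intro sum.cong refl)
      fix i
      assume "i \<in> {1..n}"
      \<comment> \<open>At clean samples \<open>d i = 0\<close> by the first certificate, whatever
        \<open>p i\<close> is.\<close>
      then show "p i * d i = lam * \<bar>d i\<bar>"
        using p(2) [of i] supp(2) [of i] sg(3) [of "d i"] by (auto split: if_splits simp: d_def)
    qed
    ultimately have "(\<Sum>t\<in>T. \<bar>h t\<bar>) + (\<Sum>i=1..n. lam * \<bar>d i\<bar>) = 0"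
      by simp
    moreover have "0 \<le> (\<Sum>t\<in>T. \<bar>h t\<bar>)" "0 \<le> (\<Sum>i=1..n. lam * \<bar>d i\<bar>)"
      using lam by (auto intro!: sum_nonneg)
    ultimately have "(\<Sum>t\<in>T. \<bar>h t\<bar>) = 0" "(\<Sum>i=1..n. lam * \<bar>d i\<bar>) = 0"
      by linarith+
    then have "\<forall>t\<in>T. h t = 0" "\<forall>i\<in>{1..n}. d i = 0"
      using T(1) lam by (simp_all add: sum_nonneg_eq_0_iff)
    then have "spikes T (\<lambda>t. \<nu> {t}) = ?\<mu>" "\<forall>i\<in>{1..n}. v i = w i"
      by (auto simp: spikes_def h_def d_def intro!: ext sum.cong)
    then show ?thesis
      using signed_measure_eq_spikes [OF sm T(1) supp(1)] by simp
  qed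
  show ?thesis
    unfolding is_unique_solution_def using solution unique by blast
qed

section \<open>The recovery theorem\<close>

lemma ricker_eq_gauss_deriv: "ricker \<sigma> t = - gauss_deriv 2 (t / \<sigma>)"
proof -
  have "(t / \<sigma>)\<^sup>2 / 2 = t\<^sup>2 / (2 * \<sigma>\<^sup>2)"
    by (simp add: power_divide)
  then show ?thesis
    by (simp add: ricker_def gauss_deriv_def hermite_simps power_divide algebra_simps)
qed

lemma abs_ricker_le: "\<bar>ricker \<sigma> t\<bar> \<le> 1"
proof (cases "\<bar>t / \<sigma>\<bar> \<le> 1")
  case True
  then have "(t / \<sigma>)\<^sup>2 \<le> 1"
    by (simp only: abs_square_le_1)
  then show ?thesis
    using gauss_deriv_2_near_0 [OF True] by (simp add: ricker_eq_gauss_deriv abs_le_iff)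
next
  case False
  then show ?thesis
    using abs_gauss_deriv_2_le_from_1 [of "t / \<sigma>"] by (simp add: ricker_eq_gauss_deriv)
qed

lemma ricker_minus: "ricker \<sigma> (- t) = ricker \<sigma> t"
  by (simp add: ricker_def)

lemma min_separationD:
  assumes "ereal d \<le> min_separation A" "a \<in> A" "b \<in> A" "a \<noteq> b"
  shows "d \<le> \<bar>a - b\<bar>"
proof -
  have "min_separation A \<le> ereal \<bar>a - b\<bar>"
    unfolding min_separation_def using assms(2-4) by (intro INF_lower2 [of "(a, b)"]) auto
  then show ?thesis
    using order_trans [OF assms(1), of "ereal \<bar>a - b\<bar>"] by simp
qed

text \<open>A union is no larger than the sum of the sizes, so there is no slack. This turns the
  counting hypotheses into information on every single spike and corruption.\<close>

lemma card_UN_eq_double: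
  assumes A: "finite A" and F: "\<And>a. a \<in> A \<Longrightarrow> card (F a) \<le> 2"
    and eq: "card (\<Union>a\<in>A. F a) = 2 * card A" and a: "a \<in> A"
  shows "card (F a) = 2"
proof (rule ccontr)
  assume "card (F a) \<noteq> 2"
  then have "\<exists>a\<in>A. card (F a) < 2"
    using F [OF a] a by (intro bexI [of _ a]) auto
  then have "(\<Sum>a\<in>A. card (F a)) < (\<Sum>a\<in>A. 2)"
    using A F by (intro sum_strict_mono_ex1) auto
  then show False
    using card_UN_le [OF A, of F] eq by simp
qed

lemma card_le_1_if_subset_singleton: "A \<subseteq> {x} \<Longrightarrow> card A \<le> 1"
  using card_mono [of "{x}" A] by simp

section \<open>The grid and the counting hypotheses\<close>

locale sample_grid =
  fixes n :: nat and s :: "nat \<Rightarrow> real" and \<tau> :: real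
  assumes step: "\<And>i. i \<in> {1..<n} \<Longrightarrow> s (i + 1) = s i + \<tau>" and \<tau>_pos: "0 < \<tau>"
begin

lemma grid_diff:
  assumes "i \<in> {1..n}" "j \<in> {1..n}"
  shows "s j - s i = (real j - real i) * \<tau>"
proof -
  have "s (Suc k) = s 1 + real k * \<tau>" if "Suc k \<le> n" for k
    using that
  proof (induction k)
    case (Suc k)
    then show ?case
      using step [of "Suc k"] by (simp add: algebra_simps)
  qed simp
  from this [of "i - 1"] this [of "j - 1"] assms show ?thesis
    by (simp add: of_nat_diff algebra_simps)
qed

lemma grid_inj: "i \<in> {1..n} \<Longrightarrow> j \<in> {1..n} \<Longrightarrow> s i = s j \<longleftrightarrow> i = j"
  using grid_diff [of i j] \<tau>_pos by auto

lemma cell_unique: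
  assumes "i \<in> {1..<n}" "j \<in> {1..<n}" "s i \<le> t" "t < s (i + 1)" "s j \<le> t" "t < s (j + 1)"
  shows "i = j"
proof -
  have "\<bar>s j - s i\<bar> < \<tau>"
    using assms step by (auto simp: abs_less_iff)
  then have "\<bar>real j - real i\<bar> * \<tau> < 1 * \<tau>"
    using grid_diff [of i j] assms(1,2) \<tau>_pos by (simp add: abs_mult)
  then show ?thesis
    using \<tau>_pos by simp
qed

text \<open>A spike outside the grid would contribute no neighbour, and one in a cell contributes
  only the clean ones among its two endpoints; the count demands two from each.\<close>

lemma spike_cells:
  assumes T: "finite T" "card (spike_neighbours n s N T) = 2 * card T" and t: "t \<in> T"
  shows "\<exists>i\<in>{1..<n}. s i \<le> t \<and> t < s (i + 1) \<and> s i \<notin> N \<and> s (i + 1) \<notin> N"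
proof -
  define F where "F t = spike_neighbours n s N {t}" for t
  have cell: "\<exists>i\<in>{1..<n}. s i \<le> t \<and> t < s (i + 1) \<and> F t \<subseteq> {s i, s (i + 1)} - N" if nonempty: "F t \<noteq> {}" for t
  proof -
    obtain i where i: "i \<in> {1..<n}" "s i \<le> t" "t < s (i + 1)"
      using nonempty by (auto simp: F_def spike_neighbours_def)
    then have "F t \<subseteq> {s i, s (i + 1)} - N"
      using cell_unique [OF i(1)] by (auto simp: F_def spike_neighbours_def)
    then show ?thesis
      using i by blast
  qed
  have "card (F t) \<le> 2" for t
  proof (cases "F t = {}")
    case False
    then obtain i where "F t \<subseteq> {s i, s (i + 1)}"
      using cell by blast
    then have "card (F t) \<le> card {s i, s (i + 1)}"
      by (intro card_mono) auto
    then show ?thesis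
      using card_insert_le_m1 [of 2 "{s (i + 1)}" "s i"] by simp
  qed simp
  moreover have "(\<Union>t\<in>T. F t) = spike_neighbours n s N T"
    unfolding F_def spike_neighbours_def by blast
  ultimately have card: "card (F t) = 2"
    using T t by (intro card_UN_eq_double [of T F]) simp_all
  then obtain i where i: "i \<in> {1..<n}" "s i \<le> t" "t < s (i + 1)" "F t \<subseteq> {s i, s (i + 1)} - N"
    using cell [of t] by fastforce
  have "s i \<notin> N" "s (i + 1) \<notin> N"
    using i(4) card card_le_1_if_subset_singleton [of "F t" "s i"]
      card_le_1_if_subset_singleton [of "F t" "s (i + 1)"] by auto
  then show ?thesis
    using i by blast
qed

text \<open>A corruption at an end of the grid or beside another corruption would have fewer than
  two clean neighbours, which the count excludes.\<close>

lemma noise_cells: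
  assumes N: "finite N" "N \<subseteq> s ` {1..n}" "card (noise_neighbours n s N) = 2 * card N"
    and m: "m \<in> {1..n}" "s m \<in> N"
  shows "m - 1 \<in> {1..<n}" "m \<in> {1..<n}" "s (m - 1) \<notin> N" "s (m + 1) \<notin> N"
proof -
  define F where "F a = {s i | i. i \<in> {1..<n} \<and> s i \<notin> N \<and> s (i + 1) = a} \<union>
    {s (i + 1) | i. i \<in> {1..<n} \<and> s (i + 1) \<notin> N \<and> s i = a}" for a
  \<comment> \<open>The ends of the grid are covered: for \<open>k = 1\<close> the index
    \<open>k - 1 = 0\<close> is out of range, and so is \<open>k\<close> itself for
    \<open>k = n\<close>.\<close>
  have F_grid: "F (s k) = (if k - 1 \<in> {1..<n} \<and> s (k - 1) \<notin> N then {s (k - 1)} else {}) \<union>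
      (if k \<in> {1..<n} \<and> s (k + 1) \<notin> N then {s (k + 1)} else {})" if k: "k \<in> {1..n}" for k
  proof -
    have "{s i | i. i \<in> {1..<n} \<and> s i \<notin> N \<and> s (i + 1) = s k} = (if k - 1 \<in> {1..<n} \<and> s (k - 1) \<notin> N then {s (k - 1)} else {})"
    proof -
      have "i \<in> {1..<n} \<Longrightarrow> s (i + 1) = s k \<longleftrightarrow> i = k - 1 \<and> k - 1 \<in> {1..<n}" for i
        using grid_inj [of "i + 1" k] k by auto
      then show ?thesis
        by auto
    qed
    moreover have "{s (i + 1) | i. i \<in> {1..<n} \<and> s (i + 1) \<notin> N \<and> s i = s k} = (if k \<in> {1..<n} \<and> s (k + 1) \<notin> N then {s (k + 1)} else {})"
    proof -
      have "i \<in> {1..<n} \<Longrightarrow> s i = s k \<longleftrightarrow> i = k" for i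
        using grid_inj [of i k] k by auto
      then show ?thesis
        by auto
    qed
    ultimately show ?thesis
      unfolding F_def by simp
  qed
  have "card (F a) \<le> 2" if a: "a \<in> N" for a
  proof -
    obtain k where "k \<in> {1..n}" "a = s k"
      using a N(2) by blast
    then show ?thesis
      using F_grid [of k] card_insert_le_m1 [of 2 "{s (k + 1)}" "s (k - 1)"] by (simp add: insert_commute)
  qed
  moreover have "(\<Union>a\<in>N. F a) = noise_neighbours n s N"
    unfolding F_def noise_neighbours_def by blast
  ultimately have "card (F (s m)) = 2"
    using N m by (intro card_UN_eq_double [of N F]) simp_all
  then show "m - 1 \<in> {1..<n}" "m \<in> {1..<n}" "s (m - 1) \<notin> N" "s (m + 1) \<notin> N"
    unfolding F_grid [OF m(1)] by (auto split: if_splits)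
qed

end

theorem theorem2p10:
  fixes \<sigma> \<tau> lo hi :: real
    and T :: "real set" and a :: "real \<Rightarrow> real"
    and n :: nat and s w y :: "nat \<Rightarrow> real"
    and \<mu> :: "real set \<Rightarrow> real" and N I C :: "real set"
  assumes "\<sigma> > 0"
    and "finite T"
    and "\<mu> = spikes T a"
    and "lo \<le> hi" and "T \<subseteq> {lo..hi}"
    and "\<tau> \<in> {0.0775 * \<sigma> .. 0.165 * \<sigma>}"
    and "\<forall>i\<in>{1..<n}. s (i + 1) = s i + \<tau>"
    and "\<forall>i\<in>{1..n}. y i = convolve (ricker \<sigma>) \<mu> (s i) + w i"
    and "N = noise_locations n s w"
    and "I = spike_neighbours n s N T"
    and "C = noise_neighbours n s N"
    and "card I = 2 * card T"
    and "card C = 2 * card N"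
    and "C \<inter> I = {}"
    and "min_separation T \<ge> ereal (5.056 * \<sigma>)"
    and "min_separation N \<ge> ereal (5.056 * \<sigma>)"
  shows "is_unique_solution 2 (ricker \<sigma>) {lo..hi} n s y \<mu> w"
proof -
  note \<sigma> = \<open>\<sigma> > 0\<close>
  have \<tau>: "31/400 * \<sigma> \<le> \<tau>" "\<tau> \<le> 33/200 * \<sigma>"
    using assms(6) by simp_all
  then have step_pos: "0 < \<tau>"
    using \<sigma> by linarith
  interpret sample_grid n s \<tau>
    using assms(7) step_pos by unfold_locales auto
  define W where "W = {i \<in> {1..n}. w i \<noteq> 0}"
  have W: "finite W" "W \<subseteq> {1..n}" "N = s ` W"
    using assms(9) by (auto simp: W_def noise_locations_def)
  have in_N: "s i \<in> N \<longleftrightarrow> w i \<noteq> 0" if "i \<in> {1..n}" for i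
    using that W(2) grid_inj unfolding W(3) by (auto simp: W_def)
  have N: "finite N" "N \<subseteq> s ` {1..n}" "card (noise_neighbours n s N) = 2 * card N"
    using W assms(11,13) by auto
  have sep: "5 * \<sigma> \<le> \<bar>x - x'\<bar>" if "x \<in> T \<and> x' \<in> T \<or> x \<in> N \<and> x' \<in> N" "x \<noteq> x'" for x x'
    using min_separationD [OF assms(15), of x x'] min_separationD [OF assms(16), of x x'] that \<sigma> by auto
  obtain \<iota> where \<iota>: "\<And>t. t \<in> T \<Longrightarrow> \<iota> t \<in> {1..<n}" "\<And>t. t \<in> T \<Longrightarrow> s (\<iota> t) \<le> t"
    "\<And>t. t \<in> T \<Longrightarrow> t < s (\<iota> t + 1)" "\<And>t. t \<in> T \<Longrightarrow> s (\<iota> t) \<notin> N" "\<And>t. t \<in> T \<Longrightarrow> s (\<iota> t + 1) \<notin> N"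
    using spike_cells [OF \<open>finite T\<close>, of N] assms(10,12) by metis
  have W_cells: "m - 1 \<in> {1..<n}" "m \<in> {1..<n}" "s (m - 1) \<notin> N" "s (m + 1) \<notin> N" if "m \<in> W" for m
    using noise_cells [OF N, of m] that W by auto
  have next_\<iota>: "s (\<iota> t + 1) = s (\<iota> t) + \<tau>" if "t \<in> T" for t
    using step [OF \<iota>(1) [OF that]] .
  have next_W: "s (m + 1) = s m + \<tau>" "s (m - 1) = s m - \<tau>" if "m \<in> W" for m
    using step [OF W_cells(2) [OF that]] step [OF W_cells(1) [OF that]] W_cells(1) [OF that] by auto
  have certificate: "\<exists>q. (\<forall>t\<in>T. (\<Sum>i=1..n. q i * ricker \<sigma> (s i - t)) = e t) \<and>
      (\<forall>x. x \<notin> T \<longrightarrow> \<bar>\<Sum>i=1..n. q i * ricker \<sigma> (s i - x)\<bar> < 1) \<and>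
      (\<forall>i\<in>{1..n}. if w i = 0 then \<bar>q i\<bar> < 2 else q i = 2 * g i)"
    if e: "\<forall>t. \<bar>e t\<bar> = 1" and g: "\<forall>i. \<bar>g i\<bar> = 1" for e :: "real \<Rightarrow> real" and g :: "nat \<Rightarrow> real"
  proof -
    let ?T = "(\<lambda>t. t / \<sigma>) ` T" and ?N = "(\<lambda>m. s m / \<sigma>) ` W"
    \<comment> \<open>Passage to \<sigma> = 1: locations are divided by \<sigma>, and
      \<open>h\<close> carries the noise signs from indices to scaled locations.\<close>
    define p where "p x = s (\<iota> (\<sigma> * x)) / \<sigma>" for x
    define h where "h x = g (inv_into W (\<lambda>m. s m / \<sigma>) x)" for x
    have inj_T: "inj_on (\<lambda>t. t / \<sigma>) T"
      using \<sigma> by (auto intro: inj_onI)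
    have inj_W: "inj_on (\<lambda>m. s m / \<sigma>) W"
    proof (rule inj_onI)
      fix m m'
      assume "m \<in> W" "m' \<in> W" and eq: "s m / \<sigma> = s m' / \<sigma>"
      then have "m \<in> {1..n}" "m' \<in> {1..n}"
        using W(2) by blast+
      then show "m = m'"
        using eq \<sigma> grid_inj by simp
    qed
    have scale: "5 \<le> \<bar>x / \<sigma> - x' / \<sigma>\<bar>" if "5 * \<sigma> \<le> \<bar>x - x'\<bar>" for x x'
      using that \<sigma> by (simp add: pos_le_divide_eq abs_divide flip: diff_divide_distrib)
    interpret spike_noise ?T ?N "\<tau> / \<sigma>" p "\<lambda>x. e (\<sigma> * x)" h
    proof
      show "finite ?T" "finite ?N"
        using \<open>finite T\<close> W(1) by simp_all
      show "5 \<le> \<bar>x - x'\<bar>" if "x \<in> ?T" "x' \<in> ?T" "x \<noteq> x'" for x x'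
        using that by (auto intro!: scale sep)
      show "5 \<le> \<bar>x - x'\<bar>" if "x \<in> ?N" "x' \<in> ?N" "x \<noteq> x'" for x x'
        using that unfolding W(3) by (auto intro!: scale sep simp: W(3))
      show "31/400 \<le> \<tau> / \<sigma>" "\<tau> / \<sigma> \<le> 33/200"
        using \<tau> \<sigma> by (simp_all add: pos_le_divide_eq pos_divide_le_eq)
      show "p t \<le> t" if "t \<in> ?T" for t
        using that \<sigma> \<iota>(2) by (auto simp: p_def divide_right_mono)
      show "t \<le> p t + \<tau> / \<sigma>" if "t \<in> ?T" for t
        using that \<sigma> \<iota>(3) next_\<iota> by (auto simp: p_def divide_right_mono less_imp_le simp flip: add_divide_distrib)
      show "\<bar>e (\<sigma> * t)\<bar> = 1" "\<bar>h t\<bar> = 1" for t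
        using e g by (simp_all add: h_def)
    qed
    obtain b c where bc: "\<And>t. t \<in> ?T \<Longrightarrow> \<bar>b t\<bar> < 2" "\<And>t. t \<in> ?T \<Longrightarrow> \<bar>c t\<bar> < 2"
      and at_T: "\<And>t. t \<in> ?T \<Longrightarrow>
        (\<Sum>k\<in>?T. b k * gauss_deriv 2 (t - p k) + c k * gauss_deriv 2 (t - p k - \<tau> / \<sigma>)) + noise 2 t = - e (\<sigma> * t)"
      and off_T: "\<And>x. x \<notin> ?T \<Longrightarrow>
        \<bar>(\<Sum>k\<in>?T. b k * gauss_deriv 2 (x - p k) + c k * gauss_deriv 2 (x - p k - \<tau> / \<sigma>)) + noise 2 x\<bar> < 1"
      by (rule certificate_exists) blast
    \<comment> \<open>\<open>P\<close> and \<open>R\<close> distribute the coefficients over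
      indices: \<open>b\<close> and \<open>c\<close> around a spike, \<open>2, - 1, - 1\<close> on a
      corruption and its neighbours. The subtraction \<open>m - 1\<close> is not truncated for
      \<open>m\<close> in \<open>W\<close>, since \<open>W_cells\<close> gives
      \<open>m \<ge> 2\<close>.\<close>
    define P where "P i t = (if i = \<iota> t then b (t / \<sigma>) else 0) + (if i = \<iota> t + 1 then c (t / \<sigma>) else 0)" for i t
    define R where "R i m = g m * (2 * (if i = m then 1 else 0) - (if i = m + 1 then 1 else 0) - (if i = m - 1 then 1 else 0))" for i m
    define q where "q i = (\<Sum>t\<in>T. P i t) + (\<Sum>m\<in>W. R i m)" for i
    have Q: "(\<Sum>i=1..n. q i * ricker \<sigma> (s i - x))
        = - ((\<Sum>k\<in>?T. b k * gauss_deriv 2 (x / \<sigma> - p k) + c k * gauss_deriv 2 (x / \<sigma> - p k - \<tau> / \<sigma>)) + noise 2 (x / \<sigma>))" for x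
    proof -
      have ricker: "ricker \<sigma> (z - x) = - gauss_deriv 2 (x / \<sigma> - z / \<sigma>)" for z
        using ricker_minus [of \<sigma> "x - z"] by (simp add: ricker_eq_gauss_deriv diff_divide_distrib)
      have pick: "(\<Sum>i=1..n. (if i = j then r else 0) * ricker \<sigma> (s i - x)) = r * ricker \<sigma> (s j - x)"
        if "j \<in> {1..n}" for j r
        using that by (simp add: if_distrib [of "\<lambda>z. z * _"] cong: if_cong)
      have "(\<Sum>i=1..n. q i * ricker \<sigma> (s i - x))
          = (\<Sum>t\<in>T. \<Sum>i=1..n. P i t * ricker \<sigma> (s i - x)) + (\<Sum>m\<in>W. \<Sum>i=1..n. R i m * ricker \<sigma> (s i - x))"
        unfolding q_def distrib_right sum.distrib sum_distrib_right
        by (rule arg_cong2 [where f = "(+)", OF sum.swap sum.swap])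
      also have "(\<Sum>t\<in>T. \<Sum>i=1..n. P i t * ricker \<sigma> (s i - x))
          = (\<Sum>t\<in>T. b (t / \<sigma>) * ricker \<sigma> (s (\<iota> t) - x) + c (t / \<sigma>) * ricker \<sigma> (s (\<iota> t + 1) - x))"
      proof (rule sum.cong [OF refl])
        fix t
        assume t: "t \<in> T"
        then have "\<iota> t \<in> {1..n}" "\<iota> t + 1 \<in> {1..n}"
          using \<iota>(1) by fastforce+
        then show "(\<Sum>i=1..n. P i t * ricker \<sigma> (s i - x))
            = b (t / \<sigma>) * ricker \<sigma> (s (\<iota> t) - x) + c (t / \<sigma>) * ricker \<sigma> (s (\<iota> t + 1) - x)"
          unfolding P_def distrib_right sum.distrib using pick by simp
      qed
      also have "(\<Sum>m\<in>W. \<Sum>i=1..n. R i m * ricker \<sigma> (s i - x))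
          = (\<Sum>m\<in>W. g m * (2 * ricker \<sigma> (s m - x) - ricker \<sigma> (s (m + 1) - x) - ricker \<sigma> (s (m - 1) - x)))"
      proof (rule sum.cong [OF refl])
        fix m
        assume m: "m \<in> W"
        then have "m \<in> {1..n}" "m + 1 \<in> {1..n}" "m - 1 \<in> {1..n}"
          using W_cells(1,2) [OF m] by auto
        then have "(\<Sum>i=1..n. (if i = m then 1 else 0) * ricker \<sigma> (s i - x)) = ricker \<sigma> (s m - x)"
          "(\<Sum>i=1..n. (if i = m + 1 then 1 else 0) * ricker \<sigma> (s i - x)) = ricker \<sigma> (s (m + 1) - x)"
          "(\<Sum>i=1..n. (if i = m - 1 then 1 else 0) * ricker \<sigma> (s i - x)) = ricker \<sigma> (s (m - 1) - x)"
          using pick [of _ 1] by simp_all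
        then show "(\<Sum>i=1..n. R i m * ricker \<sigma> (s i - x))
            = g m * (2 * ricker \<sigma> (s m - x) - ricker \<sigma> (s (m + 1) - x) - ricker \<sigma> (s (m - 1) - x))"
          unfolding R_def mult.assoc left_diff_distrib sum_distrib_left [symmetric] sum_subtractf by simp
      qed
      also have "(\<Sum>t\<in>T. b (t / \<sigma>) * ricker \<sigma> (s (\<iota> t) - x) + c (t / \<sigma>) * ricker \<sigma> (s (\<iota> t + 1) - x))
          = - (\<Sum>k\<in>?T. b k * gauss_deriv 2 (x / \<sigma> - p k) + c k * gauss_deriv 2 (x / \<sigma> - p k - \<tau> / \<sigma>))"
        using \<sigma> unfolding sum.reindex [OF inj_T] sum_negf [symmetric]
        by (intro sum.cong) (simp_all add: ricker p_def next_\<iota> [simplified] add_divide_distrib diff_diff_eq)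
      also have "(\<Sum>m\<in>W. g m * (2 * ricker \<sigma> (s m - x) - ricker \<sigma> (s (m + 1) - x) - ricker \<sigma> (s (m - 1) - x)))
          = - noise 2 (x / \<sigma>)"
        unfolding noise_def sum.reindex [OF inj_W] sum_negf [symmetric]
      proof (intro sum.cong refl)
        fix m
        assume m: "m \<in> W"
        have "h (s m / \<sigma>) = g m"
          using inv_into_f_f [OF inj_W m] by (simp add: h_def)
        moreover have "ricker \<sigma> (s (m + 1) - x) = - gauss_deriv 2 (x / \<sigma> - s m / \<sigma> - \<tau> / \<sigma>)"
          "ricker \<sigma> (s (m - 1) - x) = - gauss_deriv 2 (x / \<sigma> - s m / \<sigma> + \<tau> / \<sigma>)"
          unfolding ricker next_W [OF m] by (simp_all add: add_divide_distrib diff_divide_distrib algebra_simps)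
        ultimately show "g m * (2 * ricker \<sigma> (s m - x) - ricker \<sigma> (s (m + 1) - x) - ricker \<sigma> (s (m - 1) - x))
            = - ((\<lambda>s. h s * (2 * gauss_deriv 2 (x / \<sigma> - s) - gauss_deriv 2 (x / \<sigma> - s - \<tau> / \<sigma>)
              - gauss_deriv 2 (x / \<sigma> - s + \<tau> / \<sigma>))) \<circ> (\<lambda>m. s m / \<sigma>)) m"
          unfolding comp_def ricker by (simp add: algebra_simps)
      qed
      finally show ?thesis
        by simp
    qed
    \<comment> \<open>Two spikes around a common sample would be at most 2 \<tau> < 5 \<sigma>
      apart; the same holds for corruptions below.\<close>
    have spike_once: "t = t'" if "t \<in> T" "t' \<in> T" "i = \<iota> t \<or> i = \<iota> t + 1" "i = \<iota> t' \<or> i = \<iota> t' + 1" for t t' i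
    proof -
      have "\<bar>r - s i\<bar> \<le> \<tau>" if "r \<in> T" "i = \<iota> r \<or> i = \<iota> r + 1" for r
        using \<iota>(2,3) [OF that(1)] next_\<iota> [OF that(1)] that(2) by auto
      from this [of t] this [of t'] have "\<bar>t - s i\<bar> \<le> \<tau>" "\<bar>t' - s i\<bar> \<le> \<tau>"
        using that by blast+
      then have "\<bar>t - t'\<bar> < 5 * \<sigma>"
        using \<tau>(2) \<sigma> by linarith
      then show ?thesis
        using sep [of t t'] that(1,2) by auto
    qed
    have noise_once: "m = m'" if "m \<in> W" "m' \<in> W" "i = m + 1 \<or> i = m - 1" "i = m' + 1 \<or> i = m' - 1" for m m' i
    proof -
      have "\<bar>s k - s i\<bar> \<le> \<tau>" if "k \<in> W" "i = k + 1 \<or> i = k - 1" for k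
        using next_W [OF that(1)] that(2) step_pos by auto
      from this [of m] this [of m'] have "\<bar>s m - s i\<bar> \<le> \<tau>" "\<bar>s m' - s i\<bar> \<le> \<tau>"
        using that by blast+
      then have "\<bar>s m - s m'\<bar> < 5 * \<sigma>"
        using \<tau>(2) \<sigma> by linarith
      then have "s m = s m'"
        using sep [of "s m" "s m'"] that(1,2) W(3) by auto
      then show ?thesis
        using grid_inj that(1,2) W(2) by blast
    qed
    have P_le: "\<bar>P i t\<bar> < 2" if "t \<in> T" for i t
      using bc [of "t / \<sigma>"] that by (auto simp: P_def)
    \<comment> \<open>At a corrupted sample only its own pattern contributes, since the neighbours
      of spikes and of corruptions are clean. A neighbour of a spike lies in \<open>I\<close>, hence
      not in \<open>C\<close>, and carries a single \<open>b\<close> or \<open>c\<close>. Any other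
      clean sample carries at most one coefficient of modulus 1.\<close>
    have q_bound: "if w i = 0 then \<bar>q i\<bar> < 2 else q i = 2 * g i" if i: "i \<in> {1..n}" for i
    proof (cases "w i = 0")
      case False
      then have iN: "s i \<in> N" "i \<in> W"
        using in_N i by (auto simp: W_def)
      have "(\<Sum>t\<in>T. P i t) = 0"
        using iN(1) \<iota>(4,5) by (intro sum.neutral) (auto simp: P_def)
      moreover have "(\<Sum>m\<in>W. R i m) = (\<Sum>m\<in>W. if i = m then 2 * g m else 0)"
        using iN(1) W_cells(3,4) by (intro sum.cong) (auto simp: R_def)
      ultimately show ?thesis
        using False iN(2) W(1) by (simp add: q_def)
    next
      case True
      then have iN: "s i \<notin> N" "i \<notin> W"
        using in_N i by (auto simp: W_def)
      show ?thesis
      proof (cases "\<exists>t\<in>T. i = \<iota> t \<or> i = \<iota> t + 1")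
        case True
        then obtain t where t: "t \<in> T" "i = \<iota> t \<or> i = \<iota> t + 1"
          by blast
        have "s i \<in> I"
          using t(2) \<iota>(1-3) [OF t(1)] iN(1) t(1) unfolding assms(10) spike_neighbours_def by blast
        then have "s i \<notin> C"
          using assms(14) by blast
        have "i \<noteq> m + 1 \<and> i \<noteq> m - 1" if m: "m \<in> W" for m
        proof -
          have "s m \<in> N"
            using m W(3) by blast
          then have "s (m + 1) \<in> C" "s (m - 1) \<in> C"
            using W_cells [OF m] unfolding assms(11) noise_neighbours_def by (auto intro: exI [of _ "m - 1"])
          then show ?thesis
            using \<open>s i \<notin> C\<close> by auto
        qed
        then have "(\<Sum>m\<in>W. R i m) = 0"
          using iN(2) by (intro sum.neutral) (auto simp: R_def)
        moreover have "(\<Sum>t\<in>T. P i t) = P i t + (\<Sum>t\<in>T - {t}. P i t)"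
          using \<open>finite T\<close> t(1) by (rule sum.remove)
        moreover have "(\<Sum>t\<in>T - {t}. P i t) = 0"
          using spike_once [OF t(1) _ t(2)] by (intro sum.neutral) (auto simp: P_def)
        ultimately show ?thesis
          using P_le [OF t(1), of i] \<open>w i = 0\<close> by (simp add: q_def)
      next
        case False
        then have "(\<Sum>t\<in>T. P i t) = 0"
          by (intro sum.neutral) (auto simp: P_def)
        moreover have "\<bar>\<Sum>m\<in>W. R i m\<bar> < 2"
        proof (cases "\<exists>m\<in>W. i = m + 1 \<or> i = m - 1")
          case True
          then obtain m where m: "m \<in> W" "i = m + 1 \<or> i = m - 1"
            by blast
          have "(\<Sum>m\<in>W. R i m) = R i m + (\<Sum>m\<in>W - {m}. R i m)"
            using W(1) m(1) by (rule sum.remove)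
          moreover have "(\<Sum>m\<in>W - {m}. R i m) = 0"
            using noise_once [OF m(1) _ m(2)] iN(2) by (intro sum.neutral) (auto simp: R_def)
          moreover have "R i m = - g m"
          proof -
            have "i \<noteq> m"
              using iN(2) m(1) by blast
            from m(2) show ?thesis
            proof
              assume "i = m + 1"
              then have eqs: "(i = m) = False" "(i = m + 1) = True" "(i = m - 1) = False"
                by simp_all
              show ?thesis
                unfolding R_def eqs by simp
            next
              assume "i = m - 1"
              then have eqs: "(i = m) = False" "(i = m + 1) = False" "(i = m - 1) = True"
                using \<open>i \<noteq> m\<close> by simp_all
              show ?thesis
                unfolding R_def eqs by simp
            qed
          qed
          ultimately have "(\<Sum>m\<in>W. R i m) = - g m"
            by linarith
          moreover have "\<bar>g m\<bar> = 1"
            using g by blast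
          ultimately show ?thesis
            by linarith
        next
          case False
          then have "(\<Sum>m\<in>W. R i m) = 0"
            using iN(2) by (intro sum.neutral) (auto simp: R_def)
          then show ?thesis
            by simp
        qed
        ultimately show ?thesis
          using \<open>w i = 0\<close> by (simp add: q_def)
      qed
    qed
    have "(\<Sum>i=1..n. q i * ricker \<sigma> (s i - t)) = e t" if "t \<in> T" for t
      unfolding Q using at_T [of "t / \<sigma>"] that \<sigma> by simp
    moreover have "\<bar>\<Sum>i=1..n. q i * ricker \<sigma> (s i - x)\<bar> < 1" if "x \<notin> T" for x
    proof -
      have "x / \<sigma> \<notin> ?T"
        using that \<sigma> by auto
      from off_T [OF this] show ?thesis
        unfolding Q by simp
    qed
    ultimately show ?thesis
      using q_bound by blast
  qed
  have "continuous_on UNIV (ricker \<sigma>)"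
    unfolding ricker_def using \<sigma> by (auto intro!: continuous_intros)
  then show ?thesis
    unfolding assms(3) using assms(2,3,5,8) certificate abs_ricker_le
    by (intro unique_solution_criterion [of "ricker \<sigma>" 1]) auto
qed

end
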